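(* Let $\mathbf A_n,\mathbf M_n$ be real symmetric $n\times n$ matrices with $\sup_n\|\mathbf A_n\|<\infty$ and $\sup_n\|\mathbf M_n\|<\infty$ (operator norms). For parameters $(\tau,\boldsymbol\theta)$ let $\widehat{\mathrm{DE}}_M(\tau,\boldsymbol\theta)$, $\widehat{\mathrm{IE}}_M(\tau,\boldsymbol\theta)$ denote the outputs of either Algorithm 1 or Algorithm 2 (see context; for Algorithm 2, $\mathbf A_n=\beta\mathbf G_n$ is the Gaussian matrix described there) run with parameters $(\tau,\boldsymbol\theta)$. Let $(\tau_0,\boldsymbol\theta_0)$ be the true parameters and $(\hat\tau_{\mathrm{MPL}},\hat{\boldsymbol\theta}_{\mathrm{MPL}})$ the maximum pseudo-likelihood estimator. There exists $C_0>0$ such that, if $\limsup_n\|\mathbf A_n\|\le C_0$ (almost surely, when $\mathbf A_n$ is random), then for every fixed $M\ge 1$ and every $\varepsilon>0$, $$\lim_{n\to\infty}\mathbb P\Big(\big|\widehat{\mathrm{DE}}_M(\tau_0,\boldsymbol\theta_0)-\widehat{\mathrm{DE}}_M(\hat\tau_{\mathrm{MPL}},\hat{\boldsymbol\theta}_{\mathrm{MPL}})\big|>\varepsilon\Big)=0,$$ $$\lim_{n\to\infty}\mathbb P\Big(\big|\widehat{\mathrm{IE}}_M(\tau_0,\boldsymbol\theta_0)-\widehat{\mathrm{IE}}_M(\hat\tau_{\mathrm{MPL}},\hat{\boldsymbol\theta}_{\mathrm{MPL}})\big|>\varepsilon\Big)=0.$$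
   Context: Model. $d$ is fixed, $B,M_0>0$, $(\tau_0,\boldsymbol\theta_0)\in[-B,B]\times[-M_0,M_0]^d$. Covariates $\mathbf X_1,\dots,\mathbf X_n$ are i.i.d. from $\mathbb P_X$ on $[-1,1]^d$, whose covariance matrix has all eigenvalues in $[c,C]$, $0<c\le C<\infty$; $\mathbf X$ has rows $\mathbf X_i^\top$. Given $\mathbf X=\mathbf x$, $\mathbf T\in\{\pm1\}^n$ has law $\propto\exp(\frac12\mathbf t^\top\mathbf M_n\mathbf t+\sum_it_i\mathbf x_i^\top\boldsymbol\gamma_0)$ with $\boldsymbol\gamma_0\in[-M_0,M_0]^d$. Given $(\mathbf T,\mathbf X)=(\mathbf t,\mathbf x)$, $\mathbf Y\in[-1,1]^n$ has law $f(\mathbf y|\mathbf t,\mathbf x)\propto\exp(\frac12\mathbf y^\top\mathbf A_n\mathbf y+\mathbf y^\top(\tau_0\mathbf t+\mathbf x\boldsymbol\theta_0))\prod_id\mu(y_i)$, where $\mu$ is a probability measure on $[-1,1]$ with at least two support points. Estimator. $(\hat\tau_{\mathrm{MPL}},\hat{\boldsymbol\theta}_{\mathrm{MPL}})=\operatorname{argmax}_{\tau,\boldsymbol\theta}\prod_{i=1}^nf(\mathbf Y_i|\mathbf Y_{-i},\mathbf T,\mathbf X)$ over $[-B,B]\times[-M_0,M_0]^d$ (defined when the maximizer is unique; arbitrary in the parameter space otherwise), with conditional densities computed from the joint law on $[-1,1]^n$ proportional to $\exp(\frac12\mathbf y^\top\mathbf A_n\mathbf y+\mathbf y^\top(\tau\mathbf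 T+\mathbf X\boldsymbol\theta))\prod_id\mu(y_i)$, i.e. the outcome law $f(\cdot|\mathbf T,\mathbf X)$ with $(\tau_0,\boldsymbol\theta_0)$ replaced by $(\tau,\boldsymbol\theta)$. Function $\alpha$. $\alpha(\lambda_1,\lambda_2)=\log\int e^{\lambda_1x+\frac{\lambda_2}2x^2}d\mu(x)$ for $\lambda_1\in\mathbb R$, $\lambda_2\ge0$; $\alpha',\alpha''$ are derivatives in the first argument, applied coordinatewise. In both algorithms, $\bar{\mathbf T}\sim\mathrm{Unif}(\{\pm1\}^n)$ and $\bar{\mathbf X}$ with i.i.d. rows $\bar{\mathbf X}_i\sim\mathbb P_X$ are independent of each other and of the data, and the same draw is used for both parameter values. $\mathbb P$ is the joint probability over all randomness. Algorithm 1 with parameters $(\tau,\boldsymbol\theta)$: $\mathbf u^{(0)}=\tilde{\mathbf u}^{(0)}=\mathbf 0$, $\mathbf u^{(\ell+1)}=\alpha'(\mathbf A_n\mathbf u^{(\ell)}+\tau\bar{\mathbf T}+\bar{\mathbf X}\boldsymbol\theta,0)$, $\tilde{\mathbf u}^{(\ell+1)}=\alpha'(\mathbf A_n\tilde{\mathbf u}^{(\ell)}-\tau\mathbf 1+\bar{\mathbf X}\boldsymbol\theta,0)$; $\widehat{\mathrm{DE}}_M=\frac2n\sum_i\bar T_iu_i^{(M)}$, $\widehat{\mathrm{IE}}_M=\frac1n(\sum_iu_i^{(M)}-\sum_i\tilde u_i^{(M)})-\frac12\widehat{\mathrm{DE}}_M$. Algorithm 2 with parameters $(\tau,\boldsymbol\theta)$: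 here $\mathbf A_n=\beta\mathbf G_n$, $\beta>0$, $\mathbf G_n$ symmetric with zero diagonal and i.i.d. $\mathcal N(0,1/n)$ entries above the diagonal. With $T\sim\mathrm{Unif}(\{\pm1\})$, $H\stackrel d=\mathbf X_1^\top\boldsymbol\theta$, $G\sim\mathcal N(0,1)$ independent, let $(q_*,\sigma_{1,*}^2),(r_*,\sigma_{2,*}^2)\in[0,1]\times[0,\infty)$ be the solutions (unique for all small enough $\beta$) of $q_*=\mathbb E[(\alpha'(\tau T+H+\beta\sqrt{q_*}G,\beta^2\sigma_{1,*}^2))^2]$, $\sigma_{1,*}^2=\mathbb E[\alpha''(\tau T+H+\beta\sqrt{q_*}G,\beta^2\sigma_{1,*}^2)]$, and of the same system with $\tau T$ replaced by $-\tau$, for $(r_*,\sigma_{2,*}^2)$. Set $\mathbf u^{[0]}=\mathbf u^{[1]}=0$, $u_i^{[2]}=\sum_j\mathbf G_n(i,j)\sqrt{q_*}$, and with $h_i=\tau\bar T_i+\bar{\mathbf X}_i^\top\boldsymbol\theta$, for $k\ge2$, $$u_i^{[k+1]}=\sum_l\mathbf G_n(i,l)\alpha'(\beta u_l^{[k]}+h_l,\beta^2\sigma_{1,*}^2)-\Big(\frac\beta n\sum_j\alpha''(\beta u_j^{[k]}+h_j,\beta^2\sigma_{1,*}^2)\Big)\alpha'(\beta u_i^{[k-1]}+h_i,\beta^2\sigma_{1,*}^2).$$ Define $\tilde{\mathbf u}^{[k]}$ by the same recursion with $h_i$ replaced by $\tilde h_i=-\tau+\bar{\mathbf X}_i^\top\boldsymbol\theta$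 and $(q_*,\sigma_{1,*}^2)$ by $(r_*,\sigma_{2,*}^2)$. Set $\mathbf m^{[M]}=\alpha'(\beta\mathbf u^{[M]}+\mathbf h,\beta^2\sigma_{1,*}^2)$, $\tilde{\mathbf m}^{[M]}=\alpha'(\beta\tilde{\mathbf u}^{[M]}+\tilde{\mathbf h},\beta^2\sigma_{2,*}^2)$, $\widehat{\mathrm{DE}}_M=\frac2n\sum_i\bar T_im_i^{[M]}$, $\widehat{\mathrm{IE}}_M=\frac1n(\sum_im_i^{[M]}-\sum_i\tilde m_i^{[M]})-\frac12\widehat{\mathrm{DE}}_M$. *)

theory Defs
  imports "HOL-Probability.Probability"
begin

text \<open>
  Vectors in \<open>\<real>\<^sup>n\<close> and real n x n matrices are functions of indices below \<open>n\<close>, because the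
  size \<open>n\<close> tends to infinity; covariates and their coefficients live in \<open>real ^ 'd\<close>.  Random vectors
  and matrices follow the library convention for \<^const>\<open>PiM\<close>: they are \<^const>\<open>undefined\<close> outside
  the index range.
\<close>

definition mat_space :: "nat \<Rightarrow> (nat \<Rightarrow> nat \<Rightarrow> real) measure" where
  "mat_space n = (\<Pi>\<^sub>M i\<in>{..<n}. \<Pi>\<^sub>M j\<in>{..<n}. borel)"

definition sym_mat :: "nat \<Rightarrow> (nat \<Rightarrow> nat \<Rightarrow> real) \<Rightarrow> bool" where
  "sym_mat n A \<longleftrightarrow> (\<forall>i<n. \<forall>j<n. A i j = A j i)"

definition mat_vec :: "nat \<Rightarrow> (nat \<Rightarrow> nat \<Rightarrow> real) \<Rightarrow> (nat \<Rightarrow> real) \<Rightarrow> nat \<Rightarrow> real" where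
  "mat_vec n A x i = (\<Sum>j<n. A i j * x j)"

definition quad_form :: "nat \<Rightarrow> (nat \<Rightarrow> nat \<Rightarrow> real) \<Rightarrow> (nat \<Rightarrow> real) \<Rightarrow> real" where
  "quad_form n A x = (\<Sum>i<n. x i * mat_vec n A x i)"

definition op_norm :: "nat \<Rightarrow> (nat \<Rightarrow> nat \<Rightarrow> real) \<Rightarrow> real" where
  "op_norm n A = (SUP x\<in>{x. L2_set x {..<n} \<le> 1}. L2_set (mat_vec n A x) {..<n})"

definition support_points :: "real measure \<Rightarrow> real set" where
  "support_points \<mu> = {x. \<forall>U. open U \<longrightarrow> x \<in> U \<longrightarrow> measure \<mu> U > 0}"

definition base_measure :: "real measure \<Rightarrow> bool" where
  "base_measure \<mu> \<longleftrightarrow> prob_space \<mu> \<and> sets \<mu> = sets borel \<and> measure \<mu> {-1..1} = 1 \<and>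
     (\<exists>x\<in>support_points \<mu>. \<exists>y\<in>support_points \<mu>. x \<noteq> y)"

definition covariance_matrix :: "(real ^ 'd) measure \<Rightarrow> real ^ 'd ^ 'd" where
  "covariance_matrix PX = (\<chi> k l. \<integral>x. (x $ k - (\<integral>z. z $ k \<partial>PX)) * (x $ l - (\<integral>z. z $ l \<partial>PX)) \<partial>PX)"

definition mat_eigenvalue :: "real ^ 'd ^ 'd \<Rightarrow> real \<Rightarrow> bool" where
  "mat_eigenvalue S \<kappa> \<longleftrightarrow> (\<exists>v. v \<noteq> 0 \<and> S *v v = \<kappa> *\<^sub>R v)"

definition covariate_law :: "real \<Rightarrow> real \<Rightarrow> (real ^ 'd) measure \<Rightarrow> bool" where
  "covariate_law c C PX \<longleftrightarrow> prob_space PX \<and> sets PX = sets borel \<and>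
     measure PX {x. \<forall>k. x $ k \<in> {-1..1}} = 1 \<and>
     (\<forall>\<kappa>. mat_eigenvalue (covariance_matrix PX) \<kappa> \<longrightarrow> \<kappa> \<in> {c..C})"

definition coef_box :: "real \<Rightarrow> (real ^ 'd) set" where
  "coef_box M0 = {\<theta>. \<forall>k. \<theta> $ k \<in> {-M0..M0}}"

definition param_space :: "real \<Rightarrow> real \<Rightarrow> (real \<times> (real ^ 'd)) set" where
  "param_space B M0 = {-B..B} \<times> coef_box M0"

definition rademacher :: "real measure" where
  "rademacher = distr (measure_pmf (pmf_of_set {-1, 1})) borel (\<lambda>t. t)"

text \<open>Density with respect to \<open>\<nu>\<close> of the law proportional to \<open>exp (H z) d\<nu>(z)\<close>.\<close>

definition gibbs_density :: "'a measure \<Rightarrow> ('a \<Rightarrow> real) \<Rightarrow> 'a \<Rightarrow> real" where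
  "gibbs_density \<nu> H z = exp (H z) / (\<integral>w. exp (H w) \<partial>\<nu>)"

text \<open>
  \<open>{\<plusminus>1}\<^sup>n\<close> carries the uniform law as reference measure; the normalisation makes this
  the same as counting measure.
\<close>

definition treatment_density ::
    "nat \<Rightarrow> (nat \<Rightarrow> nat \<Rightarrow> real) \<Rightarrow> real ^ 'd \<Rightarrow> (nat \<Rightarrow> real ^ 'd) \<Rightarrow> (nat \<Rightarrow> real) \<Rightarrow> real" where
  "treatment_density n M \<gamma> x =
     gibbs_density (\<Pi>\<^sub>M i\<in>{..<n}. rademacher) (\<lambda>t. quad_form n M t / 2 + (\<Sum>i<n. t i * (x i \<bullet> \<gamma>)))"

definition outcome_density ::
    "real measure \<Rightarrow> nat \<Rightarrow> (nat \<Rightarrow> nat \<Rightarrow> real) \<Rightarrow> real \<Rightarrow> real ^ 'd \<Rightarrow>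
     (nat \<Rightarrow> real) \<Rightarrow> (nat \<Rightarrow> real ^ 'd) \<Rightarrow> (nat \<Rightarrow> real) \<Rightarrow> real" where
  "outcome_density \<mu> n A \<tau> \<theta> t x =
     gibbs_density (\<Pi>\<^sub>M i\<in>{..<n}. \<mu>) (\<lambda>y. quad_form n A y / 2 + (\<Sum>i<n. y i * (\<tau> * t i + x i \<bullet> \<theta>)))"

text \<open>
  Joint law of \<open>(A\<^sub>n, X, T, Y, Tbar, Xbar)\<close>, where \<open>LA\<close> is the law of \<open>A\<^sub>n\<close> (a point mass if \<open>A\<^sub>n\<close> is
  deterministic).  The matrix is independent of the covariates, the treatment does not depend on
  it, and the outcome law is conditional on it; \<open>Tbar\<close> and \<open>Xbar\<close> are the fresh draws made by the
  algorithms.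
\<close>

definition joint_law ::
    "nat \<Rightarrow> (nat \<Rightarrow> nat \<Rightarrow> real) measure \<Rightarrow> real measure \<Rightarrow> (real ^ 'd) measure \<Rightarrow>
     (nat \<Rightarrow> nat \<Rightarrow> real) \<Rightarrow> real ^ 'd \<Rightarrow> real \<Rightarrow> real ^ 'd \<Rightarrow>
     ((nat \<Rightarrow> nat \<Rightarrow> real) \<times> (nat \<Rightarrow> (real ^ 'd)) \<times> (nat \<Rightarrow> real) \<times> (nat \<Rightarrow> real) \<times>
      (nat \<Rightarrow> real) \<times> (nat \<Rightarrow> (real ^ 'd))) measure" where
  "joint_law n LA \<mu> PX M \<gamma>0 \<tau>0 \<theta>0 =
     density
       (LA \<Otimes>\<^sub>M (\<Pi>\<^sub>M i\<in>{..<n}. PX) \<Otimes>\<^sub>M (\<Pi>\<^sub>M i\<in>{..<n}. rademacher) \<Otimes>\<^sub>M (\<Pi>\<^sub>M i\<in>{..<n}. \<mu>) \<Otimes>\<^sub>M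
        (\<Pi>\<^sub>M i\<in>{..<n}. rademacher) \<Otimes>\<^sub>M (\<Pi>\<^sub>M i\<in>{..<n}. PX))
       (\<lambda>(a, x, t, y, tb, xb).
          ennreal (treatment_density n M \<gamma>0 x t * outcome_density \<mu> n a \<tau>0 \<theta>0 t x y))"

text \<open>No assumption is made on the coupling between different \<open>n\<close>.\<close>

definition interference_model ::
    "'w measure \<Rightarrow> real measure \<Rightarrow> (real ^ 'd) measure \<Rightarrow>
     (nat \<Rightarrow> nat \<Rightarrow> nat \<Rightarrow> real) \<Rightarrow> real ^ 'd \<Rightarrow> real \<Rightarrow> real ^ 'd \<Rightarrow>
     (nat \<Rightarrow> 'w \<Rightarrow> nat \<Rightarrow> nat \<Rightarrow> real) \<Rightarrow> (nat \<Rightarrow> 'w \<Rightarrow> nat \<Rightarrow> real ^ 'd) \<Rightarrow>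
     (nat \<Rightarrow> 'w \<Rightarrow> nat \<Rightarrow> real) \<Rightarrow> (nat \<Rightarrow> 'w \<Rightarrow> nat \<Rightarrow> real) \<Rightarrow>
     (nat \<Rightarrow> 'w \<Rightarrow> nat \<Rightarrow> real) \<Rightarrow> (nat \<Rightarrow> 'w \<Rightarrow> nat \<Rightarrow> real ^ 'd) \<Rightarrow> bool" where
  "interference_model P \<mu> PX M \<gamma>0 \<tau>0 \<theta>0 A X T Y Tb Xb \<longleftrightarrow> prob_space P \<and>
     (\<forall>n. A n \<in> measurable P (mat_space n) \<and>
          (let J = joint_law n (distr P (mat_space n) (A n)) \<mu> PX (M n) \<gamma>0 \<tau>0 \<theta>0;
               Z = (\<lambda>\<omega>. (A n \<omega>, X n \<omega>, T n \<omega>, Y n \<omega>, Tb n \<omega>, Xb n \<omega>))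
           in Z \<in> measurable P J \<and> distr P J Z = J))"

definition gaussian_matrix :: "'w measure \<Rightarrow> nat \<Rightarrow> ('w \<Rightarrow> nat \<Rightarrow> nat \<Rightarrow> real) \<Rightarrow> bool" where
  "gaussian_matrix P n G \<longleftrightarrow>
     (\<forall>\<omega>\<in>space P. sym_mat n (G \<omega>) \<and> (\<forall>i<n. G \<omega> i i = 0)) \<and>
     prob_space.indep_vars P (\<lambda>_. borel) (\<lambda>(i, j) \<omega>. G \<omega> i j) {(i, j). i < j \<and> j < n} \<and>
     (\<forall>i j. i < j \<longrightarrow> j < n \<longrightarrow>
        distributed P lborel (\<lambda>\<omega>. G \<omega> i j) (normal_density 0 (sqrt (1 / real n))))"

text \<open>Density of coordinate \<open>i\<close> given the others, for a joint density \<open>f\<close> with respect to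
  the product measure \<open>\<mu>\<^sup>n\<close>.\<close>

definition cond_density ::
    "real measure \<Rightarrow> ((nat \<Rightarrow> real) \<Rightarrow> real) \<Rightarrow> nat \<Rightarrow> (nat \<Rightarrow> real) \<Rightarrow> real" where
  "cond_density \<mu> f i y = f y / (\<integral>z. f (y(i := z)) \<partial>\<mu>)"

definition pseudo_likelihood ::
    "real measure \<Rightarrow> nat \<Rightarrow> (nat \<Rightarrow> nat \<Rightarrow> real) \<Rightarrow> (nat \<Rightarrow> real) \<Rightarrow> (nat \<Rightarrow> real ^ 'd) \<Rightarrow>
     (nat \<Rightarrow> real) \<Rightarrow> real \<times> (real ^ 'd) \<Rightarrow> real" where
  "pseudo_likelihood \<mu> n A t x y = (\<lambda>(\<tau>, \<theta>).
     \<Prod>i<n. cond_density \<mu> (outcome_density \<mu> n A \<tau> \<theta> t x) i y)"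

text \<open>Only measurability and membership in the parameter space are required where the
  maximiser is not unique.\<close>

definition is_mpl ::
    "'w measure \<Rightarrow> real measure \<Rightarrow> real \<Rightarrow> real \<Rightarrow> (nat \<Rightarrow> 'w \<Rightarrow> nat \<Rightarrow> nat \<Rightarrow> real) \<Rightarrow>
     (nat \<Rightarrow> 'w \<Rightarrow> nat \<Rightarrow> real ^ 'd) \<Rightarrow> (nat \<Rightarrow> 'w \<Rightarrow> nat \<Rightarrow> real) \<Rightarrow> (nat \<Rightarrow> 'w \<Rightarrow> nat \<Rightarrow> real) \<Rightarrow>
     (nat \<Rightarrow> 'w \<Rightarrow> real) \<Rightarrow> (nat \<Rightarrow> 'w \<Rightarrow> real ^ 'd) \<Rightarrow> bool" where
  "is_mpl P \<mu> B M0 A X T Y \<tau>h \<theta>h \<longleftrightarrow>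
     (\<forall>n. \<tau>h n \<in> borel_measurable P \<and> \<theta>h n \<in> borel_measurable P \<and>
       (\<forall>\<omega>\<in>space P.
          let PL = pseudo_likelihood \<mu> n (A n \<omega>) (T n \<omega>) (X n \<omega>) (Y n \<omega>);
              maxi = is_arg_max PL (\<lambda>p. p \<in> param_space B M0)
          in (\<tau>h n \<omega>, \<theta>h n \<omega>) \<in> param_space B M0 \<and>
             ((\<exists>!p. maxi p) \<longrightarrow> maxi (\<tau>h n \<omega>, \<theta>h n \<omega>))))"

definition alpha :: "real measure \<Rightarrow> real \<Rightarrow> real \<Rightarrow> real" where
  "alpha \<mu> l1 l2 = ln (\<integral>x. exp (l1 * x + l2 / 2 * x\<^sup>2) \<partial>\<mu>)"

definition alpha_d1 :: "real measure \<Rightarrow> real \<Rightarrow> real \<Rightarrow> real" where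
  "alpha_d1 \<mu> l1 l2 = deriv (\<lambda>l. alpha \<mu> l l2) l1"

definition alpha_d2 :: "real measure \<Rightarrow> real \<Rightarrow> real \<Rightarrow> real" where
  "alpha_d2 \<mu> l1 l2 = deriv (\<lambda>l. alpha_d1 \<mu> l l2) l1"

definition ext_field :: "real \<Rightarrow> real ^ 'd \<Rightarrow> (nat \<Rightarrow> real) \<Rightarrow> (nat \<Rightarrow> real ^ 'd) \<Rightarrow> nat \<Rightarrow> real" where
  "ext_field \<tau> \<theta> tb xb i = \<tau> * tb i + xb i \<bullet> \<theta>"

definition DE_of :: "nat \<Rightarrow> (nat \<Rightarrow> real) \<Rightarrow> (nat \<Rightarrow> real) \<Rightarrow> real" where
  "DE_of n tb u = 2 / real n * (\<Sum>i<n. tb i * u i)"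

definition IE_of :: "nat \<Rightarrow> (nat \<Rightarrow> real) \<Rightarrow> (nat \<Rightarrow> real) \<Rightarrow> (nat \<Rightarrow> real) \<Rightarrow> real" where
  "IE_of n tb u v = 1 / real n * ((\<Sum>i<n. u i) - (\<Sum>i<n. v i)) - DE_of n tb u / 2"

primrec mf_iter ::
    "real measure \<Rightarrow> nat \<Rightarrow> (nat \<Rightarrow> nat \<Rightarrow> real) \<Rightarrow> (nat \<Rightarrow> real) \<Rightarrow> nat \<Rightarrow> nat \<Rightarrow> real" where
  "mf_iter \<mu> n A h 0 = (\<lambda>i. 0)"
| "mf_iter \<mu> n A h (Suc l) = (\<lambda>i. alpha_d1 \<mu> (mat_vec n A (mf_iter \<mu> n A h l) i + h i) 0)"

definition DE_alg1 ::
    "real measure \<Rightarrow> nat \<Rightarrow> (nat \<Rightarrow> nat \<Rightarrow> real) \<Rightarrow> (nat \<Rightarrow> real) \<Rightarrow> (nat \<Rightarrow> real ^ 'd) \<Rightarrow>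
     nat \<Rightarrow> real \<Rightarrow> real ^ 'd \<Rightarrow> real" where
  "DE_alg1 \<mu> n A tb xb K \<tau> \<theta> = DE_of n tb (mf_iter \<mu> n A (ext_field \<tau> \<theta> tb xb) K)"

definition IE_alg1 ::
    "real measure \<Rightarrow> nat \<Rightarrow> (nat \<Rightarrow> nat \<Rightarrow> real) \<Rightarrow> (nat \<Rightarrow> real) \<Rightarrow> (nat \<Rightarrow> real ^ 'd) \<Rightarrow>
     nat \<Rightarrow> real \<Rightarrow> real ^ 'd \<Rightarrow> real" where
  "IE_alg1 \<mu> n A tb xb K \<tau> \<theta> =
     IE_of n tb (mf_iter \<mu> n A (ext_field \<tau> \<theta> tb xb) K) (mf_iter \<mu> n A (ext_field \<tau> \<theta> (\<lambda>_. -1) xb) K)"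

text \<open>
  The fixed-point system, with \<open>\<nu>\<close> the law of the field: \<open>\<tau> T + H\<close> for \<open>(q\<^sub>*, \<sigma>\<^sub>1\<^sub>,\<^sub>*\<^sup>2)\<close> and
  \<open>-\<tau> + H\<close> for \<open>(r\<^sub>*, \<sigma>\<^sub>2\<^sub>,\<^sub>*\<^sup>2)\<close>.  The variable \<open>s\<close> stands for the squared quantity \<open>\<sigma>\<^sup>2\<close>.
\<close>

definition fp_system :: "real measure \<Rightarrow> real \<Rightarrow> real measure \<Rightarrow> real \<times> real \<Rightarrow> bool" where
  "fp_system \<mu> \<beta> \<nu> = (\<lambda>(q, s). q \<in> {0..1} \<and> s \<ge> 0 \<and>
     q = (\<integral>(w, g). (alpha_d1 \<mu> (w + \<beta> * sqrt q * g) (\<beta>\<^sup>2 * s))\<^sup>2 \<partial>(\<nu> \<Otimes>\<^sub>M std_normal_distribution)) \<and>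
     s = (\<integral>(w, g). alpha_d2 \<mu> (w + \<beta> * sqrt q * g) (\<beta>\<^sup>2 * s) \<partial>(\<nu> \<Otimes>\<^sub>M std_normal_distribution)))"

definition fp_solution :: "real measure \<Rightarrow> real \<Rightarrow> real measure \<Rightarrow> real \<times> real" where
  "fp_solution \<mu> \<beta> \<nu> = (THE p. fp_system \<mu> \<beta> \<nu> p)"

definition field_law :: "(real ^ 'd) measure \<Rightarrow> real \<Rightarrow> real ^ 'd \<Rightarrow> real measure" where
  "field_law PX \<tau> \<theta> = distr (rademacher \<Otimes>\<^sub>M PX) borel (\<lambda>(t, x). \<tau> * t + x \<bullet> \<theta>)"

definition field_law_control :: "(real ^ 'd) measure \<Rightarrow> real \<Rightarrow> real ^ 'd \<Rightarrow> real measure" where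
  "field_law_control PX \<tau> \<theta> = distr PX borel (\<lambda>x. - \<tau> + x \<bullet> \<theta>)"

fun amp_iter ::
    "real measure \<Rightarrow> nat \<Rightarrow> real \<Rightarrow> (nat \<Rightarrow> nat \<Rightarrow> real) \<Rightarrow> real \<times> real \<Rightarrow> (nat \<Rightarrow> real) \<Rightarrow>
     nat \<Rightarrow> nat \<Rightarrow> real" where
  "amp_iter \<mu> n \<beta> G (q, s) h 0 = (\<lambda>i. 0)"
| "amp_iter \<mu> n \<beta> G (q, s) h (Suc 0) = (\<lambda>i. 0)"
| "amp_iter \<mu> n \<beta> G (q, s) h (Suc (Suc 0)) = (\<lambda>i. \<Sum>j<n. G i j * sqrt q)"
| "amp_iter \<mu> n \<beta> G (q, s) h (Suc (Suc (Suc k))) = (\<lambda>i.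
     (\<Sum>l<n. G i l * alpha_d1 \<mu> (\<beta> * amp_iter \<mu> n \<beta> G (q, s) h (Suc (Suc k)) l + h l) (\<beta>\<^sup>2 * s)) -
     (\<beta> / real n * (\<Sum>j<n. alpha_d2 \<mu> (\<beta> * amp_iter \<mu> n \<beta> G (q, s) h (Suc (Suc k)) j + h j) (\<beta>\<^sup>2 * s))) *
       alpha_d1 \<mu> (\<beta> * amp_iter \<mu> n \<beta> G (q, s) h (Suc k) i + h i) (\<beta>\<^sup>2 * s))"

definition amp_output ::
    "real measure \<Rightarrow> nat \<Rightarrow> real \<Rightarrow> (nat \<Rightarrow> nat \<Rightarrow> real) \<Rightarrow> real \<times> real \<Rightarrow> (nat \<Rightarrow> real) \<Rightarrow>
     nat \<Rightarrow> nat \<Rightarrow> real" where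
  "amp_output \<mu> n \<beta> G p h K i = alpha_d1 \<mu> (\<beta> * amp_iter \<mu> n \<beta> G p h K i + h i) (\<beta>\<^sup>2 * snd p)"

definition DE_alg2 ::
    "real measure \<Rightarrow> (real ^ 'd) measure \<Rightarrow> nat \<Rightarrow> real \<Rightarrow> (nat \<Rightarrow> nat \<Rightarrow> real) \<Rightarrow> (nat \<Rightarrow> real) \<Rightarrow>
     (nat \<Rightarrow> real ^ 'd) \<Rightarrow> nat \<Rightarrow> real \<Rightarrow> real ^ 'd \<Rightarrow> real" where
  "DE_alg2 \<mu> PX n \<beta> G tb xb K \<tau> \<theta> =
     DE_of n tb (amp_output \<mu> n \<beta> G (fp_solution \<mu> \<beta> (field_law PX \<tau> \<theta>)) (ext_field \<tau> \<theta> tb xb) K)"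

definition IE_alg2 ::
    "real measure \<Rightarrow> (real ^ 'd) measure \<Rightarrow> nat \<Rightarrow> real \<Rightarrow> (nat \<Rightarrow> nat \<Rightarrow> real) \<Rightarrow> (nat \<Rightarrow> real) \<Rightarrow>
     (nat \<Rightarrow> real ^ 'd) \<Rightarrow> nat \<Rightarrow> real \<Rightarrow> real ^ 'd \<Rightarrow> real" where
  "IE_alg2 \<mu> PX n \<beta> G tb xb K \<tau> \<theta> =
     IE_of n tb
       (amp_output \<mu> n \<beta> G (fp_solution \<mu> \<beta> (field_law PX \<tau> \<theta>)) (ext_field \<tau> \<theta> tb xb) K)
       (amp_output \<mu> n \<beta> G (fp_solution \<mu> \<beta> (field_law_control PX \<tau> \<theta>)) (ext_field \<tau> \<theta> (\<lambda>_. -1) xb) K)"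

end

theory Submission
  imports Defs
begin

text \<open>
  For a fixed number of steps, the outputs of both algorithms are continuous functions of the
  parameter, with a modulus of continuity that is uniform in \<open>n\<close> while the norm of \<open>A\<^sub>n\<close> stays bounded.
  The theorem thus follows from the consistency of the estimator, \<open>estimator_consistent\<close>.

  Consistency.  The logarithm of the pseudo-likelihood is concave, and its gradient at the true
  parameter is the sum of the vectors \<open>(T\<^sub>i, X\<^sub>i)\<close> weighted by the residuals \<open>Y\<^sub>i - E(Y\<^sub>i | Y\<^sub>j, j \<noteq> i)\<close>.
  The covariance of two residuals is bounded by the influence of one coordinate on the conditional
  mean of the other, hence by \<open>2 \<bar>A\<^sub>n(i,j)\<bar>\<close>, so the gradient has second moment of order
  \<open>n + n \<parallel>A\<^sub>n\<parallel>\<^sub>F = O(n\<^sup>3\<^sup>/\<^sup>2)\<close> and is \<open>o(n)\<close> in probability (\<open>residual_second_moment\<close>).  The curvature at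
  site \<open>i\<close> is bounded below while the local field there is moderate, which holds at most sites because the
  mean square of the local fields is bounded.  It remains to bound below the second moment matrix of
  the vectors \<open>(T\<^sub>i, X\<^sub>i)\<close>.  Given the covariates, the treatments follow a Gibbs law of the same kind, so
  the treatment residuals are nearly orthogonal to the covariates, and at most sites the conditional
  variance of the treatment is bounded below; together with the law of large numbers for the covariates
  this gives \<open>design_nondegenerate_if\<close>.  A strongly concave function with a small gradient at the true
  parameter has a unique maximiser, and that maximiser is close (\<open>pseudo_likelihood_maximiser\<close>).

  Continuity.  All derivatives of \<open>\<alpha>\<close> that occur are bounded by absolute constants.  In the first algorithm
  each step is Lipschitz at the scale \<open>\<surd>n\<close> of the Euclidean norm (\<open>mf_iter_stable\<close>).  In the second one
  (\<open>amp_iter_stable\<close>) the solution of the fixed-point system depends on the parameter as well.  For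
  small \<open>\<beta>\<close> the system is a contraction of the unit square, uniformly in the law of the field: a Gaussian
  average of a smooth function is Lipschitz in the variance, down to variance zero
  (\<open>symmetric_second_difference\<close>).  Hence its solution is a Lipschitz function of the law of the field, and
  so of the parameter (\<open>fp_solution_stable\<close>).  That \<open>\<beta>\<close> is small follows from the bound on the norm of
  \<open>\<beta> G\<^sub>n\<close>, because the first row of \<open>G\<^sub>n\<close> has a squared norm of order one (\<open>gaussian_matrix_scale_le\<close>).
\<close>

section \<open>Exponential tilts of a law on [-1,1]\<close>

text \<open>The base measure of the outcomes and the Rademacher law of a treatment are both of this kind, so the
  analysis of conditional means and residuals applies to outcomes and treatments alike.\<close>

locale interval_law = prob_space \<nu> for \<nu> :: "real measure" +
  assumes sets_law: "sets \<nu> = sets borel"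
    and AE_interval: "AE x in \<nu>. \<bar>x\<bar> \<le> 1"

text \<open>The normalised moments \<open>r\<^sub>k = tilt_mean \<nu> k a b\<close> lie in \<open>[-1,1]\<close>, and the derivatives of \<open>r\<^sub>k\<close> in \<open>a\<close> and \<open>b\<close>
  are polynomials in these moments.  Since \<open>\<alpha>' = r\<^sub>1\<close>, every derivative of \<open>\<alpha>\<close> is bounded by an absolute
  constant, whatever the law and the arguments.\<close>

definition tilt_moment :: "real measure \<Rightarrow> nat \<Rightarrow> real \<Rightarrow> real \<Rightarrow> real" where
  "tilt_moment \<nu> k a b = (\<integral>x. x ^ k * exp (a * x + b / 2 * x\<^sup>2) \<partial>\<nu>)"

definition tilt_mean :: "real measure \<Rightarrow> nat \<Rightarrow> real \<Rightarrow> real \<Rightarrow> real" where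
  "tilt_mean \<nu> k a b = tilt_moment \<nu> k a b / tilt_moment \<nu> 0 a b"

lemma exp_remainder:
  fixes u :: real
  assumes "\<bar>u\<bar> \<le> 1"
  shows "\<bar>exp u - 1 - u\<bar> \<le> u\<^sup>2"
proof (cases "u \<ge> 0")
  case True
  then show ?thesis using exp_bound[of u] exp_ge_add_one_self[of u] assms unfolding abs_le_iff by (smt (verit))
next
  case False
  define v where "v = -u"
  have v: "0 \<le> v" "v \<le> 1" "u = -v" using False assms by (auto simp: v_def)
  have "(1 - v + v\<^sup>2) * (1 + v) = 1 + v ^ 3" by (simp add: power2_eq_square power3_eq_cube algebra_simps)
  then have "1 \<le> (1 - v + v\<^sup>2) * (1 + v)" using v by simp
  also have "\<dots> \<le> (1 - v + v\<^sup>2) * exp v"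
  proof (rule mult_left_mono)
    show "1 + v \<le> exp v" by (rule exp_ge_add_one_self)
    show "0 \<le> 1 - v + v\<^sup>2" using v by (simp add: add_nonneg_nonneg)
  qed
  finally have "exp (-v) \<le> 1 - v + v\<^sup>2" by (simp add: exp_minus field_simps)
  then show ?thesis using exp_ge_add_one_self[of u] v by auto
qed

lemma abs_mult_bound:
  fixes x y :: real
  shows "\<bar>x\<bar> \<le> a \<Longrightarrow> \<bar>y\<bar> \<le> b \<Longrightarrow> \<bar>x * y\<bar> \<le> a * b"
  unfolding abs_mult by (rule mult_mono) auto

text \<open>On the real line the mean value theorem turns a derivative bound into a Lipschitz bound.\<close>

lemma lipschitz_if_deriv_bounded:
  fixes f :: "real \<Rightarrow> real"
  assumes "\<And>x. (f has_real_derivative f' x) (at x)" and "\<And>x. \<bar>f' x\<bar> \<le> D"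
  shows "\<bar>f x - f y\<bar> \<le> D * \<bar>x - y\<bar>"
  using field_differentiable_bound[of UNIV f f' D x y] assms by auto

lemma exp_tilt_bound:
  fixes a b x :: real
  assumes "\<bar>x\<bar> \<le> 1"
  shows "\<bar>a * x + b / 2 * x\<^sup>2\<bar> \<le> \<bar>a\<bar> + \<bar>b\<bar> / 2"
proof -
  have "\<bar>a * x\<bar> \<le> \<bar>a\<bar> * 1" "\<bar>b / 2 * x\<^sup>2\<bar> \<le> (\<bar>b\<bar> / 2) * 1"
    using assms abs_square_le_1[of x] by (intro abs_mult_bound; simp)+
  then show ?thesis by linarith
qed

lemma continuous_on_if_DERIV:
  "(\<And>x. (f has_real_derivative f' x) (at x)) \<Longrightarrow> continuous_on UNIV f" for f :: "real \<Rightarrow> real"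
  by (meson DERIV_continuous_on has_field_derivative_at_within)

text \<open>Joint continuity of the tilted means, the source of all measurability below, follows from the
  two separate Lipschitz bounds.\<close>

lemma separately_lipschitz_measurable:
  fixes f :: "real \<Rightarrow> real \<Rightarrow> real"
  assumes "\<And>a a' b. \<bar>f a b - f a' b\<bar> \<le> D * \<bar>a - a'\<bar>" and "\<And>a b b'. \<bar>f a b - f a b'\<bar> \<le> D * \<bar>b - b'\<bar>"
  shows "(\<lambda>p. f (fst p) (snd p)) \<in> borel_measurable borel"
proof -
  have D: "0 \<le> D" using assms(1)[of 0 0 1] by simp
  have "(2 * D)-lipschitz_on UNIV (\<lambda>p. f (fst p) (snd p))"
  proof (rule lipschitz_onI)
    fix p q :: "real \<times> real"
    have "\<bar>f (fst p) (snd p) - f (fst q) (snd q)\<bar> \<le> D * \<bar>fst p - fst q\<bar> + D * \<bar>snd p - snd q\<bar>"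
      using assms(1)[of "fst p" "snd p" "fst q"] assms(2)[of "fst q" "snd p" "snd q"] by linarith
    also have "\<dots> \<le> D * dist p q + D * dist p q"
      using dist_fst_le[of p q] dist_snd_le[of p q] D
      by (intro add_mono mult_left_mono) (auto simp: dist_real_def)
    finally show "dist (f (fst p) (snd p)) (f (fst q) (snd q)) \<le> 2 * D * dist p q"
      by (simp add: dist_real_def)
  qed (use D in auto)
  then show ?thesis using borel_measurable_continuous_onI lipschitz_on_continuous_on by blast
qed

context interval_law
begin

lemma borel_law [measurable_cong]: "sets \<nu> = sets borel"
  by (rule sets_law)

lemma space_law [simp]: "space \<nu> = UNIV"
  using sets_eq_imp_space_eq[OF sets_law] by simp

lemma prob_UNIV [simp]: "prob UNIV = 1"
  using prob_space by simp

lemma integrable_bounded_on_interval: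
  fixes g :: "real \<Rightarrow> real"
  assumes [measurable]: "g \<in> borel_measurable borel" and "\<And>x. \<bar>x\<bar> \<le> 1 \<Longrightarrow> \<bar>g x\<bar> \<le> G"
  shows "integrable \<nu> g"
  by (rule integrable_const_bound[where B = G])
    (use AE_interval in \<open>auto elim!: eventually_mono intro: assms(2)\<close>)

lemma integrable_tilt: "integrable \<nu> (\<lambda>x. x ^ k * exp (a * x + b / 2 * x\<^sup>2))"
proof (rule integrable_bounded_on_interval[where G = "1 * exp (\<bar>a\<bar> + \<bar>b\<bar> / 2)"])
  fix x :: real assume x: "\<bar>x\<bar> \<le> 1"
  have "\<bar>exp (a * x + b / 2 * x\<^sup>2)\<bar> \<le> exp (\<bar>a\<bar> + \<bar>b\<bar> / 2)" using exp_tilt_bound[OF x, of a b] by auto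
  then show "\<bar>x ^ k * exp (a * x + b / 2 * x\<^sup>2)\<bar> \<le> 1 * exp (\<bar>a\<bar> + \<bar>b\<bar> / 2)"
    by (intro abs_mult_bound) (auto simp: power_abs x power_le_one)
qed auto

lemma tilt_moment_0_ge: "exp (- \<bar>a\<bar> - \<bar>b\<bar> / 2) \<le> tilt_moment \<nu> 0 a b"
proof -
  have "(\<integral>x. exp (- \<bar>a\<bar> - \<bar>b\<bar> / 2) \<partial>\<nu>) \<le> (\<integral>x. x ^ 0 * exp (a * x + b / 2 * x\<^sup>2) \<partial>\<nu>)"
  proof (rule integral_mono_AE)
    show "AE x in \<nu>. exp (- \<bar>a\<bar> - \<bar>b\<bar> / 2) \<le> x ^ 0 * exp (a * x + b / 2 * x\<^sup>2)"
      using AE_interval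
    proof eventually_elim
      case (elim x)
      then show ?case using exp_tilt_bound[of x a b] by auto
    qed
  qed (auto simp only: integrable_tilt intro!: integrable_const)
  then show ?thesis by (simp add: tilt_moment_def prob_space)
qed

lemma tilt_moment_0_le: "tilt_moment \<nu> 0 a b \<le> exp (\<bar>a\<bar> + \<bar>b\<bar> / 2)"
proof -
  have "(\<integral>x. x ^ 0 * exp (a * x + b / 2 * x\<^sup>2) \<partial>\<nu>) \<le> (\<integral>x. exp (\<bar>a\<bar> + \<bar>b\<bar> / 2) \<partial>\<nu>)"
  proof (rule integral_mono_AE)
    show "AE x in \<nu>. x ^ 0 * exp (a * x + b / 2 * x\<^sup>2) \<le> exp (\<bar>a\<bar> + \<bar>b\<bar> / 2)"
      using AE_interval
    proof eventually_elim
      case (elim x)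
      then show ?case using exp_tilt_bound[of x a b] by auto
    qed
  qed (auto simp only: integrable_tilt intro!: integrable_const)
  then show ?thesis by (simp add: tilt_moment_def prob_space)
qed

lemma tilt_moment_0_pos [simp]: "0 < tilt_moment \<nu> 0 a b"
  using tilt_moment_0_ge[of a b] exp_gt_zero less_le_trans by blast

lemma tilt_moment_0_neq [simp]: "tilt_moment \<nu> 0 a b \<noteq> 0"
  by (rule less_imp_neq[OF tilt_moment_0_pos, symmetric])

lemma abs_tilt_mean_le [simp]: "\<bar>tilt_mean \<nu> k a b\<bar> \<le> 1"
proof -
  have "\<bar>tilt_moment \<nu> k a b\<bar> \<le> (\<integral>x. \<bar>x ^ k * exp (a * x + b / 2 * x\<^sup>2)\<bar> \<partial>\<nu>)"
    unfolding tilt_moment_def by (rule integral_abs_bound)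
  also have "\<dots> \<le> tilt_moment \<nu> 0 a b"
    unfolding tilt_moment_def
  proof (rule integral_mono_AE)
    show "AE x in \<nu>. \<bar>x ^ k * exp (a * x + b / 2 * x\<^sup>2)\<bar> \<le> x ^ 0 * exp (a * x + b / 2 * x\<^sup>2)"
      using AE_interval by eventually_elim (simp add: abs_mult power_abs power_le_one)
  qed (intro integrable_tilt integrable_abs)+
  finally show ?thesis by (simp add: tilt_mean_def)
qed

lemma tilt_mean_0 [simp]: "tilt_mean \<nu> 0 a b = 1"
  by (simp add: tilt_mean_def)

text \<open>Boundedness of the exponent makes the remainder of the difference quotient quadratic in the
  increment, so that differentiation under the integral needs no convergence theorem.\<close>

lemma deriv_under_integral:
  fixes f g :: "real \<Rightarrow> real"
  assumes [measurable]: "f \<in> borel_measurable borel" "g \<in> borel_measurable borel"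
    and f: "\<And>x. \<bar>x\<bar> \<le> 1 \<Longrightarrow> \<bar>f x\<bar> \<le> 1" and g: "\<And>x. \<bar>x\<bar> \<le> 1 \<Longrightarrow> \<bar>g x\<bar> \<le> G"
  shows "((\<lambda>t. \<integral>x. g x * exp (t * f x) \<partial>\<nu>) has_real_derivative (\<integral>x. g x * f x * exp (t * f x) \<partial>\<nu>)) (at t)"
proof -
  have G0: "0 \<le> G" using g[of 0] by simp
  have e: "\<bar>exp (s * f x)\<bar> \<le> exp \<bar>s\<bar>" if "\<bar>x\<bar> \<le> 1" for s x
    using abs_mult_bound[OF order_refl f[OF that], of s] by auto
  have i1: "integrable \<nu> (\<lambda>x. g x * exp (s * f x))" for s
    by (rule integrable_bounded_on_interval[where G = "G * exp \<bar>s\<bar>"]) (auto intro: abs_mult_bound[OF g e])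
  have i2: "integrable \<nu> (\<lambda>x. g x * f x * exp (s * f x))" for s
    by (rule integrable_bounded_on_interval[where G = "G * 1 * exp \<bar>s\<bar>"]) (auto intro: abs_mult_bound[OF abs_mult_bound[OF g f] e] simp del: mult_1_right)
  define I where "I s = (\<integral>x. g x * exp (s * f x) \<partial>\<nu>)" for s
  define J where "J = (\<integral>x. g x * f x * exp (t * f x) \<partial>\<nu>)"
  define R where "R h = (\<integral>x. \<bar>g x * exp ((t + h) * f x) - g x * exp (t * f x) - h * (g x * f x * exp (t * f x))\<bar> \<partial>\<nu>)" for h
  have bd: "\<bar>(I (t + h) - I t) / h - J\<bar> \<le> G * exp \<bar>t\<bar> * \<bar>h\<bar>" if h: "h \<noteq> 0" "\<bar>h\<bar> \<le> 1" for h
  proof -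
    have "I (t + h) - I t - h * J = (\<integral>x. g x * exp ((t + h) * f x) - g x * exp (t * f x) - h * (g x * f x * exp (t * f x)) \<partial>\<nu>)"
      unfolding I_def J_def using i1 i2 by simp
    then have "\<bar>I (t + h) - I t - h * J\<bar> \<le> R h" unfolding R_def by simp
    also have "R h \<le> (\<integral>x. G * exp \<bar>t\<bar> * h\<^sup>2 \<partial>\<nu>)"
      unfolding R_def
    proof (rule integral_mono_AE)
      show "AE x in \<nu>. \<bar>g x * exp ((t + h) * f x) - g x * exp (t * f x) - h * (g x * f x * exp (t * f x))\<bar> \<le> G * exp \<bar>t\<bar> * h\<^sup>2"
        using AE_interval
      proof eventually_elim
        case (elim x)
        have *: "g x * exp ((t + h) * f x) - g x * exp (t * f x) - h * (g x * f x * exp (t * f x))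
          = g x * exp (t * f x) * (exp (h * f x) - 1 - h * f x)"
          by (simp add: algebra_simps exp_add)
        have hf: "\<bar>h * f x\<bar> \<le> \<bar>h\<bar> * 1" by (intro abs_mult_bound f elim) simp
        then have "\<bar>exp (h * f x) - 1 - h * f x\<bar> \<le> (h * f x)\<^sup>2" using h by (intro exp_remainder) simp
        also have "\<dots> \<le> h\<^sup>2" using hf by (metis abs_le_square_iff mult.right_neutral)
        finally show ?case unfolding * by (rule abs_mult_bound[OF abs_mult_bound[OF g[OF elim] e[OF elim]]])
      qed
      show "integrable \<nu> (\<lambda>x. \<bar>g x * exp ((t + h) * f x) - g x * exp (t * f x) - h * (g x * f x * exp (t * f x))\<bar>)"
        by (intro integrable_abs Bochner_Integration.integrable_diff i1 integrable_mult_right i2)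
    qed auto
    also have "\<dots> = G * exp \<bar>t\<bar> * h\<^sup>2" by (simp add: prob_space)
    finally have main: "\<bar>I (t + h) - I t - h * J\<bar> \<le> G * exp \<bar>t\<bar> * \<bar>h\<bar> * \<bar>h\<bar>"
      by (simp add: power2_eq_square flip: abs_mult)
    have "(I (t + h) - I t) / h - J = (I (t + h) - I t - h * J) / h"
      using h by (simp add: field_simps)
    then show ?thesis using main h by (simp add: divide_le_eq)
  qed
  have "(\<lambda>h. (I (t + h) - I t) / h - J) \<midarrow>0\<rightarrow> 0"
  proof (rule Lim_null_comparison)
    show "\<forall>\<^sub>F h in at 0. norm ((I (t + h) - I t) / h - J) \<le> G * exp \<bar>t\<bar> * \<bar>h\<bar>"
      unfolding eventually_at by (rule exI[of _ 1]) (use bd in \<open>auto simp: dist_real_def\<close>)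
    show "(\<lambda>h. G * exp \<bar>t\<bar> * \<bar>h\<bar>) \<midarrow>0\<rightarrow> 0"
      by (auto intro!: tendsto_eq_intros)
  qed
  then have "(\<lambda>h. (I (t + h) - I t) / h) \<midarrow>0\<rightarrow> J" by (rule LIM_zero_cancel)
  then show ?thesis unfolding I_def J_def DERIV_def .
qed

lemma tilt_moment_deriv_a:
  "((\<lambda>a. tilt_moment \<nu> k a b) has_real_derivative tilt_moment \<nu> (Suc k) a b) (at a)"
proof -
  have "((\<lambda>t. \<integral>x. (x ^ k * exp (b / 2 * x\<^sup>2)) * exp (t * x) \<partial>\<nu>) has_real_derivative
      (\<integral>x. (x ^ k * exp (b / 2 * x\<^sup>2)) * x * exp (a * x) \<partial>\<nu>)) (at a)"
  proof (rule deriv_under_integral[where G = "1 * exp (\<bar>b\<bar> / 2)"])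
    fix x :: real assume x: "\<bar>x\<bar> \<le> 1"
    show "\<bar>x ^ k * exp (b / 2 * x\<^sup>2)\<bar> \<le> 1 * exp (\<bar>b\<bar> / 2)"
      using exp_tilt_bound[OF x, of 0 b] by (intro abs_mult_bound) (auto simp: x power_abs power_le_one)
  qed auto
  then show ?thesis by (simp add: tilt_moment_def exp_add mult_ac)
qed

lemma tilt_moment_deriv_b:
  "((\<lambda>b. tilt_moment \<nu> k a b) has_real_derivative tilt_moment \<nu> (k + 2) a b / 2) (at b)"
proof -
  have "((\<lambda>t. \<integral>x. (x ^ k * exp (a * x)) * exp (t * (x\<^sup>2 / 2)) \<partial>\<nu>) has_real_derivative
      (\<integral>x. (x ^ k * exp (a * x)) * (x\<^sup>2 / 2) * exp (b * (x\<^sup>2 / 2)) \<partial>\<nu>)) (at b)"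
  proof (rule deriv_under_integral[where G = "1 * exp \<bar>a\<bar>"])
    fix x :: real assume x: "\<bar>x\<bar> \<le> 1"
    show "\<bar>x ^ k * exp (a * x)\<bar> \<le> 1 * exp \<bar>a\<bar>"
      using exp_tilt_bound[OF x, of a 0] by (intro abs_mult_bound) (auto simp: x power_abs power_le_one)
    show "\<bar>x\<^sup>2 / 2\<bar> \<le> 1" using abs_square_le_1[of x] x by simp
  qed auto
  moreover have "(\<integral>x. (x ^ k * exp (a * x)) * (x\<^sup>2 / 2) * exp (b * (x\<^sup>2 / 2)) \<partial>\<nu>) = tilt_moment \<nu> (k + 2) a b / 2"
    unfolding tilt_moment_def integral_divide_zero[symmetric]
    by (rule arg_cong[where f = "integral\<^sup>L \<nu>"]) (simp add: fun_eq_iff exp_add power_add power2_eq_square mult_ac)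
  moreover have "(\<integral>x. (x ^ k * exp (a * x)) * exp (t * (x\<^sup>2 / 2)) \<partial>\<nu>) = tilt_moment \<nu> k a t" for t
    unfolding tilt_moment_def
    by (rule arg_cong[where f = "integral\<^sup>L \<nu>"]) (simp add: fun_eq_iff exp_add mult_ac)
  ultimately show ?thesis by (simp only:)
qed

lemma tilt_mean_deriv_a [derivative_intros]:
  "((\<lambda>a. tilt_mean \<nu> k a b) has_real_derivative
     tilt_mean \<nu> (Suc k) a b - tilt_mean \<nu> k a b * tilt_mean \<nu> 1 a b) (at a)"
proof -
  note nz = tilt_moment_0_neq[of a b]
  show ?thesis unfolding tilt_mean_def
    by (rule derivative_eq_intros tilt_moment_deriv_a nz)+ (use nz in \<open>simp add: field_simps\<close>)
qed

lemma tilt_mean_deriv_b [derivative_intros]: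
  "((\<lambda>b. tilt_mean \<nu> k a b) has_real_derivative
     (tilt_mean \<nu> (k + 2) a b - tilt_mean \<nu> k a b * tilt_mean \<nu> 2 a b) / 2) (at b)"
proof -
  note nz = tilt_moment_0_neq[of a b]
  show ?thesis unfolding tilt_mean_def
    by (rule derivative_eq_intros tilt_moment_deriv_b nz)+ (use nz in \<open>simp add: field_simps eval_nat_numeral\<close>)
qed

lemma alpha_eq: "alpha \<nu> a b = ln (tilt_moment \<nu> 0 a b)"
  by (simp add: alpha_def tilt_moment_def)

lemma alpha_deriv: "((\<lambda>a. alpha \<nu> a b) has_real_derivative tilt_mean \<nu> 1 a b) (at a)"
  unfolding alpha_eq tilt_mean_def
  by (rule derivative_eq_intros tilt_moment_deriv_a tilt_moment_0_pos)+ simp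

lemma alpha_d1_eq: "alpha_d1 \<nu> a b = tilt_mean \<nu> 1 a b"
  unfolding alpha_d1_def by (rule DERIV_imp_deriv[OF alpha_deriv])

lemma alpha_d2_eq: "alpha_d2 \<nu> a b = tilt_mean \<nu> 2 a b - (tilt_mean \<nu> 1 a b)\<^sup>2"
  unfolding alpha_d2_def alpha_d1_eq
  using DERIV_imp_deriv[OF tilt_mean_deriv_a[of 1]] by (simp add: power2_eq_square numeral_2_eq_2)

lemma alpha_d1_deriv: "((\<lambda>a. alpha_d1 \<nu> a b) has_real_derivative alpha_d2 \<nu> a b) (at a)"
  unfolding alpha_d1_eq alpha_d2_eq using tilt_mean_deriv_a[of 1]
  by (simp add: power2_eq_square numeral_2_eq_2)

lemma alpha_deriv': "((\<lambda>a. alpha \<nu> a b) has_real_derivative alpha_d1 \<nu> a b) (at a)"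
  using alpha_deriv by (simp add: alpha_d1_eq)

lemma abs_alpha_d1_le [simp]: "\<bar>alpha_d1 \<nu> a b\<bar> \<le> 1"
  by (simp add: alpha_d1_eq del: One_nat_def)

lemma abs_tilt_mean_mult_le: "\<bar>tilt_mean \<nu> k a b * tilt_mean \<nu> l a b\<bar> \<le> 1"
  using abs_mult_bound[of _ 1 _ 1] by simp

text \<open>Variance plus squared bias, for the tilted law before normalisation.\<close>

lemma tilted_square:
  "(\<integral>x. (x - m)\<^sup>2 * exp (a * x + b / 2 * x\<^sup>2) \<partial>\<nu>) =
     tilt_moment \<nu> 0 a b * (alpha_d2 \<nu> a b + (alpha_d1 \<nu> a b - m)\<^sup>2)"
proof -
  have "(\<integral>x. (x - m)\<^sup>2 * exp (a * x + b / 2 * x\<^sup>2) \<partial>\<nu>) =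
     (\<integral>x. x^2 * exp (a * x + b / 2 * x\<^sup>2) - 2 * m * (x^1 * exp (a * x + b / 2 * x\<^sup>2)) + m\<^sup>2 * (x^0 * exp (a * x + b / 2 * x\<^sup>2)) \<partial>\<nu>)"
    by (rule arg_cong[where f = "integral\<^sup>L \<nu>"]) (simp add: fun_eq_iff power2_diff algebra_simps)
  also have "\<dots> = tilt_moment \<nu> 2 a b - 2 * m * tilt_moment \<nu> 1 a b + m\<^sup>2 * tilt_moment \<nu> 0 a b"
    unfolding tilt_moment_def
    by (subst Bochner_Integration.integral_add Bochner_Integration.integral_diff;
        (intro integrable_tilt integrable_mult_right Bochner_Integration.integrable_diff)?)+ simp
  also have "\<dots> = tilt_moment \<nu> 0 a b * (alpha_d2 \<nu> a b + (alpha_d1 \<nu> a b - m)\<^sup>2)"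
    using tilt_moment_0_pos[of a b] by (simp add: alpha_d1_eq alpha_d2_eq tilt_mean_def field_simps power2_eq_square)
  finally show ?thesis .
qed

lemma alpha_d2_nonneg: "0 \<le> alpha_d2 \<nu> a b"
proof -
  have "0 \<le> (\<integral>x. (x - alpha_d1 \<nu> a b)\<^sup>2 * exp (a * x + b / 2 * x\<^sup>2) \<partial>\<nu>)" by simp
  then show ?thesis unfolding tilted_square using tilt_moment_0_pos[of a b] by (simp add: zero_le_mult_iff)
qed

lemma alpha_d2_le: "alpha_d2 \<nu> a b \<le> 1"
  using abs_tilt_mean_le[of 2 a b] by (simp add: alpha_d2_eq del: One_nat_def abs_tilt_mean_le) (smt (verit) zero_le_power2)

lemma abs_alpha_d2_le [simp]: "\<bar>alpha_d2 \<nu> a b\<bar> \<le> 1"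
  using alpha_d2_nonneg[of a b] alpha_d2_le[of a b] by simp

text \<open>A tilt changes the law by a density between \<open>exp (-\<bar>a\<bar> - \<bar>b\<bar>/2)\<close> and its inverse, up to
  normalisation, and the mean minimises the mean square deviation; hence the tilted variance is
  comparable with the variance at zero.\<close>

lemma alpha_d2_ge: "exp (- 2 * \<bar>a\<bar> - \<bar>b\<bar>) * alpha_d2 \<nu> 0 0 \<le> alpha_d2 \<nu> a b"
proof -
  let ?m = "alpha_d1 \<nu> a b" and ?e = "\<bar>a\<bar> + \<bar>b\<bar> / 2"
  have sq: "integrable \<nu> (\<lambda>x. (x - ?m)\<^sup>2 * exp (a * x + b / 2 * x\<^sup>2))" for a b
  proof -
    have "(\<lambda>x. (x - ?m)\<^sup>2 * exp (a * x + b / 2 * x\<^sup>2)) =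
       (\<lambda>x. x^2 * exp (a * x + b / 2 * x\<^sup>2) - 2 * ?m * (x^1 * exp (a * x + b / 2 * x\<^sup>2)) + ?m\<^sup>2 * (x^0 * exp (a * x + b / 2 * x\<^sup>2)))"
      by (simp add: fun_eq_iff power2_diff algebra_simps)
    moreover have "integrable \<nu> \<dots>"
      by (intro Bochner_Integration.integrable_add Bochner_Integration.integrable_diff integrable_mult_right integrable_tilt)
    ultimately show ?thesis by simp
  qed
  have "exp (- ?e) * alpha_d2 \<nu> 0 0 \<le> exp (- ?e) * (alpha_d2 \<nu> 0 0 + (alpha_d1 \<nu> 0 0 - ?m)\<^sup>2)"
    by simp
  also have "\<dots> = exp (- ?e) * (\<integral>x. (x - ?m)\<^sup>2 * exp (0 * x + 0 / 2 * x\<^sup>2) \<partial>\<nu>)"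
    unfolding tilted_square by (simp add: tilt_moment_def prob_space)
  also have "\<dots> = (\<integral>x. exp (- ?e) * ((x - ?m)\<^sup>2 * exp (0 * x + 0 / 2 * x\<^sup>2)) \<partial>\<nu>)"
    by simp
  also have "\<dots> \<le> (\<integral>x. (x - ?m)\<^sup>2 * exp (a * x + b / 2 * x\<^sup>2) \<partial>\<nu>)"
  proof (rule integral_mono_AE)
    show "AE x in \<nu>. exp (- ?e) * ((x - ?m)\<^sup>2 * exp (0 * x + 0 / 2 * x\<^sup>2)) \<le> (x - ?m)\<^sup>2 * exp (a * x + b / 2 * x\<^sup>2)"
      using AE_interval
    proof eventually_elim
      case (elim x)
      then have "exp (- ?e) \<le> exp (a * x + b / 2 * x\<^sup>2)" using exp_tilt_bound[of x a b] by auto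
      then have "(x - ?m)\<^sup>2 * exp (- ?e) \<le> (x - ?m)\<^sup>2 * exp (a * x + b / 2 * x\<^sup>2)"
        by (rule mult_left_mono) simp
      then show ?case by (simp add: mult.commute)
    qed
  qed (intro sq integrable_mult_right)+
  also have "\<dots> = tilt_moment \<nu> 0 a b * alpha_d2 \<nu> a b" unfolding tilted_square by simp
  also have "\<dots> \<le> exp ?e * alpha_d2 \<nu> a b"
    by (intro mult_right_mono tilt_moment_0_le alpha_d2_nonneg)
  finally have "exp (- ?e) * (exp (- ?e) * alpha_d2 \<nu> 0 0) \<le> exp (- ?e) * (exp ?e * alpha_d2 \<nu> a b)"
    by (intro mult_left_mono) auto
  then show ?thesis by (simp add: mult.assoc[symmetric] flip: exp_add) 
qed

lemma alpha_d1_lipschitz_a: "\<bar>alpha_d1 \<nu> a b - alpha_d1 \<nu> a' b\<bar> \<le> 1 * \<bar>a - a'\<bar>"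
  by (rule lipschitz_if_deriv_bounded[OF alpha_d1_deriv]) simp

lemma alpha_d1_lipschitz_b: "\<bar>alpha_d1 \<nu> a b - alpha_d1 \<nu> a b'\<bar> \<le> 1 * \<bar>b - b'\<bar>"
  unfolding alpha_d1_eq
proof (rule lipschitz_if_deriv_bounded[OF tilt_mean_deriv_b])
  have aux: "\<bar>p\<bar> \<le> 1 \<Longrightarrow> \<bar>q\<bar> \<le> 1 \<Longrightarrow> \<bar>(p - q) / 2\<bar> \<le> 1" for p q :: real by (auto simp: abs_le_iff)
  fix b show "\<bar>(tilt_mean \<nu> (1 + 2) a b - tilt_mean \<nu> 1 a b * tilt_mean \<nu> 2 a b) / 2\<bar> \<le> 1"
    by (rule aux) (auto intro!: abs_tilt_mean_mult_le simp del: One_nat_def)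
qed

lemma alpha_d2_deriv_a:
  "((\<lambda>a. alpha_d2 \<nu> a b) has_real_derivative
     tilt_mean \<nu> 3 a b - 3 * (tilt_mean \<nu> 1 a b * tilt_mean \<nu> 2 a b) + 2 * tilt_mean \<nu> 1 a b ^ 3) (at a)"
  unfolding alpha_d2_eq
  by (rule derivative_eq_intros refl)+ (simp add: eval_nat_numeral algebra_simps)

lemma alpha_d2_lipschitz_a: "\<bar>alpha_d2 \<nu> a b - alpha_d2 \<nu> a' b\<bar> \<le> 6 * \<bar>a - a'\<bar>"
proof (rule lipschitz_if_deriv_bounded[OF alpha_d2_deriv_a])
  fix a
  have "\<bar>tilt_mean \<nu> 1 a b ^ 3\<bar> \<le> 1" by (simp add: power_abs power_le_one del: One_nat_def)
  then show "\<bar>tilt_mean \<nu> 3 a b - 3 * (tilt_mean \<nu> 1 a b * tilt_mean \<nu> 2 a b) + 2 * tilt_mean \<nu> 1 a b ^ 3\<bar> \<le> 6"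
    using abs_tilt_mean_le[of 3 a b] abs_tilt_mean_mult_le[of 1 a b 2] by linarith
qed

lemma alpha_d2_lipschitz_b: "\<bar>alpha_d2 \<nu> a b - alpha_d2 \<nu> a b'\<bar> \<le> 3 * \<bar>b - b'\<bar>"
proof (rule lipschitz_if_deriv_bounded)
  fix b
  show "((\<lambda>b. alpha_d2 \<nu> a b) has_real_derivative
     (tilt_mean \<nu> 4 a b - tilt_mean \<nu> 2 a b * tilt_mean \<nu> 2 a b) / 2
      - tilt_mean \<nu> 1 a b * (tilt_mean \<nu> 3 a b - tilt_mean \<nu> 1 a b * tilt_mean \<nu> 2 a b)) (at b)"
    unfolding alpha_d2_eq
    by (rule derivative_eq_intros refl)+ (simp add: power2_eq_square field_simps eval_nat_numeral)
  have "\<bar>tilt_mean \<nu> 1 a b * (tilt_mean \<nu> 3 a b - tilt_mean \<nu> 1 a b * tilt_mean \<nu> 2 a b)\<bar> \<le> 1 * 2"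
  proof (rule abs_mult_bound)
    show "\<bar>tilt_mean \<nu> 3 a b - tilt_mean \<nu> 1 a b * tilt_mean \<nu> 2 a b\<bar> \<le> 2"
      using abs_tilt_mean_le[of 3 a b] abs_tilt_mean_mult_le[of 1 a b 2] by linarith
  qed (simp del: One_nat_def)
  moreover have "\<bar>p\<bar> \<le> 1 \<Longrightarrow> \<bar>q\<bar> \<le> 1 \<Longrightarrow> \<bar>r\<bar> \<le> 1 * 2 \<Longrightarrow> \<bar>(p - q) / 2 - r\<bar> \<le> 3" for p q r :: real by (auto simp: abs_le_iff diff_divide_distrib)
  ultimately show "\<bar>(tilt_mean \<nu> 4 a b - tilt_mean \<nu> 2 a b * tilt_mean \<nu> 2 a b) / 2
      - tilt_mean \<nu> 1 a b * (tilt_mean \<nu> 3 a b - tilt_mean \<nu> 1 a b * tilt_mean \<nu> 2 a b)\<bar> \<le> 3"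
    using abs_tilt_mean_le[of 4 a b] abs_tilt_mean_mult_le[of 2 a b 2] by simp
qed

text \<open>The number 26 is what the triangle inequality gives for a polynomial in moments bounded by 1; it only
  affects how small \<open>\<beta>\<close> has to be for the fixed-point system to contract.\<close>

lemma alpha_d2_second_deriv:
  obtains f' f'' where "\<And>a. ((\<lambda>a. alpha_d2 \<nu> a b) has_real_derivative f' a) (at a)"
    "\<And>a. (f' has_real_derivative f'' a) (at a)" "\<And>a. \<bar>f'' a\<bar> \<le> 26"
proof
  let ?r = "\<lambda>k a. tilt_mean \<nu> k a b"
  fix a
  show "((\<lambda>a. alpha_d2 \<nu> a b) has_real_derivative ?r 3 a - 3 * (?r 1 a * ?r 2 a) + 2 * ?r 1 a ^ 3) (at a)"
    by (rule alpha_d2_deriv_a)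
  show "((\<lambda>a. ?r 3 a - 3 * (?r 1 a * ?r 2 a) + 2 * ?r 1 a ^ 3) has_real_derivative
     (?r 4 a - ?r 3 a * ?r 1 a) - 3 * (alpha_d2 \<nu> a b * ?r 2 a + ?r 1 a * (?r 3 a - ?r 2 a * ?r 1 a))
      + 6 * ((?r 1 a * ?r 1 a) * alpha_d2 \<nu> a b)) (at a)"
    unfolding alpha_d2_eq
    by (rule derivative_eq_intros refl)+ (simp add: power2_eq_square field_simps eval_nat_numeral)
  have 1: "\<bar>alpha_d2 \<nu> a b * ?r 2 a\<bar> \<le> 1 * 1" by (rule abs_mult_bound) auto
  have 2: "\<bar>(?r 1 a * ?r 1 a) * alpha_d2 \<nu> a b\<bar> \<le> 1 * 1"
    by (rule abs_mult_bound[OF abs_tilt_mean_mult_le]) simp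
  have 3: "\<bar>?r 1 a * (?r 3 a - ?r 2 a * ?r 1 a)\<bar> \<le> 1 * 2"
  proof (rule abs_mult_bound)
    show "\<bar>?r 3 a - ?r 2 a * ?r 1 a\<bar> \<le> 2"
      using abs_tilt_mean_le[of 3 a b] abs_tilt_mean_mult_le[of 2 a b 1] by linarith
  qed (simp del: One_nat_def)
  have aux: "\<bar>p\<bar> \<le> 1 \<Longrightarrow> \<bar>q\<bar> \<le> 1 \<Longrightarrow> \<bar>r\<bar> \<le> 1 * 1 \<Longrightarrow> \<bar>s\<bar> \<le> 1 * 2 \<Longrightarrow> \<bar>t\<bar> \<le> 1 * 1 \<Longrightarrow>
      \<bar>(p - q) - 3 * (r + s) + 6 * t\<bar> \<le> 26" for p q r s t :: real by (auto simp: abs_le_iff)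
  show "\<bar>(?r 4 a - ?r 3 a * ?r 1 a) - 3 * (alpha_d2 \<nu> a b * ?r 2 a + ?r 1 a * (?r 3 a - ?r 2 a * ?r 1 a))
      + 6 * ((?r 1 a * ?r 1 a) * alpha_d2 \<nu> a b)\<bar> \<le> 26"
    by (rule aux[OF abs_tilt_mean_le abs_tilt_mean_mult_le 1 3 2])
qed

lemma alpha_d1_square_second_deriv:
  obtains f' f'' where "\<And>a. ((\<lambda>a. (alpha_d1 \<nu> a b)\<^sup>2) has_real_derivative f' a) (at a)"
    "\<And>a. (f' has_real_derivative f'' a) (at a)" "\<And>a. \<bar>f'' a\<bar> \<le> 26"
proof
  let ?r = "\<lambda>k a. tilt_mean \<nu> k a b"
  let ?v' = "\<lambda>a. ?r 3 a - 3 * (?r 1 a * ?r 2 a) + 2 * ?r 1 a ^ 3"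
  fix a
  show "((\<lambda>a. (alpha_d1 \<nu> a b)\<^sup>2) has_real_derivative 2 * (alpha_d1 \<nu> a b * alpha_d2 \<nu> a b)) (at a)"
    by (rule derivative_eq_intros refl alpha_d1_deriv)+ simp
  show "((\<lambda>a. 2 * (alpha_d1 \<nu> a b * alpha_d2 \<nu> a b)) has_real_derivative
    2 * (alpha_d2 \<nu> a b * alpha_d2 \<nu> a b + alpha_d1 \<nu> a b * ?v' a)) (at a)"
    by (rule derivative_eq_intros refl alpha_d1_deriv alpha_d2_deriv_a)+ simp
  have 1: "\<bar>alpha_d2 \<nu> a b * alpha_d2 \<nu> a b\<bar> \<le> 1 * 1" by (rule abs_mult_bound) auto
  have 2: "\<bar>alpha_d1 \<nu> a b * ?v' a\<bar> \<le> 1 * 6"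
  proof (rule abs_mult_bound)
    have "\<bar>?r 1 a ^ 3\<bar> \<le> 1" by (simp add: power_abs power_le_one del: One_nat_def)
    then show "\<bar>?v' a\<bar> \<le> 6"
      using abs_tilt_mean_le[of 3 a b] abs_tilt_mean_mult_le[of 1 a b 2] by linarith
  qed simp
  have aux: "\<bar>p\<bar> \<le> 1 * 1 \<Longrightarrow> \<bar>q\<bar> \<le> 1 * 6 \<Longrightarrow> \<bar>2 * (p + q)\<bar> \<le> 26" for p q :: real by (auto simp: abs_le_iff)
  show "\<bar>2 * (alpha_d2 \<nu> a b * alpha_d2 \<nu> a b + alpha_d1 \<nu> a b * ?v' a)\<bar> \<le> 26"
    by (rule aux[OF 1 2])
qed

lemma alpha_d1_square_lipschitz_a: "\<bar>(alpha_d1 \<nu> a b)\<^sup>2 - (alpha_d1 \<nu> a' b)\<^sup>2\<bar> \<le> 6 * \<bar>a - a'\<bar>"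
proof -
  have "\<bar>(alpha_d1 \<nu> a b)\<^sup>2 - (alpha_d1 \<nu> a' b)\<^sup>2\<bar> = \<bar>(alpha_d1 \<nu> a b + alpha_d1 \<nu> a' b) * (alpha_d1 \<nu> a b - alpha_d1 \<nu> a' b)\<bar>"
    by (simp add: power2_eq_square algebra_simps)
  also have "\<dots> \<le> 2 * (1 * \<bar>a - a'\<bar>)"
    using abs_alpha_d1_le[of a b] abs_alpha_d1_le[of a' b]
    by (intro abs_mult_bound alpha_d1_lipschitz_a) linarith
  finally show ?thesis by simp
qed

lemma alpha_d1_square_lipschitz_b: "\<bar>(alpha_d1 \<nu> a b)\<^sup>2 - (alpha_d1 \<nu> a b')\<^sup>2\<bar> \<le> 3 * \<bar>b - b'\<bar>"
proof -
  have "\<bar>(alpha_d1 \<nu> a b)\<^sup>2 - (alpha_d1 \<nu> a b')\<^sup>2\<bar> = \<bar>(alpha_d1 \<nu> a b + alpha_d1 \<nu> a b') * (alpha_d1 \<nu> a b - alpha_d1 \<nu> a b')\<bar>"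
    by (simp add: power2_eq_square algebra_simps)
  also have "\<dots> \<le> 2 * (1 * \<bar>b - b'\<bar>)"
    using abs_alpha_d1_le[of a b] abs_alpha_d1_le[of a b']
    by (intro abs_mult_bound alpha_d1_lipschitz_b) linarith
  finally show ?thesis by simp
qed

lemma alpha_d1_measurable [measurable]:
  assumes [measurable]: "f \<in> borel_measurable M" "g \<in> borel_measurable M"
  shows "(\<lambda>x. alpha_d1 \<nu> (f x) (g x)) \<in> borel_measurable M"
proof -
  have "(\<lambda>p. alpha_d1 \<nu> (fst p) (snd p)) \<in> borel_measurable borel"
    using separately_lipschitz_measurable[of "alpha_d1 \<nu>" 1] alpha_d1_lipschitz_a alpha_d1_lipschitz_b by simp
  from measurable_compose[of "\<lambda>x. (f x, g x)", OF _ this] show ?thesis by simp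
qed

lemma alpha_d2_measurable [measurable]:
  assumes [measurable]: "f \<in> borel_measurable M" "g \<in> borel_measurable M"
  shows "(\<lambda>x. alpha_d2 \<nu> (f x) (g x)) \<in> borel_measurable M"
proof -
  have "\<bar>alpha_d2 \<nu> a b - alpha_d2 \<nu> a b'\<bar> \<le> 6 * \<bar>b - b'\<bar>" for a b b'
    using alpha_d2_lipschitz_b[of a b b'] by linarith
  then have "(\<lambda>p. alpha_d2 \<nu> (fst p) (snd p)) \<in> borel_measurable borel"
    using separately_lipschitz_measurable[of "alpha_d2 \<nu>" 6] alpha_d2_lipschitz_a by simp
  from measurable_compose[of "\<lambda>x. (f x, g x)", OF _ this] show ?thesis by simp
qed

end

lemma interval_law_base_measure: "base_measure \<mu> \<Longrightarrow> interval_law \<mu>"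
proof -
  assume b: "base_measure \<mu>"
  interpret prob_space \<mu> using b by (simp add: base_measure_def)
  have s: "sets \<mu> = sets borel" and m: "prob {-1..1} = 1" using b by (auto simp: base_measure_def)
  have "AE x in \<mu>. x \<in> {-1..1}"
    using prob_eq_1[of "{-1..1}"] s m by auto
  then show ?thesis
    by unfold_locales (use s in \<open>auto elim!: eventually_mono simp: abs_le_iff\<close>)
qed

text \<open>A law of variance zero is a point mass and has only one support point.\<close>

lemma base_measure_variance_pos:
  assumes b: "base_measure \<mu>"
  shows "0 < alpha_d2 \<mu> 0 0"
proof (rule ccontr)
  assume neg: "\<not> ?thesis"
  interpret interval_law \<mu> by (rule interval_law_base_measure[OF b])
  have z: "alpha_d2 \<mu> 0 0 = 0" using neg alpha_d2_nonneg[of 0 0] by simp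
  define m where "m = alpha_d1 \<mu> 0 0"
  have "(\<integral>x. (x - m)\<^sup>2 * exp (0 * x + 0 / 2 * x\<^sup>2) \<partial>\<mu>) = 0"
    unfolding tilted_square by (simp add: m_def z)
  then have "(\<integral>x. (x - m)\<^sup>2 \<partial>\<mu>) = 0" by simp
  moreover have "integrable \<mu> (\<lambda>x. (x - m)\<^sup>2)"
  proof (rule integrable_bounded_on_interval[where G = "(1 + \<bar>m\<bar>)\<^sup>2"])
    fix x :: real assume "\<bar>x\<bar> \<le> 1"
    then have "\<bar>x - m\<bar> \<le> \<bar>1 + \<bar>m\<bar>\<bar>" by linarith
    then have "(x - m)\<^sup>2 \<le> (1 + \<bar>m\<bar>)\<^sup>2" by (simp only: abs_le_square_iff)
    then show "\<bar>(x - m)\<^sup>2\<bar> \<le> (1 + \<bar>m\<bar>)\<^sup>2" by simp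
  qed auto
  ultimately have ae: "AE x in \<mu>. (x - m)\<^sup>2 = 0" by (subst integral_nonneg_eq_0_iff_AE[symmetric]) auto
  have "x = m" if "x \<in> support_points \<mu>" for x
  proof (rule ccontr)
    assume "x \<noteq> m"
    then have "0 < measure \<mu> (- {m})" using that unfolding support_points_def by auto
    moreover have "AE x in \<mu>. x \<notin> - {m}" using ae by eventually_elim simp
    ultimately show False
      using AE_iff_null_sets[of "- {m}" \<mu>] by (auto simp: sets_law measure_eq_0_null_sets)
  qed
  then show False using b unfolding base_measure_def by auto
qed

section \<open>Operator norms and stability of the two algorithms\<close>

text \<open>A bound on the operator norm, stated as the inequality in which it is used; in this form it passes
  from \<open>\<beta> G\<^sub>n\<close> to \<open>G\<^sub>n\<close> by division.\<close>

definition bounded_matrix :: "nat \<Rightarrow> (nat \<Rightarrow> nat \<Rightarrow> real) \<Rightarrow> real \<Rightarrow> bool" where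
  "bounded_matrix n A \<kappa> \<longleftrightarrow> 0 \<le> \<kappa> \<and> (\<forall>x. L2_set (mat_vec n A x) {..<n} \<le> \<kappa> * L2_set x {..<n})"

lemma L2_set_const: "L2_set (\<lambda>i. c) {..<n} = \<bar>c\<bar> * sqrt (real n)"
  by (simp add: L2_set_def real_sqrt_mult)

lemma L2_set_mono_abs: "(\<And>i. i \<in> I \<Longrightarrow> \<bar>f i\<bar> \<le> g i) \<Longrightarrow> L2_set f I \<le> L2_set g I"
  unfolding L2_set_def by (intro real_sqrt_le_mono sum_mono) (metis abs_ge_self abs_le_square_iff order_trans)

lemma sum_abs_le_L2_set: "(\<Sum>i<n. \<bar>f i\<bar>) \<le> sqrt (real n) * L2_set f {..<n}"
  using L2_set_mult_ineq[of "\<lambda>i. 1" f "{..<n}"] by (simp add: L2_set_const)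

lemma mat_vec_diff: "mat_vec n A (\<lambda>i. x i - y i) i = mat_vec n A x i - mat_vec n A y i"
  by (simp add: mat_vec_def right_diff_distrib sum_subtractf)

lemma L2_set_mat_vec_le_frobenius:
  "L2_set (mat_vec n A x) {..<n} \<le> sqrt (\<Sum>i<n. \<Sum>j<n. (A i j)\<^sup>2) * L2_set x {..<n}"
proof -
  have "(\<Sum>i<n. (mat_vec n A x i)\<^sup>2) \<le> (\<Sum>i<n. (\<Sum>j<n. (A i j)\<^sup>2) * (\<Sum>j<n. (x j)\<^sup>2))"
    unfolding mat_vec_def by (intro sum_mono Cauchy_Schwarz_ineq_sum)
  then show ?thesis
    unfolding L2_set_def real_sqrt_mult[symmetric] sum_distrib_right[symmetric] by simp
qed

lemma bdd_above_op_norm: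
  "bdd_above ((\<lambda>x. L2_set (mat_vec n A x) {..<n}) ` {x. L2_set x {..<n} \<le> 1})"
proof (rule bdd_aboveI2)
  fix x :: "nat \<Rightarrow> real" assume "x \<in> {x. L2_set x {..<n} \<le> 1}"
  then have "sqrt (\<Sum>i<n. \<Sum>j<n. (A i j)\<^sup>2) * L2_set x {..<n} \<le> sqrt (\<Sum>i<n. \<Sum>j<n. (A i j)\<^sup>2) * 1"
    by (intro mult_left_mono) (auto intro!: sum_nonneg)
  then show "L2_set (mat_vec n A x) {..<n} \<le> sqrt (\<Sum>i<n. \<Sum>j<n. (A i j)\<^sup>2)"
    using L2_set_mat_vec_le_frobenius[of n A x] by simp
qed

lemma L2_set_scale: "L2_set (\<lambda>i. c * x i) I = \<bar>c\<bar> * L2_set x I" for c :: real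
  by (simp add: L2_set_def power_mult_distrib real_sqrt_mult flip: sum_distrib_left)

lemma bounded_matrix_op_norm:
  assumes "op_norm n A \<le> \<kappa>"
  shows "bounded_matrix n A \<kappa>"
proof -
  have le: "L2_set (mat_vec n A x) {..<n} \<le> op_norm n A" if "L2_set x {..<n} \<le> 1" for x
    unfolding op_norm_def by (rule cSUP_upper[OF _ bdd_above_op_norm]) (use that in simp)
  have "0 \<le> op_norm n A" by (rule order_trans[OF L2_set_nonneg le[of "\<lambda>_. 0"]]) (simp add: L2_set_const)
  then have k: "0 \<le> \<kappa>" using assms by simp
  have "L2_set (mat_vec n A x) {..<n} \<le> \<kappa> * L2_set x {..<n}" for x
  proof (cases "L2_set x {..<n} = 0")
    case True
    then have "\<forall>i<n. x i = 0" by (simp add: L2_set_eq_0_iff)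
    then have "mat_vec n A x = (\<lambda>i. 0)" by (simp add: mat_vec_def fun_eq_iff)
    then show ?thesis using True by (simp add: L2_set_const)
  next
    case False
    define l where "l = L2_set x {..<n}"
    have l: "0 < l" using False by (simp add: l_def less_le)
    have "mat_vec n A (\<lambda>i. (1/l) * x i) = (\<lambda>i. (1/l) * mat_vec n A x i)"
      by (simp add: mat_vec_def fun_eq_iff sum_distrib_left mult_ac divide_simps)
    then have "\<bar>1/l\<bar> * L2_set (mat_vec n A x) {..<n} = L2_set (mat_vec n A (\<lambda>i. (1/l) * x i)) {..<n}"
      by (simp only: L2_set_scale)
    also have "\<dots> \<le> op_norm n A" using l by (intro le) (simp only: L2_set_scale, simp add: l_def)
    also have "\<dots> \<le> \<kappa>" by fact
    finally show ?thesis using l by (simp add: field_simps flip: l_def)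
  qed
  then show ?thesis using k by (simp add: bounded_matrix_def)
qed

lemma L2_set_mat_vec_le: "bounded_matrix n A \<kappa> \<Longrightarrow> L2_set (mat_vec n A x) {..<n} \<le> \<kappa> * L2_set x {..<n}"
  by (simp add: bounded_matrix_def)

lemma bounded_matrix_column:
  assumes A: "bounded_matrix n A \<kappa>" and j: "j < n"
  shows "(\<Sum>i<n. (A i j)\<^sup>2) \<le> \<kappa>\<^sup>2"
proof -
  have "mat_vec n A (\<lambda>i. if i = j then 1 else 0) i = A i j" for i
    unfolding mat_vec_def using j by (subst sum.cong[OF refl, of _ _ "\<lambda>k. if k = j then A i k else 0"]) auto
  moreover have "L2_set (\<lambda>i. if i = j then 1 else 0) {..<n} = (1::real)"
    unfolding L2_set_def using j
    by (subst sum.cong[OF refl, of _ _ "\<lambda>k. if k = j then 1 else 0"]) auto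
  ultimately have "L2_set (\<lambda>i. A i j) {..<n} \<le> \<kappa>"
    using L2_set_mat_vec_le[OF A, of "\<lambda>i. if i = j then 1 else 0"] by (simp add: L2_set_def)
  then have "(L2_set (\<lambda>i. A i j) {..<n})\<^sup>2 \<le> \<kappa>\<^sup>2" by (intro power_mono) auto
  then show ?thesis by (simp add: L2_set_def sum_nonneg)
qed

lemma bounded_matrix_entry:
  assumes A: "bounded_matrix n A \<kappa>" and "i < n" "j < n"
  shows "\<bar>A i j\<bar> \<le> \<kappa>"
proof -
  have "(A i j)\<^sup>2 \<le> (\<Sum>i<n. (A i j)\<^sup>2)" using assms(2) by (intro member_le_sum) auto
  also have "\<dots> \<le> \<kappa>\<^sup>2" by (rule bounded_matrix_column[OF A assms(3)])
  finally show ?thesis using A by (simp add: bounded_matrix_def abs_le_square_iff[symmetric])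
qed

text \<open>The second moment bounds use the norm of the matrix only through this inequality, whose left side,
  unlike the operator norm, is visibly a measurable function of the entries.\<close>

lemma bounded_matrix_frobenius:
  assumes A: "bounded_matrix n A \<kappa>"
  shows "(\<Sum>i<n. \<Sum>j<n. (A i j)\<^sup>2) \<le> real n * \<kappa>\<^sup>2"
proof -
  have "(\<Sum>i<n. \<Sum>j<n. (A i j)\<^sup>2) = (\<Sum>j<n. \<Sum>i<n. (A i j)\<^sup>2)" by (rule sum.swap)
  also have "\<dots> \<le> (\<Sum>j<n. \<kappa>\<^sup>2)" by (intro sum_mono bounded_matrix_column[OF A]) simp
  finally show ?thesis by simp
qed

lemma bounded_matrix_rescale:
  assumes A: "bounded_matrix n A \<kappa>" and AG: "\<forall>i<n. \<forall>j<n. A i j = \<beta> * G i j" and b: "\<beta> > 0"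
  shows "bounded_matrix n G (\<kappa> / \<beta>)"
proof -
  have "\<beta> * L2_set (mat_vec n G x) {..<n} \<le> \<kappa> * L2_set x {..<n}" for x
  proof -
    have "L2_set (mat_vec n A x) {..<n} = L2_set (\<lambda>i. \<beta> * mat_vec n G x i) {..<n}"
      by (rule L2_set_cong) (auto simp: mat_vec_def sum_distrib_left AG mult_ac)
    also have "\<dots> = \<beta> * L2_set (mat_vec n G x) {..<n}" using b by (simp add: L2_set_scale)
    finally show ?thesis using L2_set_mat_vec_le[OF A, of x] by simp
  qed
  then show ?thesis using A b by (auto simp: bounded_matrix_def field_simps)
qed

text \<open>Averages are controlled by the Euclidean distance at scale \<open>\<surd>n\<close>, which is the scale on which both
  iterations are stable.\<close>

lemma DE_of_diff_le:
  assumes "\<forall>i<n. \<bar>tb i\<bar> \<le> 1" and "L2_set (\<lambda>i. u i - u' i) {..<n} \<le> D * sqrt (real n)" and "0 \<le> D"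
  shows "\<bar>DE_of n tb u - DE_of n tb u'\<bar> \<le> 2 * D"
proof (cases "n = 0")
  case False
  have "\<bar>(\<Sum>i<n. tb i * u i) - (\<Sum>i<n. tb i * u' i)\<bar> = \<bar>\<Sum>i<n. tb i * (u i - u' i)\<bar>"
    by (simp add: right_diff_distrib sum_subtractf)
  also have "\<dots> \<le> (\<Sum>i<n. \<bar>tb i * (u i - u' i)\<bar>)" by (rule sum_abs)
  also have "\<dots> \<le> (\<Sum>i<n. \<bar>u i - u' i\<bar>)"
    using assms(1) by (intro sum_mono) (auto simp: abs_mult intro!: mult_left_le_one_le)
  also have "\<dots> \<le> sqrt (real n) * (D * sqrt (real n))"
    by (rule order_trans[OF sum_abs_le_L2_set mult_left_mono]) (use assms(2) in auto)
  also have "\<dots> = D * real n" by (simp add: mult.left_commute)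
  finally have "\<bar>(\<Sum>i<n. tb i * u i) - (\<Sum>i<n. tb i * u' i)\<bar> \<le> D * real n" .
  moreover have "\<bar>DE_of n tb u - DE_of n tb u'\<bar> = 2 / real n * \<bar>(\<Sum>i<n. tb i * u i) - (\<Sum>i<n. tb i * u' i)\<bar>"
    unfolding DE_of_def right_diff_distrib[symmetric] abs_mult by simp
  ultimately have "\<bar>DE_of n tb u - DE_of n tb u'\<bar> \<le> 2 / real n * (D * real n)"
    by (simp only:) (intro mult_left_mono, auto)
  then show ?thesis using False by simp
qed (use assms in \<open>simp add: DE_of_def\<close>)

lemma IE_of_diff_le:
  assumes "\<forall>i<n. \<bar>tb i\<bar> \<le> 1" and u: "L2_set (\<lambda>i. u i - u' i) {..<n} \<le> D * sqrt (real n)"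
    and v: "L2_set (\<lambda>i. v i - v' i) {..<n} \<le> D * sqrt (real n)" and "0 \<le> D"
  shows "\<bar>IE_of n tb u v - IE_of n tb u' v'\<bar> \<le> 3 * D"
proof -
  have IE: "IE_of n tb u v = DE_of n (\<lambda>_. 1) u / 2 - DE_of n (\<lambda>_. 1) v / 2 - DE_of n tb u / 2" for u v
    unfolding IE_of_def DE_of_def by (simp add: diff_divide_distrib)
  have "\<bar>DE_of n (\<lambda>_. 1) u - DE_of n (\<lambda>_. 1) u'\<bar> \<le> 2 * D" "\<bar>DE_of n (\<lambda>_. 1) v - DE_of n (\<lambda>_. 1) v'\<bar> \<le> 2 * D"
    "\<bar>DE_of n tb u - DE_of n tb u'\<bar> \<le> 2 * D"
    using assms by (auto intro!: DE_of_diff_le)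
  then show ?thesis unfolding IE abs_le_iff by (auto simp: field_simps)
qed

context interval_law
begin

lemma alpha_d1_joint_lipschitz: "\<bar>alpha_d1 \<nu> a b - alpha_d1 \<nu> a' b'\<bar> \<le> \<bar>a - a'\<bar> + \<bar>b - b'\<bar>"
  using alpha_d1_lipschitz_a[of a b a'] alpha_d1_lipschitz_b[of a' b b'] by (smt (verit))

lemma alpha_d2_joint_lipschitz: "\<bar>alpha_d2 \<nu> a b - alpha_d2 \<nu> a' b'\<bar> \<le> 6 * (\<bar>a - a'\<bar> + \<bar>b - b'\<bar>)"
  using alpha_d2_lipschitz_a[of a b a'] alpha_d2_lipschitz_b[of a' b b'] by (smt (verit))

text \<open>The gradient \<open>\<alpha>'\<close> is 1-Lipschitz, so each step expands errors by at most the norm of the matrix and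
  adds the error of the field.\<close>

lemma mf_iter_stable:
  assumes A: "bounded_matrix n A \<kappa>" and h: "\<forall>i<n. \<bar>h i - h' i\<bar> \<le> \<delta>"
  shows "L2_set (\<lambda>i. mf_iter \<nu> n A h K i - mf_iter \<nu> n A h' K i) {..<n}
    \<le> ((\<lambda>L. \<kappa> * L + 1) ^^ K) 0 * (\<bar>\<delta>\<bar> * sqrt (real n))"
proof (induction K)
  case (Suc K)
  let ?u = "mf_iter \<nu> n A h K" and ?v = "mf_iter \<nu> n A h' K"
  have "L2_set (\<lambda>i. mf_iter \<nu> n A h (Suc K) i - mf_iter \<nu> n A h' (Suc K) i) {..<n}
      \<le> L2_set (\<lambda>i. \<bar>mat_vec n A (\<lambda>j. ?u j - ?v j) i\<bar> + \<bar>\<delta>\<bar>) {..<n}"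
  proof (rule L2_set_mono_abs)
    fix i assume "i \<in> {..<n}"
    then have "\<bar>h i - h' i\<bar> \<le> \<delta>" using h by simp
    then show "\<bar>mf_iter \<nu> n A h (Suc K) i - mf_iter \<nu> n A h' (Suc K) i\<bar> \<le> \<bar>mat_vec n A (\<lambda>j. ?u j - ?v j) i\<bar> + \<bar>\<delta>\<bar>"
      using alpha_d1_joint_lipschitz[of "mat_vec n A ?u i + h i" 0 "mat_vec n A ?v i + h' i" 0]
      by (simp add: mat_vec_diff)
  qed
  also have "\<dots> \<le> L2_set (\<lambda>i. \<bar>mat_vec n A (\<lambda>j. ?u j - ?v j) i\<bar>) {..<n} + L2_set (\<lambda>i. \<bar>\<delta>\<bar>) {..<n}"
    by (rule L2_set_triangle_ineq)
  also have "\<dots> = L2_set (mat_vec n A (\<lambda>j. ?u j - ?v j)) {..<n} + \<bar>\<delta>\<bar> * sqrt (real n)"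
    by (simp add: L2_set_const) (simp add: L2_set_def)
  also have "\<dots> \<le> \<kappa> * L2_set (\<lambda>j. ?u j - ?v j) {..<n} + \<bar>\<delta>\<bar> * sqrt (real n)"
    using L2_set_mat_vec_le[OF A] by simp
  also have "\<dots> \<le> \<kappa> * (((\<lambda>L. \<kappa> * L + 1) ^^ K) 0 * (\<bar>\<delta>\<bar> * sqrt (real n))) + \<bar>\<delta>\<bar> * sqrt (real n)"
    using Suc A by (simp add: bounded_matrix_def mult_left_mono)
  finally show ?case by (simp add: algebra_simps)
qed (simp add: L2_set_const)

lemma amp_nonlinearity_stable:
  assumes h: "\<forall>i<n. \<bar>h i - h' i\<bar> \<le> \<delta>" and s: "\<bar>s - s'\<bar> \<le> \<delta>" and b: "0 \<le> \<beta>"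
    and u: "L2_set (\<lambda>i. u i - u' i) {..<n} \<le> L * \<delta> * sqrt (real n)"
  shows "L2_set (\<lambda>i. alpha_d1 \<nu> (\<beta> * u i + h i) (\<beta>\<^sup>2 * s) - alpha_d1 \<nu> (\<beta> * u' i + h' i) (\<beta>\<^sup>2 * s')) {..<n}
      \<le> (\<beta> * L + 1 + \<beta>\<^sup>2) * \<delta> * sqrt (real n)" (is "?G1")
    and "(\<Sum>i<n. \<bar>alpha_d2 \<nu> (\<beta> * u i + h i) (\<beta>\<^sup>2 * s) - alpha_d2 \<nu> (\<beta> * u' i + h' i) (\<beta>\<^sup>2 * s')\<bar>)
      \<le> 6 * (\<beta> * L + 1 + \<beta>\<^sup>2) * \<delta> * real n" (is "?G2")
proof -
  have d: "0 \<le> \<delta>" using s by simp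
  define e where "e i = \<beta> * \<bar>u i - u' i\<bar> + (1 + \<beta>\<^sup>2) * \<delta>" for i
  have e: "\<bar>(\<beta> * u i + h i) - (\<beta> * u' i + h' i)\<bar> + \<bar>\<beta>\<^sup>2 * s - \<beta>\<^sup>2 * s'\<bar> \<le> e i" if "i < n" for i
  proof -
    have "\<bar>(\<beta> * u i + h i) - (\<beta> * u' i + h' i)\<bar> \<le> \<bar>\<beta> * (u i - u' i)\<bar> + \<bar>h i - h' i\<bar>"
      unfolding right_diff_distrib by linarith
    moreover have "\<bar>\<beta> * (u i - u' i)\<bar> = \<beta> * \<bar>u i - u' i\<bar>" using b by (simp add: abs_mult)
    moreover have "\<bar>\<beta>\<^sup>2 * s - \<beta>\<^sup>2 * s'\<bar> \<le> \<beta>\<^sup>2 * \<delta>"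
      using s by (simp add: abs_mult mult_left_mono flip: right_diff_distrib)
    ultimately show ?thesis using h that unfolding e_def by (simp add: algebra_simps) (smt (verit))
  qed
  have L2e: "L2_set e {..<n} \<le> (\<beta> * L + 1 + \<beta>\<^sup>2) * \<delta> * sqrt (real n)"
  proof -
    have "L2_set e {..<n} \<le> L2_set (\<lambda>i. \<beta> * \<bar>u i - u' i\<bar>) {..<n} + L2_set (\<lambda>i. (1 + \<beta>\<^sup>2) * \<delta>) {..<n}"
      unfolding e_def by (rule L2_set_triangle_ineq)
    also have "L2_set (\<lambda>i. \<beta> * \<bar>u i - u' i\<bar>) {..<n} = \<beta> * L2_set (\<lambda>i. u i - u' i) {..<n}"
      unfolding L2_set_scale using b by (simp add: L2_set_def)
    also have "\<dots> \<le> \<beta> * (L * \<delta> * sqrt (real n))" by (rule mult_left_mono[OF u b])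
    also have "L2_set (\<lambda>i. (1 + \<beta>\<^sup>2) * \<delta>) {..<n} = (1 + \<beta>\<^sup>2) * \<delta> * sqrt (real n)"
      unfolding L2_set_const using d by (simp add: abs_mult)
    finally show ?thesis by (simp add: algebra_simps)
  qed
  have "L2_set (\<lambda>i. alpha_d1 \<nu> (\<beta> * u i + h i) (\<beta>\<^sup>2 * s) - alpha_d1 \<nu> (\<beta> * u' i + h' i) (\<beta>\<^sup>2 * s')) {..<n} \<le> L2_set e {..<n}"
    by (rule L2_set_mono_abs, rule order_trans[OF alpha_d1_joint_lipschitz e]) simp
  with L2e show ?G1 by simp
  have "(\<Sum>i<n. \<bar>alpha_d2 \<nu> (\<beta> * u i + h i) (\<beta>\<^sup>2 * s) - alpha_d2 \<nu> (\<beta> * u' i + h' i) (\<beta>\<^sup>2 * s')\<bar>) \<le> (\<Sum>i<n. 6 * \<bar>e i\<bar>)"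
  proof (rule sum_mono)
    fix i assume "i \<in> {..<n}"
    then have "\<bar>(\<beta> * u i + h i) - (\<beta> * u' i + h' i)\<bar> + \<bar>\<beta>\<^sup>2 * s - \<beta>\<^sup>2 * s'\<bar> \<le> \<bar>e i\<bar>"
      using e[of i] by simp
    then show "\<bar>alpha_d2 \<nu> (\<beta> * u i + h i) (\<beta>\<^sup>2 * s) - alpha_d2 \<nu> (\<beta> * u' i + h' i) (\<beta>\<^sup>2 * s')\<bar> \<le> 6 * \<bar>e i\<bar>"
      by (intro order_trans[OF alpha_d2_joint_lipschitz]) simp
  qed
  also have "\<dots> \<le> 6 * (sqrt (real n) * L2_set e {..<n})"
    unfolding sum_distrib_left[symmetric] using sum_abs_le_L2_set[of e n] by simp
  also have "\<dots> \<le> 6 * (sqrt (real n) * ((\<beta> * L + 1 + \<beta>\<^sup>2) * \<delta> * sqrt (real n)))"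
    using L2e by (intro mult_left_mono) auto
  also have "\<dots> = 6 * (\<beta> * L + 1 + \<beta>\<^sup>2) * \<delta> * (sqrt (real n) * sqrt (real n))" by (simp only: mult_ac)
  also have "\<dots> = 6 * (\<beta> * L + 1 + \<beta>\<^sup>2) * \<delta> * real n" by simp
  finally show ?G2 .
qed

text \<open>The Onsager coefficient is an average of bounded Lipschitz functions of the previous iterate, so it
  is as stable as the iterate itself; it multiplies a bounded vector.\<close>

lemma amp_iter_stable:
  assumes b: "0 \<le> \<beta>" and k: "0 \<le> \<kappa>"
  shows "\<exists>L\<ge>0. \<forall>n G q s q' s' h h' \<delta>. bounded_matrix n G \<kappa> \<longrightarrow> \<bar>sqrt q - sqrt q'\<bar> \<le> \<delta> \<longrightarrow> \<bar>s - s'\<bar> \<le> \<delta> \<longrightarrow>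
     (\<forall>i<n. \<bar>h i - h' i\<bar> \<le> \<delta>) \<longrightarrow>
     L2_set (\<lambda>i. amp_iter \<nu> n \<beta> G (q, s) h K i - amp_iter \<nu> n \<beta> G (q', s') h' K i) {..<n} \<le> L * \<delta> * sqrt (real n)"
    (is "\<exists>L\<ge>0. ?P L K")
proof (induction K rule: less_induct)
  case (less K)
  consider "K = 0" | "K = 1" | "K = 2" | k where "K = Suc (Suc (Suc k))"
    by (metis One_nat_def Suc_1 not0_implies_Suc)
  then show ?case
  proof cases
    case 1 then show ?thesis by (intro exI[of _ 0]) (simp add: L2_set_const)
  next
    case 2 then show ?thesis by (intro exI[of _ 0]) (simp add: L2_set_const)
  next
    case 3
    have "?P \<kappa> K"
    proof (intro allI impI)
      fix n G q s q' s' and h h' :: "nat \<Rightarrow> real" and \<delta>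
      assume G: "bounded_matrix n G \<kappa>" and q: "\<bar>sqrt q - sqrt q'\<bar> \<le> \<delta>"
      have "L2_set (\<lambda>i. amp_iter \<nu> n \<beta> G (q, s) h K i - amp_iter \<nu> n \<beta> G (q', s') h' K i) {..<n}
        = L2_set (mat_vec n G (\<lambda>i. sqrt q - sqrt q')) {..<n}"
        unfolding mat_vec_diff unfolding 3 numeral_2_eq_2 by (simp add: mat_vec_def)
      also have "\<dots> \<le> \<kappa> * (\<bar>sqrt q - sqrt q'\<bar> * sqrt (real n))"
        using L2_set_mat_vec_le[OF G, of "\<lambda>i. sqrt q - sqrt q'"] by (simp add: L2_set_const)
      also have "\<dots> \<le> \<kappa> * (\<delta> * sqrt (real n))" using k q by (intro mult_left_mono mult_right_mono) auto
      finally show "L2_set (\<lambda>i. amp_iter \<nu> n \<beta> G (q, s) h K i - amp_iter \<nu> n \<beta> G (q', s') h' K i) {..<n} \<le> \<kappa> * \<delta> * sqrt (real n)"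
        by simp
    qed
    then show ?thesis using k by blast
  next
    case (4 k)
    obtain L1 where L1: "L1 \<ge> 0" "?P L1 (Suc k)" using less[of "Suc k"] 4 by auto
    obtain L2 where L2: "L2 \<ge> 0" "?P L2 (Suc (Suc k))" using less[of "Suc (Suc k)"] 4 by auto
    define D1 where "D1 = \<beta> * L1 + 1 + \<beta>\<^sup>2"
    define D2 where "D2 = \<beta> * L2 + 1 + \<beta>\<^sup>2"
    have D: "0 \<le> D1" "0 \<le> D2" using L1 L2 b by (auto simp: D1_def D2_def)
    have "?P (\<kappa> * D2 + (6 * \<beta> * D2 + \<beta> * D1)) K"
    proof (intro allI impI)
      fix n G q s q' s' and h h' :: "nat \<Rightarrow> real" and \<delta>
      assume G: "bounded_matrix n G \<kappa>" and q: "\<bar>sqrt q - sqrt q'\<bar> \<le> \<delta>" and s: "\<bar>s - s'\<bar> \<le> \<delta>"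
        and h: "\<forall>i<n. \<bar>h i - h' i\<bar> \<le> \<delta>"
      have d: "0 \<le> \<delta>" using s by simp
      let ?a = "\<lambda>k. amp_iter \<nu> n \<beta> G (q, s) h k" and ?a' = "\<lambda>k. amp_iter \<nu> n \<beta> G (q', s') h' k"
      define m where "m k i = alpha_d1 \<nu> (\<beta> * ?a k i + h i) (\<beta>\<^sup>2 * s)" for k i
      define m' where "m' k i = alpha_d1 \<nu> (\<beta> * ?a' k i + h' i) (\<beta>\<^sup>2 * s')" for k i
      define v where "v i = alpha_d2 \<nu> (\<beta> * ?a (Suc (Suc k)) i + h i) (\<beta>\<^sup>2 * s)" for i
      define v' where "v' i = alpha_d2 \<nu> (\<beta> * ?a' (Suc (Suc k)) i + h' i) (\<beta>\<^sup>2 * s')" for i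
      define c where "c = \<beta> / real n * (\<Sum>j<n. v j)"
      define c' where "c' = \<beta> / real n * (\<Sum>j<n. v' j)"
      note P1 = L1(2)[rule_format, OF G q s h[rule_format], simplified]
      note P2 = L2(2)[rule_format, OF G q s h[rule_format], simplified]
      have m1: "L2_set (\<lambda>i. m (Suc k) i - m' (Suc k) i) {..<n} \<le> D1 * \<delta> * sqrt (real n)"
        unfolding m_def m'_def D1_def by (rule amp_nonlinearity_stable(1)[OF h s b P1])
      have m2: "L2_set (\<lambda>i. m (Suc (Suc k)) i - m' (Suc (Suc k)) i) {..<n} \<le> D2 * \<delta> * sqrt (real n)"
        unfolding m_def m'_def D2_def by (rule amp_nonlinearity_stable(1)[OF h s b P2])
      have v: "(\<Sum>i<n. \<bar>v i - v' i\<bar>) \<le> 6 * D2 * \<delta> * real n"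
        unfolding v_def v'_def D2_def by (rule amp_nonlinearity_stable(2)[OF h s b P2])
      have cc: "\<bar>c - c'\<bar> \<le> 6 * \<beta> * D2 * \<delta>"
      proof (cases "n = 0")
        case False
        have "\<bar>c - c'\<bar> = \<beta> / real n * \<bar>\<Sum>j<n. v j - v' j\<bar>"
          unfolding c_def c'_def sum_subtractf right_diff_distrib[symmetric] abs_mult using b by simp
        also have "\<dots> \<le> \<beta> / real n * (6 * D2 * \<delta> * real n)"
          using b v by (intro mult_left_mono order_trans[OF sum_abs]) auto
        finally show ?thesis using False by simp
      qed (use b D d in \<open>simp add: c_def c'_def\<close>)
      have c': "\<bar>c'\<bar> \<le> \<beta>"
      proof (cases "n = 0")
        case False
        have "\<bar>\<Sum>j<n. v' j\<bar> \<le> (\<Sum>j<n. 1)" by (rule order_trans[OF sum_abs sum_mono]) (simp add: v'_def)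
        then have "\<beta> / real n * \<bar>\<Sum>j<n. v' j\<bar> \<le> \<beta> / real n * real n" using b by (intro mult_left_mono) auto
        then show ?thesis using False b by (simp add: c'_def abs_mult)
      qed (use b in \<open>simp add: c'_def\<close>)
      have "L2_set (\<lambda>i. ?a K i - ?a' K i) {..<n}
         \<le> L2_set (\<lambda>i. \<bar>mat_vec n G (\<lambda>l. m (Suc (Suc k)) l - m' (Suc (Suc k)) l) i\<bar> +
             (6 * \<beta> * D2 * \<delta> + \<beta> * \<bar>m (Suc k) i - m' (Suc k) i\<bar>)) {..<n}"
      proof (rule L2_set_mono_abs)
        fix i
        have "?a K i - ?a' K i = mat_vec n G (\<lambda>l. m (Suc (Suc k)) l - m' (Suc (Suc k)) l) i
           - ((c - c') * m (Suc k) i + c' * (m (Suc k) i - m' (Suc k) i))"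
          unfolding 4 mat_vec_diff by (simp add: m_def m'_def v_def v'_def c_def c'_def mat_vec_def algebra_simps)
        moreover have "\<bar>(c - c') * m (Suc k) i\<bar> \<le> 6 * \<beta> * D2 * \<delta> * 1"
          by (rule abs_mult_bound[OF cc]) (simp add: m_def)
        moreover have "\<bar>c' * (m (Suc k) i - m' (Suc k) i)\<bar> \<le> \<beta> * \<bar>m (Suc k) i - m' (Suc k) i\<bar>"
          by (rule abs_mult_bound[OF c']) simp
        ultimately show "\<bar>?a K i - ?a' K i\<bar> \<le> \<bar>mat_vec n G (\<lambda>l. m (Suc (Suc k)) l - m' (Suc (Suc k)) l) i\<bar> +
             (6 * \<beta> * D2 * \<delta> + \<beta> * \<bar>m (Suc k) i - m' (Suc k) i\<bar>)" by linarith
      qed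
      also have "\<dots> \<le> L2_set (\<lambda>i. \<bar>mat_vec n G (\<lambda>l. m (Suc (Suc k)) l - m' (Suc (Suc k)) l) i\<bar>) {..<n} +
          (L2_set (\<lambda>i. 6 * \<beta> * D2 * \<delta>) {..<n} + L2_set (\<lambda>i. \<beta> * \<bar>m (Suc k) i - m' (Suc k) i\<bar>) {..<n})"
        by (intro order_trans[OF L2_set_triangle_ineq] add_left_mono L2_set_triangle_ineq)
      also have "\<dots> = L2_set (mat_vec n G (\<lambda>l. m (Suc (Suc k)) l - m' (Suc (Suc k)) l)) {..<n} +
          (6 * \<beta> * D2 * \<delta> * sqrt (real n) + \<beta> * L2_set (\<lambda>i. m (Suc k) i - m' (Suc k) i) {..<n})"
        unfolding L2_set_scale L2_set_const using b D d by (simp add: L2_set_def)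
      also have "\<dots> \<le> \<kappa> * (D2 * \<delta> * sqrt (real n)) + (6 * \<beta> * D2 * \<delta> * sqrt (real n) + \<beta> * (D1 * \<delta> * sqrt (real n)))"
        using L2_set_mat_vec_le[OF G] assms(2)
        by (intro add_mono mult_left_mono m1 b order_refl order_trans[OF L2_set_mat_vec_le[OF G] mult_left_mono[OF m2]]) auto
      also have "\<dots> = (\<kappa> * D2 + (6 * \<beta> * D2 + \<beta> * D1)) * \<delta> * sqrt (real n)" by (simp add: algebra_simps)
      finally show "L2_set (\<lambda>i. ?a K i - ?a' K i) {..<n} \<le> (\<kappa> * D2 + (6 * \<beta> * D2 + \<beta> * D1)) * \<delta> * sqrt (real n)" .
    qed
    moreover have "0 \<le> \<kappa> * D2 + (6 * \<beta> * D2 + \<beta> * D1)" using D b assms(2) by simp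
    ultimately show ?thesis by blast
  qed
qed

lemma amp_output_stable:
  assumes b: "0 \<le> \<beta>" and k: "0 \<le> \<kappa>"
  shows "\<exists>L\<ge>0. \<forall>n G p p' h h' \<delta>. bounded_matrix n G \<kappa> \<longrightarrow> \<bar>sqrt (fst p) - sqrt (fst p')\<bar> \<le> \<delta> \<longrightarrow>
     \<bar>snd p - snd p'\<bar> \<le> \<delta> \<longrightarrow> (\<forall>i<n. \<bar>h i - h' i\<bar> \<le> \<delta>) \<longrightarrow>
     L2_set (\<lambda>i. amp_output \<nu> n \<beta> G p h K i - amp_output \<nu> n \<beta> G p' h' K i) {..<n} \<le> L * \<delta> * sqrt (real n)"
proof -
  obtain L where L: "L \<ge> 0" "\<And>n G q s q' s' h h' \<delta>. bounded_matrix n G \<kappa> \<Longrightarrow> \<bar>sqrt q - sqrt q'\<bar> \<le> \<delta> \<Longrightarrow> \<bar>s - s'\<bar> \<le> \<delta> \<Longrightarrow>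
     (\<forall>i<n. \<bar>h i - h' i\<bar> \<le> \<delta>) \<Longrightarrow>
     L2_set (\<lambda>i. amp_iter \<nu> n \<beta> G (q, s) h K i - amp_iter \<nu> n \<beta> G (q', s') h' K i) {..<n} \<le> L * \<delta> * sqrt (real n)"
    using amp_iter_stable[OF b k, of K] by blast
  show ?thesis
  proof (intro exI[of _ "\<beta> * L + 1 + \<beta>\<^sup>2"] conjI allI impI)
    fix n G p p' h h' \<delta>
    assume G: "bounded_matrix n G \<kappa>" and q: "\<bar>sqrt (fst p) - sqrt (fst p')\<bar> \<le> \<delta>" and s: "\<bar>snd p - snd p'\<bar> \<le> \<delta>"
      and h: "\<forall>i<n. \<bar>h i - h' i\<bar> \<le> \<delta>"
    show "L2_set (\<lambda>i. amp_output \<nu> n \<beta> G p h K i - amp_output \<nu> n \<beta> G p' h' K i) {..<n} \<le> (\<beta> * L + 1 + \<beta>\<^sup>2) * \<delta> * sqrt (real n)"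
      unfolding amp_output_def
      by (rule amp_nonlinearity_stable(1)[OF h s b]) (use L(2)[OF G q s h] in simp)
  qed (use b L in simp)
qed

end

section \<open>The fixed-point system\<close>

text \<open>The even part of \<open>f\<close> around \<open>w\<close> is a Lipschitz function of the square of the displacement.  This is
  what makes Gaussian averages Lipschitz in the variance, down to variance zero, although the standard
  deviation is not.\<close>

lemma symmetric_second_difference:
  fixes f f' f'' :: "real \<Rightarrow> real"
  assumes f: "\<And>x. (f has_real_derivative f' x) (at x)" and f': "\<And>x. (f' has_real_derivative f'' x) (at x)"
    and D: "\<And>x. \<bar>f'' x\<bar> \<le> D"
  shows "\<bar>(f (w + a) + f (w - a)) - (f (w + b) + f (w - b))\<bar> \<le> D * \<bar>a\<^sup>2 - b\<^sup>2\<bar>"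
proof -
  define g where "g t = f (w + t) + f (w - t)" for t
  have g': "(g has_real_derivative f' (w + t) - f' (w - t)) (at t)" for t
    unfolding g_def by (rule derivative_eq_intros DERIV_chain2[OF f] refl)+ simp
  have bd: "\<bar>f' (w + t) - f' (w - t)\<bar> \<le> D * (2 * t)" if "0 \<le> t" for t
    using lipschitz_if_deriv_bounded[OF f' D, of "w + t" "w - t"] that by simp
  have le: "\<bar>g x - g y\<bar> \<le> D * (x\<^sup>2 - y\<^sup>2)" if "0 \<le> y" "y \<le> x" for x y
  proof -
    have "D * y\<^sup>2 - g y \<le> D * x\<^sup>2 - g x"
    proof (rule DERIV_nonneg_imp_nondecreasing[OF that(2)])
      fix t assume "y \<le> t" "t \<le> x"
      then show "\<exists>d. ((\<lambda>t. D * t\<^sup>2 - g t) has_real_derivative d) (at t) \<and> 0 \<le> d"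
        using bd[of t] that by (intro exI[of _ "D * (2 * t) - (f' (w + t) - f' (w - t))"] conjI)
          (auto intro!: derivative_eq_intros g')
    qed
    moreover have "D * y\<^sup>2 + g y \<le> D * x\<^sup>2 + g x"
    proof (rule DERIV_nonneg_imp_nondecreasing[OF that(2)])
      fix t assume "y \<le> t" "t \<le> x"
      then show "\<exists>d. ((\<lambda>t. D * t\<^sup>2 + g t) has_real_derivative d) (at t) \<and> 0 \<le> d"
        using bd[of t] that by (intro exI[of _ "D * (2 * t) + (f' (w + t) - f' (w - t))"] conjI)
          (auto intro!: derivative_eq_intros g')
    qed
    ultimately show ?thesis by (simp add: abs_le_iff algebra_simps)
  qed
  have ev: "g \<bar>t\<bar> = g t" for t by (cases "t \<ge> 0") (simp_all add: g_def add.commute)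
  have "\<bar>g \<bar>a\<bar> - g \<bar>b\<bar>\<bar> \<le> D * \<bar>a\<^sup>2 - b\<^sup>2\<bar>"
  proof (cases "\<bar>b\<bar> \<le> \<bar>a\<bar>")
    case True
    then have "b\<^sup>2 \<le> a\<^sup>2" by (simp add: abs_le_square_iff)
    then show ?thesis using le[of "\<bar>b\<bar>" "\<bar>a\<bar>"] True by simp
  next
    case False
    then have "a\<^sup>2 \<le> b\<^sup>2" by (simp flip: abs_le_square_iff)
    then show ?thesis using le[of "\<bar>a\<bar>" "\<bar>b\<bar>"] False by (simp add: abs_minus_commute)
  qed
  then show ?thesis by (simp add: ev) (simp add: g_def)
qed

lemma prob_space_std_normal: "prob_space std_normal_distribution"
  by (rule prob_space_normal_density) simp

lemma std_normal_second_moment: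
  "integrable std_normal_distribution (\<lambda>g. g\<^sup>2)" "(\<integral>g. g\<^sup>2 \<partial>std_normal_distribution) = 1"
proof -
  have "has_bochner_integral lborel (\<lambda>x. std_normal_density x * x\<^sup>2) 1"
    using std_normal_moment_even[of 1] by (simp add: fact_numeral)
  then show "integrable std_normal_distribution (\<lambda>g. g\<^sup>2)" "(\<integral>g. g\<^sup>2 \<partial>std_normal_distribution) = 1"
    by (simp_all add: integrable_density integral_density has_bochner_integral_iff)
qed

lemma std_normal_symmetric:
  fixes f :: "real \<Rightarrow> real"
  assumes [measurable]: "f \<in> borel_measurable borel"
  shows "(\<integral>g. f (- g) \<partial>std_normal_distribution) = (\<integral>g. f g \<partial>std_normal_distribution)"
proof -
  have "(\<integral>g. f g \<partial>std_normal_distribution) = (\<integral>x. std_normal_density x * f x \<partial>lborel)"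
    by (simp add: integral_density)
  also have "\<dots> = (\<integral>x. std_normal_density (- x) * f (- x) \<partial>lborel)"
    using lborel_integral_real_affine[of "-1" "\<lambda>x. std_normal_density x * f x" 0] by simp
  also have "\<dots> = (\<integral>x. std_normal_density x * f (- x) \<partial>lborel)"
    by (simp add: normal_density_def)
  also have "\<dots> = (\<integral>g. f (- g) \<partial>std_normal_distribution)"
    by (simp add: integral_density)
  finally show ?thesis by simp
qed

lemma integral_le_const:
  fixes f :: "'a \<Rightarrow> real"
  assumes "prob_space M" and "integrable M f" and "AE x in M. \<bar>f x\<bar> \<le> c"
  shows "\<bar>\<integral>x. f x \<partial>M\<bar> \<le> c"
proof -
  interpret prob_space M by fact
  have "\<bar>\<integral>x. f x \<partial>M\<bar> \<le> (\<integral>x. \<bar>f x\<bar> \<partial>M)" by (rule integral_abs_bound)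
  also have "\<dots> \<le> (\<integral>x. c \<partial>M)" by (rule integral_mono_AE) (use assms in auto)
  finally show ?thesis by (simp add: prob_space)
qed

lemma abs_sqrt_diff_le: "\<bar>sqrt x - sqrt y\<bar> \<le> sqrt \<bar>x - y\<bar>" if "0 \<le> x" "0 \<le> y" for x y :: real
proof (rule real_le_rsqrt)
  have "\<bar>sqrt x - sqrt y\<bar> * \<bar>sqrt x - sqrt y\<bar> \<le> \<bar>sqrt x - sqrt y\<bar> * (sqrt x + sqrt y)"
    using that by (intro mult_left_mono) (auto simp: abs_le_iff)
  also have "\<dots> = \<bar>(sqrt x - sqrt y) * (sqrt x + sqrt y)\<bar>" using that by (simp add: abs_mult)
  also have "(sqrt x - sqrt y) * (sqrt x + sqrt y) = x - y" using that by (simp add: algebra_simps)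
  finally show "\<bar>sqrt x - sqrt y\<bar>\<^sup>2 \<le> \<bar>x - y\<bar>" by (simp add: power2_eq_square)
qed

text \<open>The common properties of \<open>(\<alpha>')\<^sup>2\<close> and \<open>\<alpha>''\<close>, the two functions that enter the fixed-point system.\<close>

locale smooth_activation =
  fixes \<phi> :: "real \<Rightarrow> real \<Rightarrow> real"
  assumes bounded: "\<bar>\<phi> a b\<bar> \<le> 1"
    and measurable_activation: "(\<lambda>p. \<phi> (fst p) (snd p)) \<in> borel_measurable borel"
    and lipschitz_fst: "\<bar>\<phi> a b - \<phi> a' b\<bar> \<le> 6 * \<bar>a - a'\<bar>"
    and lipschitz_snd: "\<bar>\<phi> a b - \<phi> a b'\<bar> \<le> 3 * \<bar>b - b'\<bar>"
    and second_deriv: "\<exists>f' f''. (\<forall>a. ((\<lambda>a. \<phi> a b) has_real_derivative f' a) (at a)) \<and>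
      (\<forall>a. (f' has_real_derivative f'' a) (at a)) \<and> (\<forall>a. \<bar>f'' a\<bar> \<le> 26)"
begin

lemma activation_measurable [measurable]:
  assumes [measurable]: "f \<in> borel_measurable M" "g \<in> borel_measurable M"
  shows "(\<lambda>x. \<phi> (f x) (g x)) \<in> borel_measurable M"
  using measurable_compose[of "\<lambda>x. (f x, g x)", OF _ measurable_activation] by simp

definition gauss_avg :: "real \<Rightarrow> real \<Rightarrow> real \<Rightarrow> real \<Rightarrow> real" where
  "gauss_avg \<beta> q s w = (\<integral>g. \<phi> (w + \<beta> * sqrt q * g) (\<beta>\<^sup>2 * s) \<partial>std_normal_distribution)"

lemma integrable_gauss: "integrable std_normal_distribution (\<lambda>g. \<phi> (w + c * g) t)"
proof -
  interpret prob_space std_normal_distribution by (rule prob_space_std_normal)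
  show ?thesis by (rule integrable_const_bound[where B = 1]) (auto simp: bounded)
qed

lemma gauss_avg_measurable [measurable]: "gauss_avg \<beta> q s \<in> borel_measurable borel"
proof -
  interpret prob_space std_normal_distribution by (rule prob_space_std_normal)
  show ?thesis unfolding gauss_avg_def by measurable
qed

lemma abs_gauss_avg_le: "\<bar>gauss_avg \<beta> q s w\<bar> \<le> 1"
  unfolding gauss_avg_def by (rule integral_le_const[OF prob_space_std_normal integrable_gauss]) (simp add: bounded)

lemma gauss_avg_lipschitz_w: "\<bar>gauss_avg \<beta> q s w - gauss_avg \<beta> q s w'\<bar> \<le> 6 * \<bar>w - w'\<bar>"
proof -
  have "gauss_avg \<beta> q s w - gauss_avg \<beta> q s w' =
     (\<integral>g. \<phi> (w + \<beta> * sqrt q * g) (\<beta>\<^sup>2 * s) - \<phi> (w' + \<beta> * sqrt q * g) (\<beta>\<^sup>2 * s) \<partial>std_normal_distribution)"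
    unfolding gauss_avg_def by (simp add: integrable_gauss)
  also have "\<bar>\<dots>\<bar> \<le> 6 * \<bar>w - w'\<bar>"
    by (rule integral_le_const[OF prob_space_std_normal])
      (auto intro!: Bochner_Integration.integrable_diff integrable_gauss order_trans[OF lipschitz_fst])
  finally show ?thesis .
qed

lemma gauss_avg_lipschitz_s: "\<bar>gauss_avg \<beta> q s w - gauss_avg \<beta> q s' w\<bar> \<le> 3 * \<beta>\<^sup>2 * \<bar>s - s'\<bar>"
proof -
  have "gauss_avg \<beta> q s w - gauss_avg \<beta> q s' w =
     (\<integral>g. \<phi> (w + \<beta> * sqrt q * g) (\<beta>\<^sup>2 * s) - \<phi> (w + \<beta> * sqrt q * g) (\<beta>\<^sup>2 * s') \<partial>std_normal_distribution)"
    unfolding gauss_avg_def by (simp add: integrable_gauss)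
  also have "\<bar>\<dots>\<bar> \<le> 3 * \<beta>\<^sup>2 * \<bar>s - s'\<bar>"
    by (rule integral_le_const[OF prob_space_std_normal])
      (auto intro!: Bochner_Integration.integrable_diff integrable_gauss order_trans[OF lipschitz_snd]
        simp: abs_mult simp flip: right_diff_distrib)
  finally show ?thesis .
qed

text \<open>The Gaussian law is symmetric, so one may average over \<open>g\<close> and \<open>-g\<close> together and apply the bound on
  second differences, with \<open>a\<^sup>2 - b\<^sup>2 = \<beta>\<^sup>2 (q - q') g\<^sup>2\<close>.\<close>

lemma gauss_avg_lipschitz_q:
  assumes q: "0 \<le> q" "0 \<le> q'"
  shows "\<bar>gauss_avg \<beta> q s w - gauss_avg \<beta> q' s w\<bar> \<le> 13 * \<beta>\<^sup>2 * \<bar>q - q'\<bar>"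
proof -
  let ?N = std_normal_distribution and ?b = "\<beta>\<^sup>2 * s"
  obtain f' f'' where f: "\<And>a. ((\<lambda>a. \<phi> a ?b) has_real_derivative f' a) (at a)"
    "\<And>a. (f' has_real_derivative f'' a) (at a)" "\<And>a. \<bar>f'' a\<bar> \<le> 26"
    using second_deriv[of ?b] by blast
  let ?e = "\<lambda>q g. \<phi> (w + \<beta> * sqrt q * g) ?b + \<phi> (w - \<beta> * sqrt q * g) ?b"
  have int: "integrable ?N (?e q)" for q
    using integrable_gauss[of w "\<beta> * sqrt q" ?b] integrable_gauss[of w "- \<beta> * sqrt q" ?b] by simp
  have sym: "2 * gauss_avg \<beta> q s w = (\<integral>g. ?e q g \<partial>?N)" for q
  proof -
    have "(\<integral>g. \<phi> (w + \<beta> * sqrt q * (- g)) ?b \<partial>?N) = gauss_avg \<beta> q s w"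
      unfolding gauss_avg_def by (rule std_normal_symmetric) measurable
    then show ?thesis
      using integrable_gauss[of w "\<beta> * sqrt q" ?b] integrable_gauss[of w "- \<beta> * sqrt q" ?b]
      by (simp add: gauss_avg_def)
  qed
  have "2 * \<bar>gauss_avg \<beta> q s w - gauss_avg \<beta> q' s w\<bar> = \<bar>2 * gauss_avg \<beta> q s w - 2 * gauss_avg \<beta> q' s w\<bar>"
    unfolding right_diff_distrib[symmetric] abs_mult by simp
  also have "\<dots> = \<bar>(\<integral>g. ?e q g \<partial>?N) - (\<integral>g. ?e q' g \<partial>?N)\<bar>" unfolding sym ..
  also have "\<dots> = \<bar>\<integral>g. ?e q g - ?e q' g \<partial>?N\<bar>"
    by (subst Bochner_Integration.integral_diff[OF int int]) simp
  also have "\<dots> \<le> (\<integral>g. \<bar>?e q g - ?e q' g\<bar> \<partial>?N)" by (rule integral_abs_bound)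
  also have "\<dots> \<le> (\<integral>g. 26 * \<beta>\<^sup>2 * \<bar>q - q'\<bar> * g\<^sup>2 \<partial>?N)"
  proof (rule integral_mono)
    show "integrable ?N (\<lambda>g. \<bar>?e q g - ?e q' g\<bar>)" using int by (intro integrable_abs Bochner_Integration.integrable_diff)
    show "integrable ?N (\<lambda>g. 26 * \<beta>\<^sup>2 * \<bar>q - q'\<bar> * g\<^sup>2)" using std_normal_second_moment by simp
    fix g
    have "(\<beta> * sqrt q * g)\<^sup>2 - (\<beta> * sqrt q' * g)\<^sup>2 = \<beta>\<^sup>2 * g\<^sup>2 * (q - q')"
      using q by (simp add: power_mult_distrib algebra_simps)
    then have *: "\<bar>(\<beta> * sqrt q * g)\<^sup>2 - (\<beta> * sqrt q' * g)\<^sup>2\<bar> = \<beta>\<^sup>2 * g\<^sup>2 * \<bar>q - q'\<bar>" by (simp add: abs_mult)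
    show "\<bar>?e q g - ?e q' g\<bar> \<le> 26 * \<beta>\<^sup>2 * \<bar>q - q'\<bar> * g\<^sup>2"
      using symmetric_second_difference[OF f, of w "\<beta> * sqrt q * g" "\<beta> * sqrt q' * g"] unfolding * by (simp add: mult_ac)
  qed
  also have "\<dots> = 2 * (13 * \<beta>\<^sup>2 * \<bar>q - q'\<bar>)" using std_normal_second_moment by simp
  finally show ?thesis by (simp only: mult_le_cancel_left_pos zero_less_numeral)
qed

definition smoothed :: "real \<Rightarrow> real measure \<Rightarrow> real \<Rightarrow> real \<Rightarrow> real" where
  "smoothed \<beta> \<nu> q s = (\<integral>(w, g). \<phi> (w + \<beta> * sqrt q * g) (\<beta>\<^sup>2 * s) \<partial>(\<nu> \<Otimes>\<^sub>M std_normal_distribution))"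

lemma smoothed_eq:
  assumes "prob_space \<nu>" and [measurable_cong]: "sets \<nu> = sets borel"
  shows "smoothed \<beta> \<nu> q s = (\<integral>w. gauss_avg \<beta> q s w \<partial>\<nu>)" "integrable \<nu> (gauss_avg \<beta> q s)"
proof -
  interpret A: prob_space \<nu> by fact
  interpret B: prob_space std_normal_distribution by (rule prob_space_std_normal)
  interpret AB: pair_prob_space \<nu> std_normal_distribution ..
  have "integrable (\<nu> \<Otimes>\<^sub>M std_normal_distribution) (\<lambda>(w, g). \<phi> (w + \<beta> * sqrt q * g) (\<beta>\<^sup>2 * s))"
    by (rule AB.integrable_const_bound[where B = 1]) (auto simp: bounded)
  from AB.integral_fst'[OF this] show "smoothed \<beta> \<nu> q s = (\<integral>w. gauss_avg \<beta> q s w \<partial>\<nu>)"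
    unfolding smoothed_def gauss_avg_def by simp
  show "integrable \<nu> (gauss_avg \<beta> q s)"
    by (rule A.integrable_const_bound[where B = 1]) (auto simp: abs_gauss_avg_le)
qed

lemma abs_smoothed_le:
  assumes "prob_space \<nu>" "sets \<nu> = sets borel"
  shows "\<bar>smoothed \<beta> \<nu> q s\<bar> \<le> 1"
  unfolding smoothed_eq[OF assms] by (rule integral_le_const[OF assms(1) smoothed_eq(2)[OF assms]]) (simp add: abs_gauss_avg_le)

lemma smoothed_lipschitz:
  assumes "prob_space \<nu>" "sets \<nu> = sets borel" "0 \<le> q" "0 \<le> q'"
  shows "\<bar>smoothed \<beta> \<nu> q s - smoothed \<beta> \<nu> q' s'\<bar> \<le> 13 * \<beta>\<^sup>2 * \<bar>q - q'\<bar> + 3 * \<beta>\<^sup>2 * \<bar>s - s'\<bar>"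
proof -
  have "smoothed \<beta> \<nu> q s - smoothed \<beta> \<nu> q' s' = (\<integral>w. gauss_avg \<beta> q s w - gauss_avg \<beta> q' s' w \<partial>\<nu>)"
    unfolding smoothed_eq[OF assms(1,2)] by (simp add: smoothed_eq[OF assms(1,2)])
  also have "\<bar>\<dots>\<bar> \<le> 13 * \<beta>\<^sup>2 * \<bar>q - q'\<bar> + 3 * \<beta>\<^sup>2 * \<bar>s - s'\<bar>"
  proof (rule integral_le_const[OF assms(1)])
    have "\<bar>gauss_avg \<beta> q s w - gauss_avg \<beta> q' s' w\<bar> \<le> 13 * \<beta>\<^sup>2 * \<bar>q - q'\<bar> + 3 * \<beta>\<^sup>2 * \<bar>s - s'\<bar>" for w
      using gauss_avg_lipschitz_q[OF assms(3,4), of \<beta> s w] gauss_avg_lipschitz_s[of \<beta> q' s w s'] by (smt (verit))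
    then show "AE w in \<nu>. \<bar>gauss_avg \<beta> q s w - gauss_avg \<beta> q' s' w\<bar> \<le> 13 * \<beta>\<^sup>2 * \<bar>q - q'\<bar> + 3 * \<beta>\<^sup>2 * \<bar>s - s'\<bar>" by simp
  qed (intro Bochner_Integration.integrable_diff smoothed_eq(2)[OF assms(1,2)])
  finally show ?thesis .
qed

lemma smoothed_stable_law:
  assumes N: "prob_space N" and [measurable]: "f \<in> borel_measurable N" "f' \<in> borel_measurable N"
    and AE: "AE x in N. \<bar>f x - f' x\<bar> \<le> \<delta>"
  shows "\<bar>smoothed \<beta> (distr N borel f) q s - smoothed \<beta> (distr N borel f') q s\<bar> \<le> 6 * \<delta>"
proof -
  interpret N: prob_space N by fact
  have "smoothed \<beta> (distr N borel f) q s = (\<integral>x. gauss_avg \<beta> q s (f x) \<partial>N)" if [measurable]: "f \<in> borel_measurable N" for f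
    by (subst smoothed_eq) (auto intro!: N.prob_space_distr simp: integral_distr)
  then have "smoothed \<beta> (distr N borel f) q s - smoothed \<beta> (distr N borel f') q s
     = (\<integral>x. gauss_avg \<beta> q s (f x) \<partial>N) - (\<integral>x. gauss_avg \<beta> q s (f' x) \<partial>N)" by simp
  also have "\<dots> = (\<integral>x. gauss_avg \<beta> q s (f x) - gauss_avg \<beta> q s (f' x) \<partial>N)"
    by (rule Bochner_Integration.integral_diff[symmetric];
        rule N.integrable_const_bound[where B = 1]; (auto simp: abs_gauss_avg_le)?)
  also have "\<bar>\<dots>\<bar> \<le> 6 * \<delta>"
  proof (rule integral_le_const[OF N])
    show "AE x in N. \<bar>gauss_avg \<beta> q s (f x) - gauss_avg \<beta> q s (f' x)\<bar> \<le> 6 * \<delta>"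
      using AE by eventually_elim (rule order_trans[OF gauss_avg_lipschitz_w], simp)
    show "integrable N (\<lambda>x. gauss_avg \<beta> q s (f x) - gauss_avg \<beta> q s (f' x))"
      by (intro Bochner_Integration.integrable_diff; rule N.integrable_const_bound[where B = 1]; (auto simp: abs_gauss_avg_le)?)
  qed
  finally show ?thesis .
qed

end

context interval_law
begin

lemma smooth_activation_d1_square: "smooth_activation (\<lambda>a b. (alpha_d1 \<nu> a b)\<^sup>2)"
proof
  fix a b a' b' :: real
  show "\<bar>(alpha_d1 \<nu> a b)\<^sup>2\<bar> \<le> 1" using abs_alpha_d1_le[of a b] by (simp add: abs_square_le_1 del: abs_alpha_d1_le)
  show "(\<lambda>p. (alpha_d1 \<nu> (fst p) (snd p))\<^sup>2) \<in> borel_measurable borel"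
    unfolding borel_prod[symmetric] by measurable
  show "\<exists>f' f''. (\<forall>a. ((\<lambda>a. (alpha_d1 \<nu> a b)\<^sup>2) has_real_derivative f' a) (at a)) \<and>
      (\<forall>a. (f' has_real_derivative f'' a) (at a)) \<and> (\<forall>a. \<bar>f'' a\<bar> \<le> 26)"
    using alpha_d1_square_second_deriv[of b] by metis
qed (fact alpha_d1_square_lipschitz_a alpha_d1_square_lipschitz_b)+

lemma smooth_activation_d2: "smooth_activation (alpha_d2 \<nu>)"
proof
  fix a b a' b' :: real
  show "(\<lambda>p. alpha_d2 \<nu> (fst p) (snd p)) \<in> borel_measurable borel"
    unfolding borel_prod[symmetric] by measurable
  show "\<exists>f' f''. (\<forall>a. ((\<lambda>a. alpha_d2 \<nu> a b) has_real_derivative f' a) (at a)) \<and>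
      (\<forall>a. (f' has_real_derivative f'' a) (at a)) \<and> (\<forall>a. \<bar>f'' a\<bar> \<le> 26)"
    using alpha_d2_second_deriv[of b] by metis
qed (fact abs_alpha_d2_le alpha_d2_lipschitz_a alpha_d2_lipschitz_b)+

sublocale D1: smooth_activation "\<lambda>a b. (alpha_d1 \<nu> a b)\<^sup>2" by (rule smooth_activation_d1_square)
sublocale D2: smooth_activation "alpha_d2 \<nu>" by (rule smooth_activation_d2)

lemma fp_system_iff:
  "fp_system \<nu> \<beta> F (q, s) \<longleftrightarrow> q \<in> {0..1} \<and> s \<ge> 0 \<and> q = D1.smoothed \<beta> F q s \<and> s = D2.smoothed \<beta> F q s"
  by (simp add: fp_system_def D1.smoothed_def D2.smoothed_def)

lemma smoothed_nonneg: "0 \<le> D1.smoothed \<beta> F q s" "0 \<le> D2.smoothed \<beta> F q s"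
  unfolding D1.smoothed_def D2.smoothed_def by (auto intro!: integral_nonneg_AE simp: alpha_d2_nonneg)

text \<open>For small \<open>\<beta>\<close> the system is a contraction of the unit square, uniformly in the law of the field.\<close>

lemma fp_system_unique:
  assumes F: "prob_space F" "sets F = sets borel" and b: "\<bar>\<beta>\<bar> \<le> 1/8"
  shows "\<exists>!p. fp_system \<nu> \<beta> F p"
proof -
  define \<Phi> where "\<Phi> p = (D1.smoothed \<beta> F (fst p) (snd p), D2.smoothed \<beta> F (fst p) (snd p))" for p
  let ?S = "{0..1} \<times> {0..1} :: (real \<times> real) set"
  have b2: "\<beta>\<^sup>2 \<le> 1/64" using b power_mono[of "\<bar>\<beta>\<bar>" "1/8" 2] by (simp add: power_divide)
  have "\<exists>!p. p \<in> ?S \<and> \<Phi> p = p"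
  proof (rule Banach_fix[OF compact_imp_complete[OF compact_Times[OF compact_Icc compact_Icc]], where c = "1/2"])
    show "\<Phi> ` ?S \<subseteq> ?S"
      using D1.abs_smoothed_le[OF F] D2.abs_smoothed_le[OF F] smoothed_nonneg by (auto simp: \<Phi>_def abs_le_iff)
    fix p p' assume p: "p \<in> ?S" "p' \<in> ?S"
    \<comment> \<open>The Lipschitz constant is at most \<open>32 \<beta>\<^sup>2\<close>, which the bound on \<open>\<beta>\<close> makes at most \<open>1/2\<close>.\<close>
    let ?dq = "\<bar>fst p - fst p'\<bar>" and ?ds = "\<bar>snd p - snd p'\<bar>"
    have "dist (\<Phi> p) (\<Phi> p') \<le> \<bar>D1.smoothed \<beta> F (fst p) (snd p) - D1.smoothed \<beta> F (fst p') (snd p')\<bar>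
       + \<bar>D2.smoothed \<beta> F (fst p) (snd p) - D2.smoothed \<beta> F (fst p') (snd p')\<bar>"
      unfolding \<Phi>_def dist_Pair_Pair dist_real_def using sqrt_sum_squares_le_sum_abs by simp
    also have "\<dots> \<le> (13 * \<beta>\<^sup>2 * ?dq + 3 * \<beta>\<^sup>2 * ?ds) + (13 * \<beta>\<^sup>2 * ?dq + 3 * \<beta>\<^sup>2 * ?ds)"
      using p by (intro add_mono D1.smoothed_lipschitz[OF F] D2.smoothed_lipschitz[OF F]) auto
    also have "\<dots> = \<beta>\<^sup>2 * (26 * ?dq + 6 * ?ds)" by (simp add: algebra_simps)
    also have "\<dots> \<le> 1/64 * (26 * dist p p' + 6 * dist p p')"
      using dist_fst_le[of p p'] dist_snd_le[of p p'] b2 by (intro mult_mono) (auto simp: dist_real_def)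
    finally show "dist (\<Phi> p) (\<Phi> p') \<le> 1/2 * dist p p'" by simp
  qed auto
  moreover have "fp_system \<nu> \<beta> F p \<longleftrightarrow> p \<in> ?S \<and> \<Phi> p = p" for p
  proof (cases p)
    case (Pair q s)
    have "s \<le> 1" if "s = D2.smoothed \<beta> F q s"
      using D2.abs_smoothed_le[OF F, of \<beta> q s] that by linarith
    then show ?thesis unfolding Pair fp_system_iff \<Phi>_def by auto
  qed
  ultimately show ?thesis by simp
qed

lemma fp_solution_is_fixed:
  assumes F: "prob_space F" "sets F = sets borel" and b: "\<bar>\<beta>\<bar> \<le> 1/8"
  shows "fp_system \<nu> \<beta> F (fp_solution \<nu> \<beta> F)"
  unfolding fp_solution_def by (rule theI'[OF fp_system_unique[OF assms]])

text \<open>Fixed points of contractions that are uniformly close are close.\<close>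

lemma fp_solution_stable:
  assumes N: "prob_space N" and [measurable]: "f \<in> borel_measurable N" "f' \<in> borel_measurable N"
    and AE: "AE x in N. \<bar>f x - f' x\<bar> \<le> \<delta>" and b: "\<bar>\<beta>\<bar> \<le> 1/8"
  defines "p \<equiv> fp_solution \<nu> \<beta> (distr N borel f)" and "p' \<equiv> fp_solution \<nu> \<beta> (distr N borel f')"
  shows "\<bar>sqrt (fst p) - sqrt (fst p')\<bar> \<le> sqrt (24 * \<delta>)" and "\<bar>snd p - snd p'\<bar> \<le> 24 * \<delta>"
proof -
  interpret N: prob_space N by fact
  let ?F = "distr N borel f" and ?F' = "distr N borel f'"
  have F: "prob_space ?F" "sets ?F = sets borel" and F': "prob_space ?F'" "sets ?F' = sets borel"
    by (auto intro: N.prob_space_distr)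
  obtain q s where p: "p = (q, s)" by (cases p)
  obtain q' s' where p': "p' = (q', s')" by (cases p')
  have fp: "0 \<le> q" "q = D1.smoothed \<beta> ?F q s" "s = D2.smoothed \<beta> ?F q s"
    using fp_solution_is_fixed[OF F b] p unfolding p_def by (auto simp: fp_system_iff)
  have fp': "0 \<le> q'" "q' = D1.smoothed \<beta> ?F' q' s'" "s' = D2.smoothed \<beta> ?F' q' s'"
    using fp_solution_is_fixed[OF F' b] p' unfolding p'_def by (auto simp: fp_system_iff)
  have b2: "\<beta>\<^sup>2 \<le> 1/64" using b power_mono[of "\<bar>\<beta>\<bar>" "1/8" 2] by (simp add: power_divide)
  \<comment> \<open>Each coordinate of the error is at most \<open>6 \<delta>\<close> plus a quarter of the total error, so the total error
    is at most \<open>12 \<delta>\<close> plus half of itself.\<close>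
  have e: "13 * \<beta>\<^sup>2 * \<bar>q - q'\<bar> + 3 * \<beta>\<^sup>2 * \<bar>s - s'\<bar> \<le> 1/4 * (\<bar>q - q'\<bar> + \<bar>s - s'\<bar>)"
    unfolding distrib_left using b2 by (intro add_mono mult_right_mono) auto
  have "\<bar>q - q'\<bar> \<le> 13 * \<beta>\<^sup>2 * \<bar>q - q'\<bar> + 3 * \<beta>\<^sup>2 * \<bar>s - s'\<bar> + 6 * \<delta>"
    using D1.smoothed_lipschitz[OF F fp(1) fp'(1), of \<beta> s s'] D1.smoothed_stable_law[OF N assms(2,3) AE, of \<beta> q' s']
      fp(2) fp'(2) by (smt (verit))
  moreover have "\<bar>s - s'\<bar> \<le> 13 * \<beta>\<^sup>2 * \<bar>q - q'\<bar> + 3 * \<beta>\<^sup>2 * \<bar>s - s'\<bar> + 6 * \<delta>"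
    using D2.smoothed_lipschitz[OF F fp(1) fp'(1), of \<beta> s s'] D2.smoothed_stable_law[OF N assms(2,3) AE, of \<beta> q' s']
      fp(3) fp'(3) by (smt (verit))
  moreover have "x \<le> E + 6 * \<delta> \<Longrightarrow> y \<le> E + 6 * \<delta> \<Longrightarrow> E \<le> 1/4 * (x + y) \<Longrightarrow> x + y \<le> 24 * \<delta>" for x y E :: real
    by (simp add: field_simps)
  ultimately have "\<bar>q - q'\<bar> + \<bar>s - s'\<bar> \<le> 24 * \<delta>" using e by blast
  then have d: "\<bar>q - q'\<bar> \<le> 24 * \<delta>" "\<bar>s - s'\<bar> \<le> 24 * \<delta>"
    using abs_ge_zero[of "q - q'"] abs_ge_zero[of "s - s'"] by linarith+
  show "\<bar>snd p - snd p'\<bar> \<le> 24 * \<delta>" using d by (simp add: p p')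
  have "\<bar>sqrt q - sqrt q'\<bar> \<le> sqrt \<bar>q - q'\<bar>" by (rule abs_sqrt_diff_le[OF fp(1) fp'(1)])
  also have "\<dots> \<le> sqrt (24 * \<delta>)" using d by simp
  finally show "\<bar>sqrt (fst p) - sqrt (fst p')\<bar> \<le> sqrt (24 * \<delta>)" by (simp add: p p')
qed

end

lemma interval_law_rademacher: "interval_law rademacher"
proof -
  have "prob_space rademacher" unfolding rademacher_def by (rule measure_pmf.prob_space_distr) simp
  moreover have "AE x in rademacher. \<bar>x\<bar> \<le> 1" unfolding rademacher_def by (subst AE_distr_iff) (auto simp: AE_measure_pmf_iff)
  ultimately show ?thesis by (simp add: interval_law_def interval_law_axioms_def) (simp add: rademacher_def)
qed

lemma AE_rademacher: "AE t in rademacher. t = 1 \<or> t = -1"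
  unfolding rademacher_def by (subst AE_distr_iff) (auto simp: AE_measure_pmf_iff)

lemma covariate_lawD:
  assumes "covariate_law c C PX"
  shows "prob_space PX" "sets PX = sets borel" "AE x in PX. \<forall>k. \<bar>x $ k\<bar> \<le> 1"
proof -
  show P: "prob_space PX" and S: "sets PX = sets borel" using assms by (auto simp: covariate_law_def)
  interpret prob_space PX by fact
  have "{x :: real ^ 'a. \<forall>k. x $ k \<in> {-1..1}} \<in> sets borel" by measurable
  then have "AE x in PX. x \<in> {x. \<forall>k. x $ k \<in> {-1..1}}"
    using assms by (subst prob_eq_1[symmetric]) (auto simp: covariate_law_def)
  then show "AE x in PX. \<forall>k. \<bar>x $ k\<bar> \<le> 1" by eventually_elim (auto simp: abs_le_iff)
qed

lemma norm_le_card: "norm x \<le> real CARD('d)" if "\<forall>k. \<bar>x $ k\<bar> \<le> 1" for x :: "real ^ 'd"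
proof -
  have "norm x \<le> (\<Sum>k\<in>UNIV. \<bar>x $ k\<bar>)" by (rule norm_le_l1_cart)
  also have "\<dots> \<le> (\<Sum>k\<in>(UNIV::'d set). 1)" using that by (intro sum_mono) auto
  finally show ?thesis by simp
qed

text \<open>Dominates the change of every field \<open>\<tau> t + x \<bullet> \<theta>\<close> with \<open>\<bar>t\<bar> \<le> 1\<close> and \<open>x\<close> in the unit cube; the factor
  \<open>CARD('d)\<close> bounds the norm of such an \<open>x\<close>.\<close>

definition field_dist :: "real \<times> (real ^ 'd) \<Rightarrow> real \<times> (real ^ 'd) \<Rightarrow> real" where
  "field_dist p p' = \<bar>fst p - fst p'\<bar> + real CARD('d) * norm (snd p - snd p')"

lemma field_diff_le:
  fixes x \<theta> \<theta>' :: "real ^ 'd"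
  assumes "\<bar>t\<bar> \<le> 1" "\<forall>k. \<bar>x $ k\<bar> \<le> 1"
  shows "\<bar>(\<tau> * t + x \<bullet> \<theta>) - (\<tau>' * t + x \<bullet> \<theta>')\<bar> \<le> field_dist (\<tau>, \<theta>) (\<tau>', \<theta>')"
proof -
  have "(\<tau> * t + x \<bullet> \<theta>) - (\<tau>' * t + x \<bullet> \<theta>') = (\<tau> - \<tau>') * t + x \<bullet> (\<theta> - \<theta>')"
    by (simp add: algebra_simps inner_diff_right)
  moreover have "\<bar>(\<tau> - \<tau>') * t\<bar> \<le> \<bar>\<tau> - \<tau>'\<bar> * 1" by (rule abs_mult_bound) (use assms in auto)
  moreover have "\<bar>x \<bullet> (\<theta> - \<theta>')\<bar> \<le> real CARD('d) * norm (\<theta> - \<theta>')"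
    by (rule order_trans[OF Cauchy_Schwarz_ineq2 mult_right_mono[OF norm_le_card[OF assms(2)]]]) simp
  ultimately show ?thesis by (simp add: field_dist_def)
qed

lemma (in interval_law) fp_solution_field_stable:
  fixes PX :: "(real ^ 'd) measure" and \<tau> \<tau>' :: real and \<theta> \<theta>' :: "real ^ 'd"
  assumes PX: "covariate_law c C PX" and b: "\<bar>\<beta>\<bar> \<le> 1/8"
  defines "\<delta> \<equiv> field_dist (\<tau>, \<theta>) (\<tau>', \<theta>')"
  shows "\<bar>sqrt (fst (fp_solution \<nu> \<beta> (field_law PX \<tau> \<theta>))) - sqrt (fst (fp_solution \<nu> \<beta> (field_law PX \<tau>' \<theta>')))\<bar> \<le> sqrt (24 * \<delta>)"
    and "\<bar>snd (fp_solution \<nu> \<beta> (field_law PX \<tau> \<theta>)) - snd (fp_solution \<nu> \<beta> (field_law PX \<tau>' \<theta>'))\<bar> \<le> 24 * \<delta>"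
    and "\<bar>sqrt (fst (fp_solution \<nu> \<beta> (field_law_control PX \<tau> \<theta>))) - sqrt (fst (fp_solution \<nu> \<beta> (field_law_control PX \<tau>' \<theta>')))\<bar> \<le> sqrt (24 * \<delta>)"
    and "\<bar>snd (fp_solution \<nu> \<beta> (field_law_control PX \<tau> \<theta>)) - snd (fp_solution \<nu> \<beta> (field_law_control PX \<tau>' \<theta>'))\<bar> \<le> 24 * \<delta>"
proof -
  note PXD = covariate_lawD[OF PX]
  note [measurable_cong] = PXD(2)
  interpret R: interval_law rademacher by (rule interval_law_rademacher)
  interpret X: prob_space PX by (rule PXD(1))
  interpret RX: pair_prob_space rademacher PX ..
  have AE: "AE z in rademacher \<Otimes>\<^sub>M PX. \<bar>(case z of (t, x) \<Rightarrow> \<tau> * t + x \<bullet> \<theta>) - (case z of (t, x) \<Rightarrow> \<tau>' * t + x \<bullet> \<theta>')\<bar> \<le> \<delta>"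
  proof (rule RX.AE_pair_measure)
    show "AE t in rademacher. AE x in PX. \<bar>(case (t, x) of (t, x) \<Rightarrow> \<tau> * t + x \<bullet> \<theta>) - (case (t, x) of (t, x) \<Rightarrow> \<tau>' * t + x \<bullet> \<theta>')\<bar> \<le> \<delta>"
      using R.AE_interval
    proof eventually_elim
      case (elim t)
      show ?case using PXD(3) by eventually_elim (use elim in \<open>simp add: \<delta>_def field_diff_le\<close>)
    qed
  qed measurable
  have AE': "AE x in PX. \<bar>(- \<tau> + x \<bullet> \<theta>) - (- \<tau>' + x \<bullet> \<theta>')\<bar> \<le> \<delta>"
    using PXD(3) by eventually_elim (use field_diff_le[of "-1"] in \<open>simp add: \<delta>_def\<close>)
  show "\<bar>sqrt (fst (fp_solution \<nu> \<beta> (field_law PX \<tau> \<theta>))) - sqrt (fst (fp_solution \<nu> \<beta> (field_law PX \<tau>' \<theta>')))\<bar> \<le> sqrt (24 * \<delta>)"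
    "\<bar>snd (fp_solution \<nu> \<beta> (field_law PX \<tau> \<theta>)) - snd (fp_solution \<nu> \<beta> (field_law PX \<tau>' \<theta>'))\<bar> \<le> 24 * \<delta>"
    unfolding field_law_def by (rule fp_solution_stable[OF RX.prob_space_axioms _ _ AE b]; measurable)+
  show "\<bar>sqrt (fst (fp_solution \<nu> \<beta> (field_law_control PX \<tau> \<theta>))) - sqrt (fst (fp_solution \<nu> \<beta> (field_law_control PX \<tau>' \<theta>')))\<bar> \<le> sqrt (24 * \<delta>)"
    "\<bar>snd (fp_solution \<nu> \<beta> (field_law_control PX \<tau> \<theta>)) - snd (fp_solution \<nu> \<beta> (field_law_control PX \<tau>' \<theta>'))\<bar> \<le> 24 * \<delta>"
    unfolding field_law_control_def by (rule fp_solution_stable[OF X.prob_space_axioms _ _ AE' b]; measurable)+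
qed

section \<open>Second moments of conditionally centred sums\<close>

text \<open>Replace coordinate \<open>i\<close> in \<open>\<phi>\<^sub>j\<close> by a constant: the modified \<open>\<phi>\<^sub>j\<close> does not depend on coordinate \<open>i\<close>, so
  integrating that coordinate first kills its product with \<open>\<phi>\<^sub>i\<close>.  What remains of the covariance of
  \<open>\<phi>\<^sub>i\<close> and \<open>\<phi>\<^sub>j\<close> is the influence \<open>d i j\<close> of coordinate \<open>i\<close> on \<open>\<phi>\<^sub>j\<close>.\<close>

lemma second_moment_conditionally_centred:
  fixes \<nu> :: "'a measure" and f :: "(nat \<Rightarrow> 'a) \<Rightarrow> real" and \<phi> :: "nat \<Rightarrow> (nat \<Rightarrow> 'a) \<Rightarrow> real" and n :: nat
  defines "Q \<equiv> \<Pi>\<^sub>M i\<in>{..<n}. \<nu>"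
  assumes \<nu>: "prob_space \<nu>"
    and f: "integrable Q f" "\<And>y. 0 \<le> f y"
    and \<phi>: "\<And>i. i < n \<Longrightarrow> \<phi> i \<in> borel_measurable Q"
    and b: "\<And>i. i < n \<Longrightarrow> AE y in Q. \<bar>\<phi> i y\<bar> \<le> b"
    and ref: "ref \<in> space \<nu>"
    and d: "\<And>i j. i < n \<Longrightarrow> j < n \<Longrightarrow> i \<noteq> j \<Longrightarrow> AE y in Q. \<bar>\<phi> j y - \<phi> j (y(i := ref))\<bar> \<le> d i j"
    and centred: "\<And>i y. i < n \<Longrightarrow> y \<in> space Q \<Longrightarrow> (\<integral>z. \<phi> i (y(i := z)) * f (y(i := z)) \<partial>\<nu>) = 0"
  shows "integrable Q (\<lambda>y. (\<Sum>i<n. \<phi> i y)\<^sup>2 * f y)"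
    and "(\<integral>y. (\<Sum>i<n. \<phi> i y)\<^sup>2 * f y \<partial>Q) \<le> (real n * b\<^sup>2 + b * (\<Sum>i<n. \<Sum>j\<in>{..<n}-{i}. d i j)) * (\<integral>y. f y \<partial>Q)"
proof -
  interpret N: prob_space \<nu> by fact
  interpret P: product_sigma_finite "\<lambda>_::nat. \<nu>" by (simp add: N.sigma_finite_measure_axioms product_sigma_finite_def)
  have fm [measurable]: "f \<in> borel_measurable Q" using f(1) by simp
  have bounded: "integrable Q (\<lambda>y. g y * f y)" "\<bar>\<integral>y. g y * f y \<partial>Q\<bar> \<le> c * (\<integral>y. f y \<partial>Q)"
    if [measurable]: "g \<in> borel_measurable Q" and g: "AE y in Q. \<bar>g y\<bar> \<le> c" for g c
  proof -
    have le: "AE y in Q. \<bar>g y * f y\<bar> \<le> c * f y"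
      using g by eventually_elim (simp add: abs_mult f(2) mult_right_mono)
    have ic: "integrable Q (\<lambda>y. c * f y)" using f(1) by simp
    show int: "integrable Q (\<lambda>y. g y * f y)"
      by (rule Bochner_Integration.integrable_bound[OF ic]) (use le in \<open>auto elim!: eventually_mono\<close>)
    have "\<bar>\<integral>y. g y * f y \<partial>Q\<bar> \<le> (\<integral>y. \<bar>g y * f y\<bar> \<partial>Q)" by (rule integral_abs_bound)
    also have "\<dots> \<le> (\<integral>y. c * f y \<partial>Q)" by (rule integral_mono_AE[OF _ ic le]) (use int in auto)
    finally show "\<bar>\<integral>y. g y * f y \<partial>Q\<bar> \<le> c * (\<integral>y. f y \<partial>Q)" by simp
  qed
  have upd [measurable]: "(\<lambda>y. y(i := ref)) \<in> measurable Q Q" if "i < n" for i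
    unfolding Q_def by (rule measurable_fun_upd[where J = "{..<n}"]) (use that ref in auto)
  have prod_m [measurable]: "(\<lambda>y. \<phi> i y * \<phi> j y) \<in> borel_measurable Q" if "i < n" "j < n" for i j
    using \<phi>[OF that(1)] \<phi>[OF that(2)] by simp
  have prod_b: "AE y in Q. \<bar>\<phi> i y * \<phi> j y\<bar> \<le> b * b" if "i < n" "j < n" for i j
    using b[OF that(1)] b[OF that(2)] by eventually_elim (rule abs_mult_bound)
  have int: "integrable Q (\<lambda>y. (\<phi> i y * \<phi> j y) * f y)" if "i < n" "j < n" for i j
    by (rule bounded(1)[OF prod_m prod_b]) (use that in auto)
  have diag: "(\<integral>y. (\<phi> i y * \<phi> i y) * f y \<partial>Q) \<le> b\<^sup>2 * (\<integral>y. f y \<partial>Q)" if "i < n" for i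
    using bounded(2)[OF prod_m[OF that that] prod_b[OF that that]] by (simp add: power2_eq_square)
  have off: "(\<integral>y. (\<phi> i y * \<phi> j y) * f y \<partial>Q) \<le> (b * d i j) * (\<integral>y. f y \<partial>Q)" if ij: "i < n" "j < n" "i \<noteq> j" for i j
  proof -
    note [measurable] = \<phi>[OF ij(1)] \<phi>[OF ij(2)] upd[OF ij(1)]
    define g where "g y = \<phi> j (y(i := ref))" for y
    have gm [measurable]: "g \<in> borel_measurable Q" unfolding g_def by measurable
    have gb: "AE y in Q. \<bar>g y\<bar> \<le> b + d i j"
      using b[OF ij(2)] d[OF ij] unfolding g_def by eventually_elim linarith
    have b1: "AE y in Q. \<bar>\<phi> i y * g y\<bar> \<le> b * (b + d i j)"
      using b[OF ij(1)] gb by eventually_elim (rule abs_mult_bound)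
    have b2: "AE y in Q. \<bar>\<phi> i y * (\<phi> j y - g y)\<bar> \<le> b * d i j"
      using b[OF ij(1)] d[OF ij] unfolding g_def by eventually_elim (rule abs_mult_bound)
    have i1: "integrable Q (\<lambda>y. (\<phi> i y * g y) * f y)" by (rule bounded(1)[OF _ b1]) measurable
    have i2: "integrable Q (\<lambda>y. (\<phi> i y * (\<phi> j y - g y)) * f y)" by (rule bounded(1)[OF _ b2]) measurable
    have "(\<integral>y. (\<phi> i y * g y) * f y \<partial>Q) = 0"
    proof -
      have I: "insert i ({..<n} - {i}) = {..<n}" using ij by auto
      have "(\<integral>y. (\<phi> i y * g y) * f y \<partial>Q) = (\<integral>x. (\<integral>z. (\<phi> i (x(i := z)) * g (x(i := z))) * f (x(i := z)) \<partial>\<nu>) \<partial>(\<Pi>\<^sub>M i\<in>{..<n} - {i}. \<nu>))"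
        using P.product_integral_insert[of "{..<n} - {i}" i "\<lambda>y. (\<phi> i y * g y) * f y", unfolded I] i1 unfolding Q_def by blast
      also have "\<dots> = (\<integral>x. 0 \<partial>(\<Pi>\<^sub>M i\<in>{..<n} - {i}. \<nu>))"
      proof (rule Bochner_Integration.integral_cong[OF refl])
        fix x assume "x \<in> space (\<Pi>\<^sub>M i\<in>{..<n} - {i}. \<nu>)"
        then have "x(i := ref) \<in> space Q" using ref ij by (auto simp: Q_def space_PiM PiE_iff extensional_def)
        from centred[OF ij(1) this] have "(\<integral>z. g x * (\<phi> i (x(i := z)) * f (x(i := z))) \<partial>\<nu>) = 0" by simp
        then show "(\<integral>z. (\<phi> i (x(i := z)) * g (x(i := z))) * f (x(i := z)) \<partial>\<nu>) = 0"
          by (simp add: g_def mult_ac)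
      qed
      finally show ?thesis by simp
    qed
    moreover have "(\<integral>y. (\<phi> i y * \<phi> j y) * f y \<partial>Q) = (\<integral>y. (\<phi> i y * g y) * f y + (\<phi> i y * (\<phi> j y - g y)) * f y \<partial>Q)"
      by (rule Bochner_Integration.integral_cong) (auto simp: algebra_simps)
    ultimately have "(\<integral>y. (\<phi> i y * \<phi> j y) * f y \<partial>Q) = (\<integral>y. (\<phi> i y * (\<phi> j y - g y)) * f y \<partial>Q)"
      using i1 i2 by simp
    then show ?thesis using bounded(2)[OF _ b2] by simp
  qed
  have sq: "(\<Sum>i<n. \<phi> i y)\<^sup>2 * f y = (\<Sum>i<n. \<Sum>j<n. (\<phi> i y * \<phi> j y) * f y)" for y
    by (subst power2_eq_square, subst sum_product) (simp only: sum_distrib_right)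
  show "integrable Q (\<lambda>y. (\<Sum>i<n. \<phi> i y)\<^sup>2 * f y)" unfolding sq by (intro Bochner_Integration.integrable_sum int) auto
  have "(\<integral>y. (\<Sum>i<n. \<phi> i y)\<^sup>2 * f y \<partial>Q) = (\<Sum>i<n. \<Sum>j<n. \<integral>y. (\<phi> i y * \<phi> j y) * f y \<partial>Q)"
    unfolding sq
    by (subst Bochner_Integration.integral_sum, intro Bochner_Integration.integrable_sum int, simp, simp)
      (intro sum.cong refl Bochner_Integration.integral_sum int, auto)
  also have "\<dots> = (\<Sum>i<n. (\<integral>y. (\<phi> i y * \<phi> i y) * f y \<partial>Q) + (\<Sum>j\<in>{..<n}-{i}. \<integral>y. (\<phi> i y * \<phi> j y) * f y \<partial>Q))"
    by (intro sum.cong refl sum.remove) auto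
  also have "\<dots> \<le> (\<Sum>i<n. b\<^sup>2 * (\<integral>y. f y \<partial>Q) + (\<Sum>j\<in>{..<n}-{i}. (b * d i j) * (\<integral>y. f y \<partial>Q)))"
    by (intro sum_mono add_mono diag off) auto
  also have "\<dots> = (real n * b\<^sup>2 + b * (\<Sum>i<n. \<Sum>j\<in>{..<n}-{i}. d i j)) * (\<integral>y. f y \<partial>Q)"
    by (simp add: sum.distrib sum_distrib_left sum_distrib_right distrib_right)
  finally show "(\<integral>y. (\<Sum>i<n. \<phi> i y)\<^sup>2 * f y \<partial>Q) \<le> (real n * b\<^sup>2 + b * (\<Sum>i<n. \<Sum>j\<in>{..<n}-{i}. d i j)) * (\<integral>y. f y \<partial>Q)" .
qed

lemma AE_PiM_all:
  assumes "prob_space \<nu>" and "AE x in \<nu>. Q x"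
  shows "AE y in (\<Pi>\<^sub>M i\<in>{..<n::nat}. \<nu>). \<forall>i<n. Q (y i)"
proof -
  have "AE y in (\<Pi>\<^sub>M i\<in>{..<n}. \<nu>). Q (y i)" if "i \<in> {..<n}" for i
    using AE_PiM_component[of "{..<n}" "\<lambda>_. \<nu>" i Q] assms that by simp
  then have "AE y in (\<Pi>\<^sub>M i\<in>{..<n}. \<nu>). \<forall>i\<in>{..<n}. Q (y i)" by (subst AE_finite_all) auto
  then show ?thesis by eventually_elim simp
qed

text \<open>With constant density, centred functions of single coordinates have no influence on each other.\<close>

lemma second_moment_iid_sum:
  fixes \<nu> :: "'a measure" and g :: "'a \<Rightarrow> real" and n :: nat
  assumes \<nu>: "prob_space \<nu>" and g [measurable]: "g \<in> borel_measurable \<nu>" and g1: "AE x in \<nu>. \<bar>g x\<bar> \<le> 1"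
  defines "Q \<equiv> \<Pi>\<^sub>M i\<in>{..<n}. \<nu>"
  shows "integrable Q (\<lambda>x. (\<Sum>i<n. g (x i) - (\<integral>z. g z \<partial>\<nu>))\<^sup>2)"
    and "(\<integral>x. (\<Sum>i<n. g (x i) - (\<integral>z. g z \<partial>\<nu>))\<^sup>2 \<partial>Q) \<le> 4 * real n"
proof -
  interpret N: prob_space \<nu> by fact
  interpret P: prob_space Q unfolding Q_def by (rule prob_space_PiM) (rule \<nu>)
  let ?m = "\<integral>z. g z \<partial>\<nu>"
  have gi: "integrable \<nu> g" by (rule N.integrable_const_bound[where B = 1]) (use g1 in auto)
  have m: "\<bar>?m\<bar> \<le> 1"
  proof -
    have "\<bar>?m\<bar> \<le> (\<integral>x. \<bar>g x\<bar> \<partial>\<nu>)" by (rule integral_abs_bound)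
    also have "\<dots> \<le> (\<integral>x. 1 \<partial>\<nu>)" by (rule integral_mono_AE) (use g1 gi in auto)
    finally show ?thesis by (simp add: N.prob_space)
  qed
  obtain w where w: "w \<in> space \<nu>" using N.not_empty by auto
  have "integrable Q (\<lambda>x. (\<Sum>i<n. g (x i) - ?m)\<^sup>2 * 1)"
    and "(\<integral>x. (\<Sum>i<n. g (x i) - ?m)\<^sup>2 * 1 \<partial>Q) \<le> (real n * 2\<^sup>2 + 2 * (\<Sum>i<n. \<Sum>j\<in>{..<n}-{i}. 0)) * (\<integral>x. 1 \<partial>Q)"
  proof (goal_cases)
    case 1 show ?case unfolding Q_def
      by (rule second_moment_conditionally_centred(1)[OF \<nu>, where b = 2 and d = "\<lambda>_ _. 0", OF _ _ _ _ w])
       (use AE_PiM_all[OF \<nu> g1, of n] m gi P.integrable_const[of "1::real", unfolded Q_def] in \<open>auto simp: N.prob_space elim!: eventually_mono\<close>)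
    case 2 show ?case unfolding Q_def
      by (rule second_moment_conditionally_centred(2)[OF \<nu>, where b = 2 and d = "\<lambda>_ _. 0", OF _ _ _ _ w])
       (use AE_PiM_all[OF \<nu> g1, of n] m gi P.integrable_const[of "1::real", unfolded Q_def] in \<open>auto simp: N.prob_space elim!: eventually_mono\<close>)
  qed
  then show "integrable Q (\<lambda>x. (\<Sum>i<n. g (x i) - ?m)\<^sup>2)"
    "(\<integral>x. (\<Sum>i<n. g (x i) - ?m)\<^sup>2 \<partial>Q) \<le> 4 * real n"
    by (simp_all add: P.prob_space)
qed

section \<open>Gibbs laws with quadratic interaction\<close>

text \<open>The diagonal is left out: the entry \<open>A i i\<close> acts on coordinate \<open>i\<close> through the second argument of \<open>\<alpha>\<close>.\<close>

definition local_field :: "nat \<Rightarrow> (nat \<Rightarrow> nat \<Rightarrow> real) \<Rightarrow> (nat \<Rightarrow> real) \<Rightarrow> nat \<Rightarrow> real" where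
  "local_field n A y i = (\<Sum>j\<in>{..<n} - {i}. A i j * y j)"

definition gibbs_exponent :: "nat \<Rightarrow> (nat \<Rightarrow> nat \<Rightarrow> real) \<Rightarrow> (nat \<Rightarrow> real) \<Rightarrow> (nat \<Rightarrow> real) \<Rightarrow> real" where
  "gibbs_exponent n A h y = quad_form n A y / 2 + (\<Sum>i<n. y i * h i)"

lemma local_field_upd: "local_field n A (y(i := z)) i = local_field n A y i"
  by (simp add: local_field_def)

lemma local_field_eq: "i < n \<Longrightarrow> local_field n A y i = mat_vec n A y i - A i i * y i"
  unfolding local_field_def mat_vec_def by (subst sum.remove[of "{..<n}" i]) auto

lemma quad_form_split:
  assumes A: "sym_mat n A" and i: "i < n"
  shows "quad_form n A y = A i i * (y i)\<^sup>2 + 2 * y i * local_field n A y i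
    + (\<Sum>k\<in>{..<n} - {i}. \<Sum>l\<in>{..<n} - {i}. y k * A k l * y l)"
proof -
  have q: "quad_form n A y = (\<Sum>k<n. \<Sum>l<n. y k * A k l * y l)"
    by (simp add: quad_form_def mat_vec_def sum_distrib_left mult_ac)
  have row: "(\<Sum>l<n. y k * A k l * y l) = y k * A k i * y i + (\<Sum>l\<in>{..<n} - {i}. y k * A k l * y l)" for k
    using i by (subst sum.remove[of "{..<n}" i]) auto
  have "quad_form n A y = (\<Sum>l<n. y i * A i l * y l) + (\<Sum>k\<in>{..<n} - {i}. \<Sum>l<n. y k * A k l * y l)"
    unfolding q using i by (subst sum.remove[of "{..<n}" i]) auto
  also have "\<dots> = y i * A i i * y i + (\<Sum>l\<in>{..<n} - {i}. y i * A i l * y l) + ((\<Sum>k\<in>{..<n} - {i}. y k * A k i * y i)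
     + (\<Sum>k\<in>{..<n} - {i}. \<Sum>l\<in>{..<n} - {i}. y k * A k l * y l))"
    unfolding row sum.distrib by simp
  also have "(\<Sum>k\<in>{..<n} - {i}. y k * A k i * y i) = y i * local_field n A y i"
    unfolding local_field_def sum_distrib_left using A i by (intro sum.cong) (auto simp: sym_mat_def mult_ac)
  also have "(\<Sum>l\<in>{..<n} - {i}. y i * A i l * y l) = y i * local_field n A y i"
    unfolding local_field_def sum_distrib_left by (intro sum.cong) (auto simp: mult_ac)
  finally show ?thesis by (simp add: power2_eq_square algebra_simps)
qed

text \<open>As a function of one coordinate, the exponent is that of a tilt in the local field.\<close>

lemma gibbs_exponent_upd:
  assumes A: "sym_mat n A" and i: "i < n"
  obtains R where "\<And>z. gibbs_exponent n A h (y(i := z)) = (local_field n A y i + h i) * z + A i i / 2 * z\<^sup>2 + R"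
proof
  fix z
  let ?y = "y(i := z)"
  have "(\<Sum>k<n. ?y k * h k) = z * h i + (\<Sum>k\<in>{..<n} - {i}. y k * h k)"
    using i by (subst sum.remove[of "{..<n}" i]) (auto intro!: sum.cong)
  then show "gibbs_exponent n A h ?y = (local_field n A y i + h i) * z + A i i / 2 * z\<^sup>2 +
     ((\<Sum>k\<in>{..<n} - {i}. \<Sum>l\<in>{..<n} - {i}. y k * A k l * y l) / 2 + (\<Sum>k\<in>{..<n} - {i}. y k * h k))"
    unfolding gibbs_exponent_def quad_form_split[OF A i] local_field_upd by (simp add: field_simps)
qed

lemma abs_gibbs_exponent_le:
  assumes "\<forall>i<n. \<bar>y i\<bar> \<le> 1"
  shows "\<bar>gibbs_exponent n A h y\<bar> \<le> (\<Sum>i<n. \<Sum>j<n. \<bar>A i j\<bar>) + (\<Sum>i<n. \<bar>h i\<bar>)"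
proof -
  have "\<bar>quad_form n A y\<bar> \<le> (\<Sum>i<n. \<bar>y i * (\<Sum>j<n. A i j * y j)\<bar>)"
    unfolding quad_form_def mat_vec_def by (rule sum_abs)
  also have "\<dots> \<le> (\<Sum>i<n. 1 * (\<Sum>j<n. \<bar>A i j\<bar> * 1))"
    using assms by (intro sum_mono abs_mult_bound order_trans[OF sum_abs] sum_mono abs_mult_bound) auto
  finally have "\<bar>quad_form n A y\<bar> \<le> (\<Sum>i<n. \<Sum>j<n. \<bar>A i j\<bar>)" by simp
  moreover have "\<bar>\<Sum>i<n. y i * h i\<bar> \<le> (\<Sum>i<n. 1 * \<bar>h i\<bar>)"
    using assms by (intro order_trans[OF sum_abs] sum_mono abs_mult_bound) auto
  ultimately show ?thesis unfolding gibbs_exponent_def by simp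
qed

context interval_law
begin

lemma component_measurable: "i < n \<Longrightarrow> (\<lambda>y. y i) \<in> borel_measurable (\<Pi>\<^sub>M i\<in>{..<n}. \<nu>)"
  using measurable_component_singleton[of i "{..<n}" "\<lambda>_. \<nu>"] by (simp add: measurable_cong_sets[OF refl sets_law])

lemma gibbs_exponent_measurable: "gibbs_exponent n A h \<in> borel_measurable (\<Pi>\<^sub>M i\<in>{..<n}. \<nu>)"
  unfolding gibbs_exponent_def quad_form_def mat_vec_def
  by (intro borel_measurable_add borel_measurable_divide borel_measurable_sum borel_measurable_times component_measurable) auto

lemma prob_space_product: "prob_space (\<Pi>\<^sub>M i\<in>{..<n::nat}. \<nu>)"
  by (rule prob_space_PiM) (rule prob_space_axioms)

lemma AE_product_interval: "AE y in (\<Pi>\<^sub>M i\<in>{..<n::nat}. \<nu>). \<forall>i<n. \<bar>y i\<bar> \<le> 1"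
  by (rule AE_PiM_all[OF prob_space_axioms AE_interval])

lemma integrable_exp_gibbs: "integrable (\<Pi>\<^sub>M i\<in>{..<n}. \<nu>) (\<lambda>y. exp (gibbs_exponent n A h y))"
proof -
  interpret P: prob_space "\<Pi>\<^sub>M i\<in>{..<n}. \<nu>" by (rule prob_space_product)
  show ?thesis
    by (rule P.integrable_const_bound[where B = "exp ((\<Sum>i<n. \<Sum>j<n. \<bar>A i j\<bar>) + (\<Sum>i<n. \<bar>h i\<bar>))"])
     (use AE_product_interval[of n] gibbs_exponent_measurable[of n A h] in \<open>auto elim!: eventually_mono intro: order_trans[OF abs_ge_self abs_gibbs_exponent_le]\<close>)
qed

lemma gibbs_normaliser_pos: "0 < (\<integral>y. exp (gibbs_exponent n A h y) \<partial>(\<Pi>\<^sub>M i\<in>{..<n}. \<nu>))"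
proof -
  interpret P: prob_space "\<Pi>\<^sub>M i\<in>{..<n}. \<nu>" by (rule prob_space_product)
  let ?c = "(\<Sum>i<n. \<Sum>j<n. \<bar>A i j\<bar>) + (\<Sum>i<n. \<bar>h i\<bar>)"
  have "0 < exp (- ?c)" by simp
  also have "\<dots> = (\<integral>y. exp (- ?c) \<partial>(\<Pi>\<^sub>M i\<in>{..<n}. \<nu>))" by (simp add: P.prob_space)
  also have "\<dots> \<le> (\<integral>y. exp (gibbs_exponent n A h y) \<partial>(\<Pi>\<^sub>M i\<in>{..<n}. \<nu>))"
  proof (rule integral_mono_AE[OF _ integrable_exp_gibbs])
    show "AE y in \<Pi>\<^sub>M i\<in>{..<n}. \<nu>. exp (- ?c) \<le> exp (gibbs_exponent n A h y)"
      using AE_product_interval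
    proof eventually_elim
      case (elim y)
      then show ?case using abs_gibbs_exponent_le[of n y A h] by simp
    qed
  qed simp
  finally show ?thesis .
qed

lemma gibbs_density_props:
  fixes n :: nat
  defines "Q \<equiv> \<Pi>\<^sub>M i\<in>{..<n}. \<nu>"
  shows "integrable Q (gibbs_density Q (gibbs_exponent n A h))" "0 \<le> gibbs_density Q (gibbs_exponent n A h) y"
    "(\<integral>y. gibbs_density Q (gibbs_exponent n A h) y \<partial>Q) = 1"
  using gibbs_normaliser_pos[of n A h] integrable_exp_gibbs[of n A h] unfolding gibbs_density_def Q_def by auto

text \<open>Coordinate minus conditional mean.\<close>

definition residual :: "nat \<Rightarrow> (nat \<Rightarrow> nat \<Rightarrow> real) \<Rightarrow> (nat \<Rightarrow> real) \<Rightarrow> (nat \<Rightarrow> real) \<Rightarrow> nat \<Rightarrow> real" where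
  "residual n A h y i = y i - alpha_d1 \<nu> (local_field n A y i + h i) (A i i)"

lemma residual_measurable: "i < n \<Longrightarrow> (\<lambda>y. residual n A h y i) \<in> borel_measurable (\<Pi>\<^sub>M i\<in>{..<n}. \<nu>)"
  unfolding residual_def local_field_def
  by (intro borel_measurable_diff alpha_d1_measurable borel_measurable_add borel_measurable_sum borel_measurable_times component_measurable) auto

lemma residual_conditionally_centred:
  assumes A: "sym_mat n A" and i: "i < n"
  shows "(\<integral>z. residual n A h (y(i := z)) i * gibbs_density Q (gibbs_exponent n A h) (y(i := z)) \<partial>\<nu>) = 0"
proof -
  obtain R where R: "\<And>z. gibbs_exponent n A h (y(i := z)) = (local_field n A y i + h i) * z + A i i / 2 * z\<^sup>2 + R"
    using gibbs_exponent_upd[OF A i] by blast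
  let ?a = "local_field n A y i + h i" and ?b = "A i i" and ?Z = "\<integral>w. exp (gibbs_exponent n A h w) \<partial>Q"
  have "(\<lambda>z. residual n A h (y(i := z)) i * gibbs_density Q (gibbs_exponent n A h) (y(i := z)))
     = (\<lambda>z. (exp R / ?Z) * (z ^ 1 * exp (?a * z + ?b / 2 * z\<^sup>2) - alpha_d1 \<nu> ?a ?b * (z ^ 0 * exp (?a * z + ?b / 2 * z\<^sup>2))))"
    unfolding residual_def gibbs_density_def local_field_upd R by (simp add: fun_eq_iff exp_add algebra_simps diff_divide_distrib)
  moreover have "(\<integral>z. z ^ 1 * exp (?a * z + ?b / 2 * z\<^sup>2) - alpha_d1 \<nu> ?a ?b * (z ^ 0 * exp (?a * z + ?b / 2 * z\<^sup>2)) \<partial>\<nu>)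
     = tilt_moment \<nu> 1 ?a ?b - alpha_d1 \<nu> ?a ?b * tilt_moment \<nu> 0 ?a ?b"
    unfolding tilt_moment_def by (subst Bochner_Integration.integral_diff; (intro integrable_mult_right integrable_tilt)?) simp
  moreover have "\<dots> = 0" by (simp add: alpha_d1_eq tilt_mean_def)
  ultimately show ?thesis by simp
qed

text \<open>Flipping one coordinate moves the conditional mean of another by at most the corresponding matrix
  entry, because \<open>\<alpha>'\<close> is 1-Lipschitz.  The total influence is at most \<open>n\<close> times the Frobenius norm, which
  is of smaller order than \<open>n\<^sup>2\<close> for a matrix of bounded operator norm.\<close>

lemma residual_second_moment:
  fixes n :: nat
  assumes A: "sym_mat n A" and v: "\<forall>i<n. \<bar>v i\<bar> \<le> 1"
  defines "Q \<equiv> \<Pi>\<^sub>M i\<in>{..<n}. \<nu>"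
  shows "integrable Q (\<lambda>y. (\<Sum>i<n. v i * residual n A h y i)\<^sup>2 * gibbs_density Q (gibbs_exponent n A h) y)" (is ?I)
    and "(\<integral>y. (\<Sum>i<n. v i * residual n A h y i)\<^sup>2 * gibbs_density Q (gibbs_exponent n A h) y \<partial>Q)
      \<le> 4 * real n + 2 * real n * sqrt (\<Sum>i<n. \<Sum>j<n. (A i j)\<^sup>2)" (is ?B)
proof -
  let ?f = "gibbs_density Q (gibbs_exponent n A h)"
  have bnd: "AE y in Q. \<bar>v i * residual n A h y i\<bar> \<le> 2" if "i < n" for i
    using AE_product_interval unfolding Q_def
  proof eventually_elim
    case (elim y)
    have "\<bar>residual n A h y i\<bar> \<le> 2"
      unfolding residual_def using elim that abs_alpha_d1_le[of "local_field n A y i + h i" "A i i"] by (smt (verit))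
    then show ?case using abs_mult_bound[of "v i" 1 _ 2] v that by simp
  qed
  have infl: "AE y in Q. \<bar>v j * residual n A h y j - v j * residual n A h (y(i := 0)) j\<bar> \<le> \<bar>A i j\<bar>"
    if ij: "i < n" "j < n" "i \<noteq> j" for i j
    using AE_product_interval unfolding Q_def
  proof eventually_elim
    case (elim y)
    have "local_field n A y j - local_field n A (y(i := 0)) j = (\<Sum>k\<in>{..<n} - {j}. if k = i then A j k * y k else 0)"
      unfolding local_field_def sum_subtractf[symmetric] by (rule sum.cong) auto
    also have "\<dots> = A j i * y i" using ij by simp
    finally have l: "\<bar>local_field n A y j - local_field n A (y(i := 0)) j\<bar> \<le> \<bar>A j i\<bar> * 1"
      using elim ij by (simp only:) (intro abs_mult_bound, auto)
    have "v j * residual n A h y j - v j * residual n A h (y(i := 0)) j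
       = v j * (alpha_d1 \<nu> (local_field n A (y(i := 0)) j + h j) (A j j) - alpha_d1 \<nu> (local_field n A y j + h j) (A j j))"
      using ij by (simp add: residual_def algebra_simps)
    also have "\<bar>\<dots>\<bar> \<le> 1 * (\<bar>A j i\<bar> * 1)"
      using v ij l by (intro abs_mult_bound order_trans[OF alpha_d1_lipschitz_a]) (auto simp: abs_minus_commute)
    finally show ?case using A ij by (simp add: sym_mat_def)
  qed
  note main = second_moment_conditionally_centred[where n = n and \<nu> = \<nu> and f = ?f and \<phi> = "\<lambda>i y. v i * residual n A h y i"
    and b = 2 and ref = 0 and d = "\<lambda>i j. \<bar>A i j\<bar>", folded Q_def, OF prob_space_axioms]
  have centred: "(\<integral>z. v i * residual n A h (y(i := z)) i * ?f (y(i := z)) \<partial>\<nu>) = 0" if "i < n" for i y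
    using residual_conditionally_centred[OF A that, of h y Q] by (simp add: mult.assoc)
  have meas: "(\<lambda>y. v i * residual n A h y i) \<in> borel_measurable Q" if "i < n" for i
    using residual_measurable[OF that] unfolding Q_def by simp
  note props = gibbs_density_props[of n A h, folded Q_def]
  show ?I by (rule main(1)[OF props(1,2) meas bnd _ infl centred]) auto
  have "(\<integral>y. (\<Sum>i<n. v i * residual n A h y i)\<^sup>2 * ?f y \<partial>Q)
      \<le> (real n * 2\<^sup>2 + 2 * (\<Sum>i<n. \<Sum>j\<in>{..<n}-{i}. \<bar>A i j\<bar>)) * (\<integral>y. ?f y \<partial>Q)"
    by (rule main(2)[OF props(1,2) meas bnd _ infl centred]) auto
  also have "\<dots> \<le> 4 * real n + 2 * (\<Sum>i<n. \<Sum>j<n. \<bar>A i j\<bar>)"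
    unfolding props(3) by (auto intro!: sum_mono sum_mono2)
  also have "(\<Sum>i<n. \<Sum>j<n. \<bar>A i j\<bar>) \<le> real n * sqrt (\<Sum>i<n. \<Sum>j<n. (A i j)\<^sup>2)"
  proof -
    have "(\<Sum>p\<in>{..<n}\<times>{..<n}. \<bar>1\<bar> * \<bar>A (fst p) (snd p)\<bar>) \<le> L2_set (\<lambda>_. 1) ({..<n}\<times>{..<n}) * L2_set (\<lambda>p. A (fst p) (snd p)) ({..<n}\<times>{..<n})"
      by (rule L2_set_mult_ineq)
    then show ?thesis by (simp add: L2_set_def sum.cartesian_product case_prod_beta)
  qed
  finally show ?B by simp
qed

end

section \<open>The maximum pseudo-likelihood estimator on a nondegenerate sample\<close>

text \<open>The empirical second moment matrix of the vectors \<open>(t\<^sub>i, x\<^sub>i)\<close> has smallest eigenvalue at least \<open>\<kappa>\<close>.\<close>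

definition design_nondegenerate ::
    "nat \<Rightarrow> (nat \<Rightarrow> real) \<Rightarrow> (nat \<Rightarrow> real ^ 'd) \<Rightarrow> real \<Rightarrow> bool" where
  "design_nondegenerate n t x \<kappa> \<longleftrightarrow>
     (\<forall>a b. \<kappa> * real n * (a\<^sup>2 + (norm b)\<^sup>2) \<le> (\<Sum>i<n. (a * t i + x i \<bullet> b)\<^sup>2))"

lemma coef_box_eq_cbox: "coef_box M0 = cbox (\<chi> k. - M0) (\<chi> k. M0)"
  by (auto simp: coef_box_def mem_box_cart)

lemma param_space_compact: "compact (param_space B M0)"
  unfolding param_space_def coef_box_eq_cbox by (intro compact_Times compact_cbox compact_Icc)

lemma param_space_convex: "convex (param_space B M0)"
  unfolding param_space_def coef_box_eq_cbox by (intro convex_Times convex_box convex_real_interval)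

lemma norm_pair_square: "(norm p)\<^sup>2 = (fst p)\<^sup>2 + (norm (snd p))\<^sup>2" for p :: "real \<times> 'a::real_normed_vector"
  by (cases p) (simp add: norm_Pair)

definition design_row :: "(nat \<Rightarrow> real) \<Rightarrow> (nat \<Rightarrow> real ^ 'd) \<Rightarrow> nat \<Rightarrow> real \<times> (real ^ 'd) \<Rightarrow> real" where
  "design_row t x i p = fst p * t i + x i \<bullet> snd p"

lemma design_row_diff: "design_row t x i (p - q) = design_row t x i p - design_row t x i q"
  by (simp add: design_row_def algebra_simps inner_diff_right)

lemma design_row_minus: "design_row t x i (- p) = - design_row t x i p"
  by (simp add: design_row_def)

lemma abs_design_row_le:
  fixes x :: "nat \<Rightarrow> real ^ 'd"
  assumes "\<bar>t i\<bar> \<le> 1" "\<forall>k. \<bar>x i $ k\<bar> \<le> 1"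
  shows "\<bar>design_row t x i p\<bar> \<le> \<bar>fst p\<bar> + real CARD('d) * norm (snd p)"
  using field_diff_le[OF assms, of "fst p" "snd p" 0 0] by (simp add: design_row_def field_dist_def)

lemma abs_design_row_param_le:
  fixes x :: "nat \<Rightarrow> real ^ 'd"
  assumes "\<bar>t i\<bar> \<le> 1" "\<forall>k. \<bar>x i $ k\<bar> \<le> 1" and p: "p \<in> param_space B M0"
  shows "\<bar>design_row t x i p\<bar> \<le> B + real CARD('d) * (real CARD('d) * M0)"
proof -
  have "norm (snd p) \<le> (\<Sum>k\<in>UNIV. \<bar>snd p $ k\<bar>)" by (rule norm_le_l1_cart)
  also have "\<dots> \<le> (\<Sum>k\<in>(UNIV::'d set). M0)"
    using p by (intro sum_mono) (auto simp: param_space_def coef_box_def abs_le_iff minus_le_iff)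
  finally have "real CARD('d) * norm (snd p) \<le> real CARD('d) * (real CARD('d) * M0)" by (intro mult_left_mono) auto
  moreover have "\<bar>fst p\<bar> \<le> B" using p by (auto simp: param_space_def)
  ultimately show ?thesis using abs_design_row_le[of t i x p, OF assms(1,2)] by linarith
qed

lemma sum_design_row:
  fixes r :: "nat \<Rightarrow> real"
  shows "(\<Sum>i<n. r i * design_row t x i e) = fst e * (\<Sum>i<n. t i * r i) + (\<Sum>k\<in>UNIV. snd e $ k * (\<Sum>i<n. x i $ k * r i))"
proof -
  have "(\<Sum>i<n. r i * design_row t x i e) = (\<Sum>i<n. fst e * (t i * r i)) + (\<Sum>i<n. \<Sum>k\<in>UNIV. snd e $ k * (x i $ k * r i))"
    unfolding sum.distrib[symmetric] design_row_def inner_vec_def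
    by (intro sum.cong refl) (simp add: distrib_left sum_distrib_left mult_ac)
  also have "(\<Sum>i<n. \<Sum>k\<in>UNIV. snd e $ k * (x i $ k * r i)) = (\<Sum>k\<in>UNIV. \<Sum>i<n. snd e $ k * (x i $ k * r i))"
    by (rule sum.swap)
  finally show ?thesis by (simp add: sum_distrib_left)
qed

lemma le_of_quadratic_le:
  fixes N :: real
  assumes "0 \<le> a * N - c * N\<^sup>2" "0 < c" "0 \<le> N" "0 \<le> a"
  shows "N \<le> a / c"
proof (cases "N = 0")
  case False
  then have "N > 0" using assms by simp
  moreover have "N * (c * N) \<le> N * a" using assms by (simp add: power2_eq_square algebra_simps)
  ultimately have "c * N \<le> a" by simp
  then show ?thesis using assms by (simp add: field_simps)
qed (use assms in simp)

context interval_law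
begin

text \<open>A tangent bound for \<open>\<alpha>\<close> whose quadratic term needs a curvature bound only between the two points.\<close>

lemma alpha_tangent:
  assumes "\<And>u. \<bar>u\<bar> \<le> max \<bar>s\<bar> \<bar>s'\<bar> \<Longrightarrow> k \<le> alpha_d2 \<nu> u a"
  shows "alpha \<nu> s a + alpha_d1 \<nu> s a * (s' - s) + k / 2 * (s' - s)\<^sup>2 \<le> alpha \<nu> s' a"
proof (cases "s' = s")
  case False
  define diff where "diff m = (if m = 0 then (\<lambda>u. alpha \<nu> u a) else if m = 1 then (\<lambda>u. alpha_d1 \<nu> u a) else (\<lambda>u. alpha_d2 \<nu> u a))" for m :: nat
  have D: "\<forall>m t. m < 2 \<and> min s s' \<le> t \<and> t \<le> max s s' \<longrightarrow> ((diff m) has_real_derivative diff (Suc m) t) (at t)"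
    using alpha_deriv' alpha_d1_deriv by (auto simp: diff_def less_2_cases_iff)
  have "\<exists>t. (if s' < s then s' < t \<and> t < s else s < t \<and> t < s') \<and>
      alpha \<nu> s' a = (\<Sum>m<2. (diff m s / fact m) * (s' - s) ^ m) + (diff 2 t / fact 2) * (s' - s) ^ 2"
    by (rule Taylor[OF _ _ D]) (use False in \<open>auto simp: diff_def\<close>)
  then obtain t where t: "if s' < s then s' < t \<and> t < s else s < t \<and> t < s'"
    and eq: "alpha \<nu> s' a = (\<Sum>m<2. (diff m s / fact m) * (s' - s) ^ m) + (diff 2 t / fact 2) * (s' - s) ^ 2" by blast
  have "alpha \<nu> s' a = alpha \<nu> s a + alpha_d1 \<nu> s a * (s' - s) + alpha_d2 \<nu> t a / 2 * (s' - s)\<^sup>2"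
    using eq by (simp add: diff_def numeral_2_eq_2)
  moreover have "\<bar>t\<bar> \<le> max \<bar>s\<bar> \<bar>s'\<bar>" using t by (auto split: if_splits)
  then have "k \<le> alpha_d2 \<nu> t a" by (rule assms)
  then have "k / 2 * (s' - s)\<^sup>2 \<le> alpha_d2 \<nu> t a / 2 * (s' - s)\<^sup>2" by (intro mult_right_mono) auto
  ultimately show ?thesis by simp
qed simp

definition site_log_density :: "nat \<Rightarrow> (nat \<Rightarrow> nat \<Rightarrow> real) \<Rightarrow> (nat \<Rightarrow> real) \<Rightarrow> nat \<Rightarrow> real \<Rightarrow> real" where
  "site_log_density n A y i h = (local_field n A y i + h) * y i + A i i / 2 * (y i)\<^sup>2 - alpha \<nu> (local_field n A y i + h) (A i i)"

lemma cond_density_eq: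
  assumes A: "sym_mat n A" and i: "i < n"
  shows "cond_density \<nu> (outcome_density \<nu> n A \<tau> \<theta> t x) i y = exp (site_log_density n A y i (ext_field \<tau> \<theta> t x i))"
proof -
  let ?h = "ext_field \<tau> \<theta> t x" and ?Q = "\<Pi>\<^sub>M i\<in>{..<n}. \<nu>"
  let ?Z = "\<integral>w. exp (gibbs_exponent n A ?h w) \<partial>?Q"
  obtain R where R: "\<And>z. gibbs_exponent n A ?h (y(i := z)) = (local_field n A y i + ?h i) * z + A i i / 2 * z\<^sup>2 + R"
    using gibbs_exponent_upd[OF A i] by blast
  have dens: "outcome_density \<nu> n A \<tau> \<theta> t x y = exp (gibbs_exponent n A ?h y) / ?Z" for y
    by (simp add: outcome_density_def gibbs_density_def gibbs_exponent_def ext_field_def)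
  let ?e = "\<lambda>z. exp ((local_field n A y i + ?h i) * z + A i i / 2 * z\<^sup>2)"
  have "(\<integral>z. outcome_density \<nu> n A \<tau> \<theta> t x (y(i := z)) \<partial>\<nu>) = (\<integral>z. (exp R / ?Z) * ?e z \<partial>\<nu>)"
    unfolding dens R by (simp add: exp_add mult_ac)
  also have "\<dots> = (exp R / ?Z) * tilt_moment \<nu> 0 (local_field n A y i + ?h i) (A i i)"
    by (simp add: tilt_moment_def)
  finally have den: "(\<integral>z. outcome_density \<nu> n A \<tau> \<theta> t x (y(i := z)) \<partial>\<nu>) = (exp R / ?Z) * tilt_moment \<nu> 0 (local_field n A y i + ?h i) (A i i)" .
  have num: "outcome_density \<nu> n A \<tau> \<theta> t x y = (exp R / ?Z) * ?e (y i)"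
    using R[of "y i"] unfolding dens by (simp add: exp_add mult_ac)
  have "?Z \<noteq> 0" using gibbs_normaliser_pos[of n A ?h] by simp
  then have "cond_density \<nu> (outcome_density \<nu> n A \<tau> \<theta> t x) i y = ?e (y i) / tilt_moment \<nu> 0 (local_field n A y i + ?h i) (A i i)"
    unfolding cond_density_def den num by simp
  also have "\<dots> = exp (site_log_density n A y i (?h i))"
    unfolding site_log_density_def alpha_eq exp_diff by simp
  finally show ?thesis .
qed

definition log_pseudo_likelihood ::
  "nat \<Rightarrow> (nat \<Rightarrow> nat \<Rightarrow> real) \<Rightarrow> (nat \<Rightarrow> real) \<Rightarrow> (nat \<Rightarrow> real ^ 'd) \<Rightarrow> (nat \<Rightarrow> real) \<Rightarrow> real \<times> (real ^ 'd) \<Rightarrow> real" where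
  "log_pseudo_likelihood n A t x y p = (\<Sum>i<n. site_log_density n A y i (design_row t x i p))"

lemma pseudo_likelihood_eq:
  assumes "sym_mat n A"
  shows "pseudo_likelihood \<nu> n A t x y p = exp (log_pseudo_likelihood n A t x y p)"
proof (cases p)
  case (Pair \<tau> \<theta>)
  have "(\<Prod>i<n. cond_density \<nu> (outcome_density \<nu> n A \<tau> \<theta> t x) i y) = (\<Prod>i<n. exp (site_log_density n A y i (ext_field \<tau> \<theta> t x i)))"
    by (intro prod.cong refl cond_density_eq[OF assms]) simp
  then show ?thesis
    by (simp add: Pair pseudo_likelihood_def log_pseudo_likelihood_def design_row_def ext_field_def exp_sum)
qed

lemma log_pseudo_likelihood_continuous: "continuous_on S (log_pseudo_likelihood n A t x y)"
proof -
  have "continuous_on UNIV (\<lambda>u. alpha \<nu> u a)" for a by (rule continuous_on_if_DERIV[OF alpha_deriv])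
  then have "continuous_on S (\<lambda>p. alpha \<nu> (local_field n A y i + design_row t x i p) (A i i))" for i
    by (rule continuous_on_compose2) (auto simp: design_row_def intro!: continuous_intros)
  then show ?thesis unfolding log_pseudo_likelihood_def site_log_density_def design_row_def
    by (intro continuous_intros) auto
qed

text \<open>The curvature of the criterion is bounded below at sites whose local field is moderate.  A bound on
  the mean square of the local fields leaves so few other sites that the design remains nondegenerate
  without them.\<close>

lemma log_pseudo_likelihood_tangent:
  fixes x :: "nat \<Rightarrow> real ^ 'd"
  assumes t: "\<forall>i<n. \<bar>t i\<bar> \<le> 1" and x: "\<forall>i<n. \<forall>k. \<bar>x i $ k\<bar> \<le> 1"
    and diag: "\<forall>i<n. \<bar>A i i\<bar> \<le> Ka" and field: "(\<Sum>i<n. (local_field n A y i)\<^sup>2) \<le> Km * real n"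
    and nondeg: "design_nondegenerate n t x \<kappa>" and L: "0 < L" "4 * (real CARD('d))\<^sup>2 * Km \<le> \<kappa> * L\<^sup>2"
    and p: "p \<in> param_space B M0" and q: "q \<in> param_space B M0"
  defines "k0 \<equiv> exp (- 2 * (L + (B + real CARD('d) * (real CARD('d) * M0))) - Ka) * alpha_d2 \<nu> 0 0"
  shows "log_pseudo_likelihood n A t x y p \<le> log_pseudo_likelihood n A t x y q
    + (\<Sum>i<n. residual n A (\<lambda>i. design_row t x i q) y i * design_row t x i (p - q)) - k0 * \<kappa> / 4 * real n * (norm (p - q))\<^sup>2"
proof -
  let ?m = "local_field n A y" and ?D = "\<lambda>i. design_row t x i (p - q)" and ?h = "\<lambda>i. design_row t x i q"
  define bad where "bad = {i \<in> {..<n}. L < \<bar>?m i\<bar>}"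
  let ?d = "real CARD('d)"
  let ?H = "B + ?d * (?d * M0)"
  have fin: "finite bad" "bad \<subseteq> {..<n}" by (auto simp: bad_def)
  have k0: "0 \<le> k0" unfolding k0_def using alpha_d2_nonneg by simp
  have site: "site_log_density n A y i (design_row t x i p) \<le> site_log_density n A y i (?h i)
      + residual n A ?h y i * ?D i - (if i \<in> bad then 0 else k0) / 2 * (?D i)\<^sup>2" if i: "i < n" for i
  proof -
    define s where "s = ?m i + ?h i"
    define s' where "s' = ?m i + design_row t x i p"
    have ss: "s' - s = ?D i" by (simp add: s_def s'_def design_row_diff)
    have hb: "\<bar>?h i\<bar> \<le> ?H" "\<bar>design_row t x i p\<bar> \<le> ?H"
      using abs_design_row_param_le[OF _ _ q] abs_design_row_param_le[OF _ _ p] t x i by auto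
    have "(if i \<in> bad then 0 else k0) \<le> alpha_d2 \<nu> u (A i i)" if u: "\<bar>u\<bar> \<le> max \<bar>s\<bar> \<bar>s'\<bar>" for u
    proof (cases "i \<in> bad")
      case False
      then have "\<bar>?m i\<bar> \<le> L" using i by (auto simp: bad_def)
      then have "\<bar>u\<bar> \<le> L + ?H" using u hb unfolding s_def s'_def by (smt (verit))
      then have "- 2 * (L + ?H) - Ka \<le> - 2 * \<bar>u\<bar> - \<bar>A i i\<bar>" using diag i by (smt (verit))
      then have "k0 \<le> exp (- 2 * \<bar>u\<bar> - \<bar>A i i\<bar>) * alpha_d2 \<nu> 0 0"
        unfolding k0_def by (intro mult_right_mono alpha_d2_nonneg) simp
      then show ?thesis using alpha_d2_ge[of u "A i i"] False by simp
    qed (simp add: alpha_d2_nonneg)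
    from alpha_tangent[OF this] show ?thesis
      unfolding site_log_density_def residual_def ss[symmetric] unfolding s_def[symmetric] s'_def[symmetric]
      by (simp add: algebra_simps)
  qed
  have "real (card bad) * L\<^sup>2 = (\<Sum>i\<in>bad. L\<^sup>2)" by simp
  also have "\<dots> \<le> (\<Sum>i\<in>bad. (?m i)\<^sup>2)"
    using L by (intro sum_mono) (auto simp: bad_def abs_le_square_iff[symmetric])
  also have "\<dots> \<le> (\<Sum>i<n. (?m i)\<^sup>2)" using fin by (intro sum_mono2) auto
  also have "\<dots> \<le> Km * real n" by (rule field)
  finally have card: "real (card bad) * L\<^sup>2 \<le> Km * real n" .
  let ?N = "(norm (p - q))\<^sup>2"
  have d1: "1 \<le> ?d" by simp
  have Dle: "(?D i)\<^sup>2 \<le> 2 * ?d\<^sup>2 * ?N" if "i < n" for i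
  proof -
    let ?a = "\<bar>fst (p - q)\<bar>" and ?b = "norm (snd (p - q))"
    have "(?D i)\<^sup>2 \<le> (?a + ?d * ?b)\<^sup>2"
      using abs_design_row_le[of t i x "p - q"] t x that by (simp add: abs_le_square_iff[symmetric])
    also have "\<dots> \<le> (?d * ?a + ?d * ?b)\<^sup>2"
      using mult_right_mono[OF d1, of ?a] by (intro power_mono add_mono) auto
    also have "\<dots> = ?d\<^sup>2 * (?a + ?b)\<^sup>2" by (simp add: power_mult_distrib flip: distrib_left)
    also have "(?a + ?b)\<^sup>2 \<le> 2 * ?N"
      unfolding norm_pair_square using sum_squares_bound[of ?a ?b] by (simp add: power2_sum)
    finally show ?thesis by (simp add: mult_ac)
  qed
  have "4 * ((\<Sum>i\<in>bad. (?D i)\<^sup>2) * L\<^sup>2) \<le> 4 * ((real (card bad) * (2 * ?d\<^sup>2 * ?N)) * L\<^sup>2)"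
    using fin Dle sum_mono[of bad "\<lambda>i. (?D i)\<^sup>2" "\<lambda>_. 2 * ?d\<^sup>2 * ?N"] by (intro mult_left_mono mult_right_mono) auto
  also have "\<dots> = (real (card bad) * L\<^sup>2) * (8 * ?d\<^sup>2 * ?N)" by simp
  also have "\<dots> \<le> (Km * real n) * (8 * ?d\<^sup>2 * ?N)" by (rule mult_right_mono[OF card]) simp
  also have "\<dots> = (4 * ?d\<^sup>2 * Km) * (2 * real n * ?N)" by (simp add: mult_ac)
  also have "\<dots> \<le> (\<kappa> * L\<^sup>2) * (2 * real n * ?N)" by (rule mult_right_mono[OF L(2)]) simp
  finally have "(4 * (\<Sum>i\<in>bad. (?D i)\<^sup>2)) * L\<^sup>2 \<le> (\<kappa> * (2 * real n * ?N)) * L\<^sup>2" by (simp add: mult_ac)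
  then have badsum: "2 * (\<Sum>i\<in>bad. (?D i)\<^sup>2) \<le> \<kappa> * real n * ?N" using L(1) by simp
  have "\<kappa> * real n * ?N \<le> (\<Sum>i<n. (?D i)\<^sup>2)"
    using nondeg unfolding design_nondegenerate_def design_row_def norm_pair_square by blast
  also have "\<dots> = (\<Sum>i\<in>bad. (?D i)\<^sup>2) + (\<Sum>i\<in>{..<n} - bad. (?D i)\<^sup>2)"
    using fin by (simp add: sum.subset_diff)
  finally have good: "\<kappa> * real n * ?N / 2 \<le> (\<Sum>i\<in>{..<n} - bad. (?D i)\<^sup>2)" using badsum by linarith
  have "(\<Sum>i<n. (if i \<in> bad then 0 else k0) / 2 * (?D i)\<^sup>2) = (\<Sum>i\<in>{..<n} - bad. k0 / 2 * (?D i)\<^sup>2)"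
    by (rule sum.mono_neutral_cong_right) (use fin in auto)
  then have eq: "(\<Sum>i<n. (if i \<in> bad then 0 else k0) / 2 * (?D i)\<^sup>2) = k0 / 2 * (\<Sum>i\<in>{..<n} - bad. (?D i)\<^sup>2)"
    by (simp only: sum_distrib_left)
  have "k0 / 2 * (\<kappa> * real n * ?N / 2) \<le> k0 / 2 * (\<Sum>i\<in>{..<n} - bad. (?D i)\<^sup>2)" by (rule mult_left_mono[OF good]) (use k0 in simp)
  then have curv: "k0 * \<kappa> / 4 * real n * ?N \<le> (\<Sum>i<n. (if i \<in> bad then 0 else k0) / 2 * (?D i)\<^sup>2)" unfolding eq by simp
  have "log_pseudo_likelihood n A t x y p \<le> (\<Sum>i<n. site_log_density n A y i (?h i)
      + residual n A ?h y i * ?D i - (if i \<in> bad then 0 else k0) / 2 * (?D i)\<^sup>2)"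
    unfolding log_pseudo_likelihood_def by (intro sum_mono site) simp
  also have "\<dots> = log_pseudo_likelihood n A t x y q + (\<Sum>i<n. residual n A ?h y i * ?D i)
      - (\<Sum>i<n. (if i \<in> bad then 0 else k0) / 2 * (?D i)\<^sup>2)"
    unfolding log_pseudo_likelihood_def by (simp only: sum.distrib sum_subtractf)
  finally show ?thesis using curv by linarith
qed

text \<open>Strong concavity, seen from the midpoint of two maximisers, shows that they coincide.  Seen from \<open>q\<close>, it
  bounds the square of the distance of the maximiser by the product of that distance and the gradient
  at \<open>q\<close>.\<close>

lemma pseudo_likelihood_maximiser:
  fixes x :: "nat \<Rightarrow> real ^ 'd"
  assumes n: "0 < n" and A: "sym_mat n A" and V: "0 < alpha_d2 \<nu> 0 0"
    and t: "\<forall>i<n. \<bar>t i\<bar> \<le> 1" and x: "\<forall>i<n. \<forall>k. \<bar>x i $ k\<bar> \<le> 1"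
    and diag: "\<forall>i<n. \<bar>A i i\<bar> \<le> Ka" and field: "(\<Sum>i<n. (local_field n A y i)\<^sup>2) \<le> Km * real n"
    and \<kappa>: "0 < \<kappa>" and nondeg: "design_nondegenerate n t x \<kappa>"
    and L: "0 < L" "4 * (real CARD('d))\<^sup>2 * Km \<le> \<kappa> * L\<^sup>2"
    and q: "q \<in> param_space B M0"
    and score_t: "\<bar>\<Sum>i<n. t i * residual n A (\<lambda>i. design_row t x i q) y i\<bar> \<le> \<eta> * real n"
    and score_x: "\<And>k. \<bar>\<Sum>i<n. x i $ k * residual n A (\<lambda>i. design_row t x i q) y i\<bar> \<le> \<eta> * real n"
  defines "k0 \<equiv> exp (- 2 * (L + (B + real CARD('d) * (real CARD('d) * M0))) - Ka) * alpha_d2 \<nu> 0 0"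
    and "maxi \<equiv> is_arg_max (pseudo_likelihood \<nu> n A t x y) (\<lambda>p. p \<in> param_space B M0)"
  shows "\<exists>!p. maxi p" and "maxi p \<Longrightarrow> dist p q \<le> (1 + real CARD('d)) * \<eta> / (k0 * \<kappa> / 4)"
proof -
  let ?l = "log_pseudo_likelihood n A t x y" and ?P = "param_space B M0"
  define c where "c = k0 * \<kappa> / 4"
  have c: "0 < c" unfolding c_def k0_def using V \<kappa> by simp
  have maxi: "maxi p \<longleftrightarrow> p \<in> ?P \<and> (\<forall>p'\<in>?P. ?l p' \<le> ?l p)" for p
    unfolding maxi_def is_arg_max_def pseudo_likelihood_eq[OF A] by (auto simp: not_less)
  note tangent = log_pseudo_likelihood_tangent[OF t x diag field nondeg L, where B = B and ?M0.0 = M0, folded k0_def, folded c_def]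
  have "\<exists>p\<in>?P. \<forall>p'\<in>?P. ?l p' \<le> ?l p"
    by (rule continuous_attains_sup[OF param_space_compact _ log_pseudo_likelihood_continuous]) (use q in auto)
  then obtain p where p: "maxi p" unfolding maxi by blast
  show "\<exists>!p. maxi p"
  proof (rule ex1I, rule p, rule ccontr)
    fix p' assume p': "maxi p'" and ne: "p' \<noteq> p"
    define m where "m = (1/2) *\<^sub>R (p + p')"
    have mP: "m \<in> ?P"
      unfolding m_def scaleR_right_distrib by (rule convexD[OF param_space_convex]) (use p p' maxi in auto)
    define e where "e = (1/2) *\<^sub>R (p - p')"
    have m2: "2 *\<^sub>R m = p + p'" and e2: "2 *\<^sub>R e = p - p'" by (simp_all add: m_def e_def)
    have "2 *\<^sub>R (p - m) = 2 *\<^sub>R e" "2 *\<^sub>R (p' - m) = 2 *\<^sub>R (- e)"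
      unfolding scaleR_right_diff_distrib scaleR_minus_right m2 e2 by (simp_all add: scaleR_2)
    then have e: "p - m = e" "p' - m = - e" by (metis scaleR_cancel_left zero_neq_numeral)+
    have "0 < norm e" using ne by (simp add: e_def)
    then have "0 < c * real n * (norm e)\<^sup>2" using c n by simp
    moreover have "?l p \<le> ?l m + (\<Sum>i<n. residual n A (\<lambda>i. design_row t x i m) y i * design_row t x i e) - c * real n * (norm e)\<^sup>2"
      using tangent[OF _ mP, of p] p maxi e by simp
    moreover have "?l p' \<le> ?l m - (\<Sum>i<n. residual n A (\<lambda>i. design_row t x i m) y i * design_row t x i e) - c * real n * (norm e)\<^sup>2"
      using tangent[OF _ mP, of p'] p' maxi e by (simp add: design_row_minus sum_negf)
    moreover have "?l m \<le> ?l p" "?l m \<le> ?l p'" using mP p p' maxi by auto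
    ultimately show False by linarith
  qed
  show "dist p q \<le> (1 + real CARD('d)) * \<eta> / (k0 * \<kappa> / 4)" if pm: "maxi p" for p
  proof -
    let ?r = "residual n A (\<lambda>i. design_row t x i q) y" and ?e = "p - q"
    have eta: "0 \<le> \<eta>" using order_trans[OF abs_ge_zero score_t] n by (simp add: zero_le_mult_iff)
    have "(\<Sum>i<n. ?r i * design_row t x i ?e) = fst ?e * (\<Sum>i<n. t i * ?r i) + (\<Sum>k\<in>UNIV. snd ?e $ k * (\<Sum>i<n. x i $ k * ?r i))"
      by (rule sum_design_row)
    also have "\<dots> \<le> norm ?e * (\<eta> * real n) + (\<Sum>k\<in>(UNIV::'d set). norm ?e * (\<eta> * real n))"
    proof (rule add_mono[OF _ sum_mono])
      have "\<bar>fst ?e\<bar> \<le> norm ?e" using norm_fst_le[of "fst ?e" "snd ?e"] by (simp del: fst_diff snd_diff)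
      from order_trans[OF abs_ge_self abs_mult_bound[OF this score_t]]
      show "fst ?e * (\<Sum>i<n. t i * ?r i) \<le> norm ?e * (\<eta> * real n)" .
      fix k
      have "\<bar>snd ?e $ k\<bar> \<le> norm ?e"
        using component_le_norm_cart[of "snd ?e" k] norm_snd_le[of "snd ?e" "fst ?e"] by (simp del: fst_diff snd_diff)
      from order_trans[OF abs_ge_self abs_mult_bound[OF this score_x]]
      show "snd ?e $ k * (\<Sum>i<n. x i $ k * ?r i) \<le> norm ?e * (\<eta> * real n)" .
    qed
    also have "\<dots> = real n * (((1 + real CARD('d)) * \<eta>) * norm ?e)" by (simp add: algebra_simps)
    finally have "?l p \<le> ?l q + real n * (((1 + real CARD('d)) * \<eta>) * norm ?e) - c * real n * (norm ?e)\<^sup>2"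
      using tangent[OF _ q, of p] pm maxi by (smt (verit))
    moreover have "?l q \<le> ?l p" using q pm maxi by auto
    ultimately have "0 \<le> real n * (((1 + real CARD('d)) * \<eta>) * norm ?e - c * (norm ?e)\<^sup>2)" by (simp add: algebra_simps)
    then have "0 \<le> ((1 + real CARD('d)) * \<eta>) * norm ?e - c * (norm ?e)\<^sup>2" using n by (simp add: zero_le_mult_iff)
    from le_of_quadratic_le[OF this c] eta show ?thesis by (simp add: dist_norm c_def)
  qed
qed

end

section \<open>Nondegeneracy of the design\<close>

text \<open>A minimiser of the quadratic form on the unit sphere is an eigenvector, so a lower bound on the
  eigenvalues of a symmetric matrix bounds its quadratic form.\<close>

lemma eigenvalues_bound_quadratic_form:
  fixes S :: "real ^ 'd ^ 'd"
  assumes sym: "transpose S = S" and eig: "\<And>\<kappa>. mat_eigenvalue S \<kappa> \<Longrightarrow> c \<le> \<kappa>"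
  shows "c * (norm b)\<^sup>2 \<le> b \<bullet> (S *v b)"
proof -
  define Q where "Q v = v \<bullet> (S *v v)" for v
  have lin: "linear ((*v) S)" by simp
  have cont: "continuous_on UNIV ((*v) S)" by (rule linear_continuous_on) (simp add: linear_linear)
  have "\<exists>v\<in>sphere (0::real^'d) 1. \<forall>w\<in>sphere 0 1. Q v \<le> Q w"
  proof (rule continuous_attains_inf)
    show "sphere (0::real^'d) 1 \<noteq> {}"
      using norm_axis_1[of undefined] by (metis mem_sphere_0 empty_iff)
    show "continuous_on (sphere 0 1) Q" unfolding Q_def
      by (intro continuous_intros continuous_on_subset[OF cont]) auto
  qed simp
  then obtain v where v: "norm v = 1" and min: "\<And>w. norm w = 1 \<Longrightarrow> Q v \<le> Q w" by auto
  have ge: "Q v * (norm w)\<^sup>2 \<le> Q w" for w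
  proof (cases "w = 0")
    case False
    have "Q v \<le> Q ((1 / norm w) *\<^sub>R w)" using False by (intro min) simp
    also have "\<dots> = Q w / (norm w)\<^sup>2"
      by (simp add: Q_def matrix_vector_mult_scaleR power2_eq_square)
    finally show ?thesis using False by (simp add: field_simps)
  qed (simp add: Q_def)
  have symm: "x \<bullet> (S *v y) = y \<bullet> (S *v x)" for x y
    using dot_lmul_matrix[of y S x] by (simp add: transpose_matrix_vector[symmetric] sym inner_commute)
  have orth: "w \<bullet> (S *v v - Q v *\<^sub>R v) = 0" for w
  proof -
    define e where "e = w \<bullet> (S *v v - Q v *\<^sub>R v)"
    define f where "f = Q w - Q v * (norm w)\<^sup>2"
    have f0: "0 \<le> f" using ge[of w] by (simp add: f_def)
    have quad: "0 \<le> 2 * s * e + s\<^sup>2 * f" for s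
    proof -
      have "0 \<le> Q (v + s *\<^sub>R w) - Q v * (norm (v + s *\<^sub>R w))\<^sup>2" using ge by simp
      also have "Q (v + s *\<^sub>R w) = Q v + 2 * s * (w \<bullet> (S *v v)) + s\<^sup>2 * Q w"
        using symm[of v w] by (simp add: Q_def matrix_vector_right_distrib matrix_vector_mult_scaleR inner_add_left inner_add_right power2_eq_square algebra_simps)
      also have "(norm (v + s *\<^sub>R w))\<^sup>2 = 1 + 2 * s * (w \<bullet> v) + s\<^sup>2 * (norm w)\<^sup>2"
        using v unfolding norm_eq_1 power2_norm_eq_inner
          by (simp add: inner_add_left inner_add_right inner_commute power2_eq_square algebra_simps)
      finally show ?thesis by (simp add: e_def f_def inner_diff_right algebra_simps)
    qed
    show ?thesis
    proof (rule ccontr)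
      assume "\<not> ?thesis"
      then have e: "e \<noteq> 0" by (simp add: e_def)
      define s where "s = - e / (f + 1)"
      have sf: "s * (f + 1) = - e" using f0 by (simp add: s_def)
      have "0 \<le> (2 * s * e + s\<^sup>2 * f) * (f + 1)\<^sup>2" using quad[of s] by simp
      also have "\<dots> = 2 * (s * (f + 1)) * e * (f + 1) + (s * (f + 1))\<^sup>2 * f"
        by (simp add: power2_eq_square algebra_simps)
      also have "\<dots> = - (e\<^sup>2 * (f + 2))" unfolding sf by (simp add: power2_eq_square algebra_simps)
      also have "\<dots> < 0" using e f0 by simp
      finally show False by simp
    qed
  qed
  have "S *v v - Q v *\<^sub>R v = 0" using orth[of "S *v v - Q v *\<^sub>R v"] by simp
  then have "mat_eigenvalue S (Q v)" using v unfolding mat_eigenvalue_def by (intro exI[of _ v]) auto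
  then have "c \<le> Q v" by (rule eig)
  then have "c * (norm b)\<^sup>2 \<le> Q v * (norm b)\<^sup>2" by (rule mult_right_mono) simp
  with ge[of b] show ?thesis by (simp add: Q_def)
qed

definition second_moment :: "(real ^ 'd) measure \<Rightarrow> 'd \<Rightarrow> 'd \<Rightarrow> real" where
  "second_moment PX k l = (\<integral>x. x $ k * x $ l \<partial>PX)"

text \<open>The second moment matrix exceeds the covariance matrix by a matrix of rank one.\<close>

lemma second_moment_pos:
  fixes PX :: "(real ^ 'd) measure"
  assumes PX: "covariate_law c C PX"
  shows "c * (norm b)\<^sup>2 \<le> (\<Sum>k\<in>UNIV. \<Sum>l\<in>UNIV. b $ k * second_moment PX k l * b $ l)"
proof -
  interpret prob_space PX by (rule covariate_lawD(1)[OF PX])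
  note [measurable_cong] = covariate_lawD(2)[OF PX]
  have ae: "AE x in PX. \<forall>k. \<bar>x $ k\<bar> \<le> 1" by (rule covariate_lawD(3)[OF PX])
  have i1: "integrable PX (\<lambda>x. x $ k)" for k
    by (rule integrable_const_bound[where B = 1]) (use ae in auto)
  have i2: "integrable PX (\<lambda>x. x $ k * x $ l)" for k l
  proof (rule integrable_const_bound[where B = "1 * 1"])
    show "AE x in PX. norm (x $ k * x $ l) \<le> 1 * 1"
      using ae unfolding real_norm_def by eventually_elim (intro abs_mult_bound, auto)
  qed simp
  define m where "m k = (\<integral>x. x $ k \<partial>PX)" for k
  let ?S = "covariance_matrix PX"
  have S: "?S $ k $ l = second_moment PX k l - m k * m l" for k l
  proof -
    have "?S $ k $ l = (\<integral>x. x $ k * x $ l - m l * x $ k - m k * x $ l + m k * m l \<partial>PX)"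
      unfolding covariance_matrix_def by (simp add: m_def algebra_simps)
    also have "\<dots> = second_moment PX k l - m l * m k - m k * m l + m k * m l"
      using i1 i2 by (simp add: second_moment_def m_def prob_space)
    finally show ?thesis by simp
  qed
  have "transpose ?S = ?S" by (simp add: transpose_def vec_eq_iff S second_moment_def mult.commute)
  moreover have "c \<le> \<kappa>" if "mat_eigenvalue ?S \<kappa>" for \<kappa> using PX that by (auto simp: covariate_law_def)
  ultimately have "c * (norm b)\<^sup>2 \<le> b \<bullet> (?S *v b)" by (rule eigenvalues_bound_quadratic_form)
  also have "\<dots> = (\<Sum>k\<in>UNIV. \<Sum>l\<in>UNIV. b $ k * ?S $ k $ l * b $ l)"
    by (simp add: inner_vec_def matrix_vector_mult_def sum_distrib_left mult_ac)
  also have "\<dots> = (\<Sum>k\<in>UNIV. \<Sum>l\<in>UNIV. b $ k * second_moment PX k l * b $ l) - (\<Sum>k\<in>UNIV. b $ k * m k) * (\<Sum>l\<in>UNIV. b $ l * m l)"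
    unfolding S sum_product by (simp add: algebra_simps sum_subtractf)
  also have "\<dots> \<le> (\<Sum>k\<in>UNIV. \<Sum>l\<in>UNIV. b $ k * second_moment PX k l * b $ l)" by simp
  finally show ?thesis .
qed

lemma local_field_square_sum_le:
  assumes A: "bounded_matrix n A K" and y: "\<forall>i<n. \<bar>y i\<bar> \<le> 1"
  shows "(\<Sum>i<n. (local_field n A y i)\<^sup>2) \<le> 4 * K\<^sup>2 * real n"
proof -
  have K: "0 \<le> K" using A by (simp add: bounded_matrix_def)
  have "L2_set y {..<n} \<le> L2_set (\<lambda>i. 1) {..<n}" by (rule L2_set_mono_abs) (use y in auto)
  then have "L2_set (mat_vec n A y) {..<n} \<le> K * sqrt (real n)"
    using L2_set_mat_vec_le[OF A, of y] K by (simp add: L2_set_const) (meson mult_left_mono order_trans)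
  then have "(L2_set (mat_vec n A y) {..<n})\<^sup>2 \<le> (K * sqrt (real n))\<^sup>2" by (intro power_mono) auto
  then have 1: "(\<Sum>i<n. (mat_vec n A y i)\<^sup>2) \<le> K\<^sup>2 * real n"
    by (simp add: L2_set_def sum_nonneg power_mult_distrib)
  have 2: "(\<Sum>i<n. (A i i * y i)\<^sup>2) \<le> (\<Sum>i<n. K\<^sup>2)"
  proof (rule sum_mono)
    fix i assume i: "i \<in> {..<n}"
    have "\<bar>A i i * y i\<bar> \<le> K * 1" using bounded_matrix_entry[OF A] y i by (intro abs_mult_bound) auto
    then show "(A i i * y i)\<^sup>2 \<le> K\<^sup>2" using K by (simp add: abs_le_square_iff[symmetric])
  qed
  have "(\<Sum>i<n. (local_field n A y i)\<^sup>2) \<le> (\<Sum>i<n. 2 * (mat_vec n A y i)\<^sup>2 + 2 * (A i i * y i)\<^sup>2)"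
  proof (rule sum_mono)
    fix i assume "i \<in> {..<n}"
    then have "local_field n A y i = mat_vec n A y i - A i i * y i" by (simp add: local_field_eq)
    moreover have "(p - q)\<^sup>2 \<le> 2 * p\<^sup>2 + 2 * q\<^sup>2" for p q :: real
      using zero_le_power2[of "p + q"] by (simp add: power2_sum power2_diff)
    ultimately show "(local_field n A y i)\<^sup>2 \<le> 2 * (mat_vec n A y i)\<^sup>2 + 2 * (A i i * y i)\<^sup>2" by simp
  qed
  also have "\<dots> = 2 * (\<Sum>i<n. (mat_vec n A y i)\<^sup>2) + 2 * (\<Sum>i<n. (A i i * y i)\<^sup>2)"
    by (simp add: sum.distrib sum_distrib_left)
  finally show ?thesis using 1 2 by (simp add: mult.commute)
qed

lemma rademacher_variance: "alpha_d2 rademacher a b = 1 - (alpha_d1 rademacher a b)\<^sup>2"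
proof -
  interpret R: interval_law rademacher by (rule interval_law_rademacher)
  have "tilt_moment rademacher 2 a b = tilt_moment rademacher 0 a b"
    unfolding tilt_moment_def
    by (rule integral_cong_AE) (use AE_rademacher in \<open>auto elim!: eventually_mono\<close>)
  then have "tilt_mean rademacher 2 a b = 1" by (simp add: tilt_mean_def)
  then show ?thesis by (simp add: R.alpha_d2_eq R.alpha_d1_eq)
qed

lemma rademacher_variance_0: "alpha_d2 rademacher 0 0 = 1"
proof -
  interpret R: interval_law rademacher by (rule interval_law_rademacher)
  have "(\<integral>x. x \<partial>rademacher) = (\<integral>x. x \<partial>measure_pmf (pmf_of_set {-1, 1::real}))"
    unfolding rademacher_def by (simp add: integral_distr)
  also have "\<dots> = 0" by (subst integral_pmf_of_set) auto
  finally show ?thesis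
    unfolding rademacher_variance by (simp add: R.alpha_d1_eq tilt_mean_def tilt_moment_def)
qed

text \<open>A lower bound for the conditional variance of a treatment whose local field is at most \<open>3 K + 1\<close> and
  whose external field is at most \<open>H\<close>.  The mean square of the local fields is at most
  \<open>4 K\<^sup>2 \<le> (3 K + 1)\<^sup>2 / 2\<close>, so at least half of the sites qualify.\<close>

definition design_curvature :: "real \<Rightarrow> real \<Rightarrow> real" where
  "design_curvature K H = exp (- 2 * ((3 * K + 1) + H) - K)"

text \<open>With \<open>p\<^sub>i\<close> the conditional mean of \<open>t\<^sub>i\<close> and \<open>b\<^sub>i = x\<^sub>i \<bullet> b\<close>,
  \<open>(a t\<^sub>i + b\<^sub>i)\<^sup>2 = a\<^sup>2 (1 - p\<^sub>i\<^sup>2) + (a p\<^sub>i + b\<^sub>i)\<^sup>2 + 2 a b\<^sub>i (t\<^sub>i - p\<^sub>i)\<close>.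
  The residuals average out against the covariates, and most of the conditional variances are bounded
  below; this gives the \<open>a\<^sup>2\<close> part for an interaction matrix of any size.  The \<open>b\<close> part then comes from
  the second moments of the covariates.\<close>

lemma design_nondegenerate_if:
  fixes x :: "nat \<Rightarrow> real ^ 'd" and S :: "'d \<Rightarrow> 'd \<Rightarrow> real"
  assumes t: "\<forall>i<n. t i = 1 \<or> t i = -1" and M: "bounded_matrix n M K"
    and h: "\<forall>i<n. \<bar>h i\<bar> \<le> H"
    and score: "\<And>k. \<bar>\<Sum>i<n. x i $ k * interval_law.residual rademacher n M h t i\<bar> \<le> \<eta> * real n"
    and lln: "\<And>k l. \<bar>(\<Sum>i<n. x i $ k * x i $ l - S k l)\<bar> \<le> \<eta> * real n"
    and S: "\<And>b. c * (norm b)\<^sup>2 \<le> (\<Sum>k\<in>UNIV. \<Sum>l\<in>UNIV. b $ k * S k l * b $ l)"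
    and c: "0 < c" and \<kappa>0: "\<kappa>0 \<le> design_curvature K H / 4" "\<kappa>0 \<le> design_curvature K H * c / 8" "0 < \<kappa>0"
    and \<eta>: "4 * (real CARD('d))\<^sup>2 * \<eta> \<le> \<kappa>0" "0 \<le> \<eta>"
  shows "design_nondegenerate n t x (\<kappa>0 / 4)"
  unfolding design_nondegenerate_def
proof (intro allI)
  fix a :: real and b :: "real ^ 'd"
  interpret R: interval_law rademacher by (rule interval_law_rademacher)
  define m where "m = local_field n M t"
  define p where "p i = alpha_d1 rademacher (m i + h i) (M i i)" for i
  define r where "r i = R.residual n M h t i" for i
  have r: "r i = t i - p i" for i by (simp add: r_def R.residual_def p_def m_def)
  let ?d = "real CARD('d)"
  let ?N = "a\<^sup>2 + (norm b)\<^sup>2"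
  define L where "L = 3 * K + 1"
  define k1 where "k1 = design_curvature K H"
  have K: "0 \<le> K" using M by (simp add: bounded_matrix_def)
  have k1: "0 < k1" by (simp add: k1_def design_curvature_def)
  have t1: "\<forall>i<n. \<bar>t i\<bar> \<le> 1" and t2: "\<forall>i<n. (t i)\<^sup>2 = 1" using t by auto
  define bad where "bad = {i \<in> {..<n}. L < \<bar>m i\<bar>}"
  have fin: "finite bad" "bad \<subseteq> {..<n}" by (auto simp: bad_def)
  have "real (card bad) * L\<^sup>2 = (\<Sum>i\<in>bad. L\<^sup>2)" by simp
  also have "\<dots> \<le> (\<Sum>i\<in>bad. (m i)\<^sup>2)"
    using K by (intro sum_mono) (auto simp: bad_def L_def abs_le_square_iff[symmetric])
  also have "\<dots> \<le> (\<Sum>i<n. (m i)\<^sup>2)" using fin by (intro sum_mono2) auto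
  also have "\<dots> \<le> 4 * K\<^sup>2 * real n" unfolding m_def by (rule local_field_square_sum_le[OF M t1])
  also have "\<dots> \<le> (L\<^sup>2 / 2) * real n"
    using K by (intro mult_right_mono) (auto simp: L_def power2_eq_square algebra_simps intro: add_nonneg_nonneg)
  finally have "real (card bad) * L\<^sup>2 \<le> (real n / 2) * L\<^sup>2" by (simp add: mult.commute)
  then have card: "real (card bad) \<le> real n / 2" using K by (simp add: L_def)
  have var: "k1 \<le> 1 - (p i)\<^sup>2" if i: "i \<in> {..<n} - bad" for i
  proof -
    have "\<bar>m i + h i\<bar> \<le> L + H" using h i by (auto simp: bad_def not_less intro: order_trans[OF abs_triangle_ineq add_mono])
    moreover have "\<bar>M i i\<bar> \<le> K" using bounded_matrix_entry[OF M] i by auto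
    ultimately have "k1 \<le> exp (- 2 * \<bar>m i + h i\<bar> - \<bar>M i i\<bar>) * alpha_d2 rademacher 0 0"
      by (simp add: k1_def design_curvature_def L_def rademacher_variance_0)
    also have "\<dots> \<le> alpha_d2 rademacher (m i + h i) (M i i)" by (rule R.alpha_d2_ge)
    finally show ?thesis by (simp add: rademacher_variance p_def)
  qed
  have p1: "0 \<le> 1 - (p i)\<^sup>2" for i unfolding p_def rademacher_variance[symmetric] by (rule R.alpha_d2_nonneg)
  have "(real n / 2) * k1 \<le> (\<Sum>i\<in>{..<n} - bad. k1)"
    using card fin k1 by (simp add: card_Diff_subset of_nat_diff card_mono[of "{..<n}", simplified] mult_right_mono)
  also have "\<dots> \<le> (\<Sum>i\<in>{..<n} - bad. 1 - (p i)\<^sup>2)" by (intro sum_mono var)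
  also have "\<dots> \<le> (\<Sum>i<n. 1 - (p i)\<^sup>2)" using p1 by (intro sum_mono2) auto
  finally have "a\<^sup>2 * ((real n / 2) * k1) \<le> a\<^sup>2 * (\<Sum>i<n. 1 - (p i)\<^sup>2)" by (rule mult_left_mono) simp
  then have apart: "a\<^sup>2 * k1 / 2 * real n \<le> (\<Sum>i<n. a\<^sup>2 * (1 - (p i)\<^sup>2))" by (simp add: sum_distrib_left mult_ac)
  define T where "T = (\<Sum>i<n. (a * t i + x i \<bullet> b)\<^sup>2)"
  have bk: "\<bar>b $ k\<bar> \<le> norm b" for k by (rule component_le_norm_cart)
  have ab: "2 * (\<bar>a\<bar> * norm b) \<le> ?N" using sum_squares_bound[of "\<bar>a\<bar>" "norm b"] by simp
  have cross: "\<bar>\<Sum>i<n. 2 * a * (x i \<bullet> b) * r i\<bar> \<le> ?d * \<eta> * ?N * real n"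
  proof -
    have "(\<Sum>i<n. 2 * a * (x i \<bullet> b) * r i) = (2 * a) * (\<Sum>k\<in>UNIV. b $ k * (\<Sum>i<n. x i $ k * r i))"
    proof -
      have "(\<Sum>i<n. 2 * a * (x i \<bullet> b) * r i) = (2 * a) * (\<Sum>i<n. r i * design_row t x i (0, b))"
        by (simp add: design_row_def sum_distrib_left mult_ac)
      then show ?thesis unfolding sum_design_row by simp
    qed
    also have "\<bar>\<dots>\<bar> \<le> (2 * \<bar>a\<bar>) * (\<Sum>k\<in>(UNIV::'d set). norm b * (\<eta> * real n))"
      by (rule abs_mult_bound, simp, rule order_trans[OF sum_abs sum_mono], rule abs_mult_bound[OF bk score[folded r_def]])
    also have "\<dots> = (2 * (\<bar>a\<bar> * norm b)) * (?d * \<eta> * real n)" by simp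
    also have "\<dots> \<le> ?N * (?d * \<eta> * real n)" using ab \<eta> by (intro mult_right_mono) auto
    finally show ?thesis by (simp add: mult_ac)
  qed
  have "(\<Sum>i<n. a\<^sup>2 * (1 - (p i)\<^sup>2)) + (\<Sum>i<n. 2 * a * (x i \<bullet> b) * r i) \<le> T"
    unfolding T_def sum.distrib[symmetric]
  proof (rule sum_mono)
    fix i assume "i \<in> {..<n}"
    then have "(a * t i + x i \<bullet> b)\<^sup>2 = a\<^sup>2 * (1 - (p i)\<^sup>2) + (a * p i + x i \<bullet> b)\<^sup>2 + 2 * a * (x i \<bullet> b) * r i"
      using t2 unfolding r by (simp add: power2_sum power_mult_distrib algebra_simps)
    then show "a\<^sup>2 * (1 - (p i)\<^sup>2) + 2 * a * (x i \<bullet> b) * r i \<le> (a * t i + x i \<bullet> b)\<^sup>2" by simp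
  qed
  with apart cross have T1: "a\<^sup>2 * k1 / 2 * real n - ?d * \<eta> * ?N * real n \<le> T" by linarith
  have T2: "(c - ?d\<^sup>2 * \<eta>) * (norm b)\<^sup>2 / 2 * real n - a\<^sup>2 * real n \<le> T"
  proof -
    define V where "V = (\<Sum>i<n. (x i \<bullet> b)\<^sup>2)"
    have "V = (\<Sum>i<n. \<Sum>k\<in>UNIV. \<Sum>l\<in>UNIV. b $ k * (x i $ k * x i $ l) * b $ l)"
      unfolding V_def power2_eq_square inner_vec_def sum_product by (simp add: mult_ac)
    also have "\<dots> = (\<Sum>i<n. \<Sum>k\<in>UNIV. \<Sum>l\<in>UNIV. b $ k * S k l * b $ l) +
        (\<Sum>i<n. \<Sum>k\<in>UNIV. \<Sum>l\<in>UNIV. (b $ k * b $ l) * (x i $ k * x i $ l - S k l))"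
      unfolding sum.distrib[symmetric] by (simp add: algebra_simps)
    also have "(\<Sum>i<n. \<Sum>k\<in>UNIV. \<Sum>l\<in>UNIV. (b $ k * b $ l) * (x i $ k * x i $ l - S k l))
        = (\<Sum>k\<in>UNIV. \<Sum>l\<in>UNIV. (b $ k * b $ l) * (\<Sum>i<n. x i $ k * x i $ l - S k l))"
      unfolding sum_distrib_left
      by (subst sum.swap, rule sum.cong[OF refl], subst sum.swap, rule refl)
    finally have V: "V = real n * (\<Sum>k\<in>UNIV. \<Sum>l\<in>UNIV. b $ k * S k l * b $ l) +
        (\<Sum>k\<in>UNIV. \<Sum>l\<in>UNIV. (b $ k * b $ l) * (\<Sum>i<n. x i $ k * x i $ l - S k l))" by simp
    have "\<bar>\<Sum>k\<in>UNIV. \<Sum>l\<in>UNIV. (b $ k * b $ l) * (\<Sum>i<n. x i $ k * x i $ l - S k l)\<bar>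
       \<le> (\<Sum>k\<in>(UNIV::'d set). \<Sum>l\<in>(UNIV::'d set). (norm b * norm b) * (\<eta> * real n))"
    proof (rule order_trans[OF sum_abs sum_mono], rule order_trans[OF sum_abs sum_mono])
      fix k l
      show "\<bar>(b $ k * b $ l) * (\<Sum>i<n. x i $ k * x i $ l - S k l)\<bar> \<le> (norm b * norm b) * (\<eta> * real n)"
        by (rule abs_mult_bound[OF abs_mult_bound[OF bk bk] lln])
    qed
    also have "\<dots> = ?d\<^sup>2 * \<eta> * (norm b)\<^sup>2 * real n" by (simp add: power2_eq_square mult_ac)
    finally have "real n * (\<Sum>k\<in>UNIV. \<Sum>l\<in>UNIV. b $ k * S k l * b $ l) - ?d\<^sup>2 * \<eta> * (norm b)\<^sup>2 * real n \<le> V"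
      unfolding V by linarith
    moreover have "real n * (c * (norm b)\<^sup>2) \<le> real n * (\<Sum>k\<in>UNIV. \<Sum>l\<in>UNIV. b $ k * S k l * b $ l)"
      by (rule mult_left_mono[OF S]) simp
    ultimately have "(c - ?d\<^sup>2 * \<eta>) * (norm b)\<^sup>2 * real n \<le> V" by (simp add: algebra_simps)
    moreover have "V \<le> (\<Sum>i<n. 2 * (a * t i + x i \<bullet> b)\<^sup>2 + 2 * a\<^sup>2)"
      unfolding V_def
    proof (rule sum_mono)
      fix i assume i: "i \<in> {..<n}"
      have "(v::real)\<^sup>2 \<le> 2 * (u + v)\<^sup>2 + 2 * u\<^sup>2" for u v
        using zero_le_power2[of "2 * u + v"] by (simp add: power2_sum power_mult_distrib)
      from this[of "x i \<bullet> b" "a * t i"] show "(x i \<bullet> b)\<^sup>2 \<le> 2 * (a * t i + x i \<bullet> b)\<^sup>2 + 2 * a\<^sup>2"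
        using t2 i by (simp add: power_mult_distrib)
    qed
    moreover have "\<dots> = 2 * T + 2 * a\<^sup>2 * real n" by (simp add: T_def sum.distrib sum_distrib_left)
    ultimately show ?thesis by simp
  qed
  \<comment> \<open>Add \<open>T1\<close> and \<open>k1 / 4\<close> times \<open>T2\<close>: the loss of \<open>a\<^sup>2\<close> in \<open>T2\<close> then uses up half of the gain in \<open>T1\<close>.\<close>
  show "\<kappa>0 / 4 * real n * ?N \<le> (\<Sum>i<n. (a * t i + x i \<bullet> b)\<^sup>2)"
  proof (cases "n = 0")
    case False
    define Z where "Z = T / real n"
    have n: "0 < real n" using False by simp
    have Tz: "T = Z * real n" using False by (simp add: Z_def)
    have Z1: "a\<^sup>2 * k1 / 2 - ?d * \<eta> * ?N \<le> Z" using T1 n unfolding Tz left_diff_distrib[symmetric] by simp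
    have Z2: "(c - ?d\<^sup>2 * \<eta>) * (norm b)\<^sup>2 / 2 - a\<^sup>2 \<le> Z" using T2 n unfolding Tz left_diff_distrib[symmetric] by simp
    have Z0: "0 \<le> Z" unfolding Z_def T_def by (intro divide_nonneg_nonneg sum_nonneg) auto
    have k1le: "k1 \<le> 1"
    proof -
      have "k1 \<le> exp 0" unfolding k1_def design_curvature_def using K
        by (cases "n = 0") (use False h in \<open>auto intro: order_trans[OF abs_ge_zero]\<close>)
      then show ?thesis by simp
    qed
    have d1: "1 \<le> ?d" by simp
    have de: "?d * \<eta> \<le> ?d\<^sup>2 * \<eta>" unfolding power2_eq_square using d1 \<eta>(2) by (intro mult_right_mono) auto
    have dsmall: "?d\<^sup>2 * \<eta> \<le> \<kappa>0 / 4" using \<eta>(1) by simp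
    have "k1 / 4 * ((c - ?d\<^sup>2 * \<eta>) * (norm b)\<^sup>2 / 2 - a\<^sup>2) \<le> k1 / 4 * Z" by (rule mult_left_mono[OF Z2]) (use k1 in simp)
    also have "\<dots> \<le> 1 / 4 * Z" using k1le Z0 by (intro mult_right_mono) auto
    finally have "k1 / 4 * ((c - ?d\<^sup>2 * \<eta>) * (norm b)\<^sup>2 / 2 - a\<^sup>2) + (a\<^sup>2 * k1 / 2 - ?d * \<eta> * ?N) \<le> 5 / 4 * Z"
      using Z1 by linarith
    moreover have "k1 / 4 * ((c - ?d\<^sup>2 * \<eta>) * (norm b)\<^sup>2 / 2 - a\<^sup>2) + (a\<^sup>2 * k1 / 2 - ?d * \<eta> * ?N)
       = k1 / 4 * a\<^sup>2 + k1 * c / 8 * (norm b)\<^sup>2 - k1 * (?d\<^sup>2 * \<eta>) * (norm b)\<^sup>2 / 8 - ?d * \<eta> * ?N"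
      by (simp add: field_simps)
    moreover have "\<kappa>0 * a\<^sup>2 \<le> k1 / 4 * a\<^sup>2" "\<kappa>0 * (norm b)\<^sup>2 \<le> k1 * c / 8 * (norm b)\<^sup>2"
      by (rule mult_right_mono[OF \<kappa>0(1)[folded k1_def]], simp) (rule mult_right_mono[OF \<kappa>0(2)[folded k1_def]], simp)
    moreover have "k1 * (?d\<^sup>2 * \<eta>) * (norm b)\<^sup>2 / 8 \<le> \<kappa>0 / 4 * ?N"
    proof -
      have "k1 * (?d\<^sup>2 * \<eta>) * (norm b)\<^sup>2 \<le> 1 * (\<kappa>0 / 4) * ?N"
        using k1 k1le dsmall \<eta>(2) \<kappa>0 by (intro mult_mono) auto
      moreover have "0 \<le> \<kappa>0 / 4 * ?N" using \<kappa>0 by simp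
      ultimately show ?thesis by linarith
    qed
    moreover have "?d * \<eta> * ?N \<le> \<kappa>0 / 4 * ?N" using de dsmall by (intro mult_right_mono) auto
    ultimately have "\<kappa>0 * a\<^sup>2 + \<kappa>0 * (norm b)\<^sup>2 - \<kappa>0 / 4 * ?N - \<kappa>0 / 4 * ?N \<le> 5 / 4 * Z" by linarith
    then have "\<kappa>0 / 2 * ?N \<le> 5 / 4 * Z" by (simp add: field_simps)
    then have "\<kappa>0 / 4 * ?N \<le> Z" using Z0 by simp
    then have "(\<kappa>0 / 4 * ?N) * real n \<le> Z * real n" by (rule mult_right_mono) simp
    then show ?thesis unfolding T_def[symmetric] Tz by (simp add: mult_ac)
  qed simp
qed

section \<open>The law of the sample\<close>

lemma AE_pair_snd:
  assumes "prob_space N1" "prob_space N2" and ae: "AE y in N2. Q y"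
  shows "AE z in N1 \<Otimes>\<^sub>M N2. Q (snd z)"
proof -
  interpret N1: prob_space N1 by fact
  interpret N2: prob_space N2 by fact
  obtain E where E: "{y \<in> space N2. \<not> Q y} \<subseteq> E" "E \<in> sets N2" "emeasure N2 E = 0" using ae by (rule AE_E)
  show ?thesis
  proof (rule AE_I)
    show "{z \<in> space (N1 \<Otimes>\<^sub>M N2). \<not> Q (snd z)} \<subseteq> space N1 \<times> E" using E(1) by (auto simp: space_pair_measure)
    show "emeasure (N1 \<Otimes>\<^sub>M N2) (space N1 \<times> E) = 0"
      using E by (simp add: N2.emeasure_pair_measure_Times)
  qed (use E in auto)
qed

lemma AE_pair_fst:
  assumes "prob_space N1" "prob_space N2" and ae: "AE x in N1. Q x"
  shows "AE z in N1 \<Otimes>\<^sub>M N2. Q (fst z)"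
proof -
  interpret N1: prob_space N1 by fact
  interpret N2: prob_space N2 by fact
  obtain E where E: "{x \<in> space N1. \<not> Q x} \<subseteq> E" "E \<in> sets N1" "emeasure N1 E = 0" using ae by (rule AE_E)
  show ?thesis
  proof (rule AE_I)
    show "{z \<in> space (N1 \<Otimes>\<^sub>M N2). \<not> Q (fst z)} \<subseteq> E \<times> space N2" using E(1) by (auto simp: space_pair_measure)
    show "emeasure (N1 \<Otimes>\<^sub>M N2) (E \<times> space N2) = 0"
      using E by (simp add: N2.emeasure_pair_measure_Times)
  qed (use E in auto)
qed

text \<open>Integration against a density that is a product of successive conditional densities.\<close>

lemma nn_integral_successive_densities:
  fixes u :: "'x \<Rightarrow> 't \<Rightarrow> real" and v :: "'a \<Rightarrow> 'x \<Rightarrow> 't \<Rightarrow> 'y \<Rightarrow> real"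
    and g :: "'a \<Rightarrow> 'x \<Rightarrow> 't \<Rightarrow> 'y \<Rightarrow> ennreal" and N5 :: "'b measure"
  assumes N: "prob_space N1" "prob_space N2" "prob_space N3" "prob_space N4" "prob_space N5"
    and u: "(\<lambda>(x, t). u x t) \<in> borel_measurable (N2 \<Otimes>\<^sub>M N3)" "\<And>x t. 0 \<le> u x t"
    and v: "(\<lambda>(a, x, t, y). v a x t y) \<in> borel_measurable (N1 \<Otimes>\<^sub>M N2 \<Otimes>\<^sub>M N3 \<Otimes>\<^sub>M N4)" "\<And>a x t y. 0 \<le> v a x t y"
    and g: "(\<lambda>(a, x, t, y). g a x t y) \<in> borel_measurable (N1 \<Otimes>\<^sub>M N2 \<Otimes>\<^sub>M N3 \<Otimes>\<^sub>M N4)"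
  shows "(\<integral>\<^sup>+(a, x, t, y, w). g a x t y \<partial>density (N1 \<Otimes>\<^sub>M N2 \<Otimes>\<^sub>M N3 \<Otimes>\<^sub>M N4 \<Otimes>\<^sub>M N5) (\<lambda>(a, x, t, y, w). ennreal (u x t * v a x t y)))
    = (\<integral>\<^sup>+a. \<integral>\<^sup>+x. \<integral>\<^sup>+t. ennreal (u x t) * (\<integral>\<^sup>+y. ennreal (v a x t y) * g a x t y \<partial>N4) \<partial>N3 \<partial>N2 \<partial>N1)"
proof -
  interpret N1: prob_space N1 by fact
  interpret N2: prob_space N2 by fact
  interpret N3: prob_space N3 by fact
  interpret N4: prob_space N4 by fact
  interpret N5: prob_space N5 by fact
  interpret N45: prob_space "N4 \<Otimes>\<^sub>M N5" by (intro prob_space_pair N)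
  interpret N345: prob_space "N3 \<Otimes>\<^sub>M N4 \<Otimes>\<^sub>M N5" by (intro prob_space_pair N)
  interpret N2345: prob_space "N2 \<Otimes>\<^sub>M N3 \<Otimes>\<^sub>M N4 \<Otimes>\<^sub>M N5" by (intro prob_space_pair N)
  let ?B = "N1 \<Otimes>\<^sub>M N2 \<Otimes>\<^sub>M N3 \<Otimes>\<^sub>M N4 \<Otimes>\<^sub>M N5"
  define U where "U z = u (fst (snd z)) (fst (snd (snd z)))" for z :: "'a \<times> 'x \<times> 't \<times> 'y \<times> 'b"
  define V where "V z = v (fst z) (fst (snd z)) (fst (snd (snd z))) (fst (snd (snd (snd z))))" for z :: "'a \<times> 'x \<times> 't \<times> 'y \<times> 'b"
  define G where "G z = g (fst z) (fst (snd z)) (fst (snd (snd z))) (fst (snd (snd (snd z))))" for z :: "'a \<times> 'x \<times> 't \<times> 'y \<times> 'b"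
  have proj2: "(\<lambda>z. (fst (snd z), fst (snd (snd z)))) \<in> measurable ?B (N2 \<Otimes>\<^sub>M N3)" by measurable
  have proj4: "(\<lambda>z. (fst z, fst (snd z), fst (snd (snd z)), fst (snd (snd (snd z))))) \<in> measurable ?B (N1 \<Otimes>\<^sub>M N2 \<Otimes>\<^sub>M N3 \<Otimes>\<^sub>M N4)" by measurable
  have Um: "U \<in> borel_measurable ?B" using measurable_compose[OF proj2 u(1)] by (simp add: U_def[abs_def])
  have Vm: "V \<in> borel_measurable ?B" using measurable_compose[OF proj4 v(1)] by (simp add: V_def[abs_def])
  have Gm: "G \<in> borel_measurable ?B" using measurable_compose[OF proj4 g] by (simp add: G_def[abs_def])
  define F where "F z = ennreal (U z * V z) * G z" for z
  have dm: "(\<lambda>z. ennreal (U z * V z)) \<in> borel_measurable ?B"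
    by (intro measurable_compose[OF _ measurable_ennreal] borel_measurable_times Um Vm)
  have Fm: "F \<in> borel_measurable ?B" unfolding F_def by (intro borel_measurable_times_ennreal dm Gm)
  have "(\<integral>\<^sup>+(a, x, t, y, w). g a x t y \<partial>density ?B (\<lambda>(a, x, t, y, w). ennreal (u x t * v a x t y)))
      = (\<integral>\<^sup>+z. G z \<partial>density ?B (\<lambda>z. ennreal (U z * V z)))"
    by (simp add: U_def V_def G_def case_prod_beta')
  also have "\<dots> = integral\<^sup>N ?B F" unfolding nn_integral_density[OF dm Gm] F_def ..
  also have "\<dots> = (\<integral>\<^sup>+a. \<integral>\<^sup>+z. F (a, z) \<partial>(N2 \<Otimes>\<^sub>M N3 \<Otimes>\<^sub>M N4 \<Otimes>\<^sub>M N5) \<partial>N1)"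
    by (rule N2345.nn_integral_fst[symmetric, OF Fm])
  also have "\<dots> = (\<integral>\<^sup>+a. \<integral>\<^sup>+x. \<integral>\<^sup>+z. F (a, x, z) \<partial>(N3 \<Otimes>\<^sub>M N4 \<Otimes>\<^sub>M N5) \<partial>N2 \<partial>N1)"
    by (intro nn_integral_cong N345.nn_integral_fst[symmetric] measurable_Pair2[OF Fm]) simp
  also have "\<dots> = (\<integral>\<^sup>+a. \<integral>\<^sup>+x. \<integral>\<^sup>+t. \<integral>\<^sup>+z. F (a, x, t, z) \<partial>(N4 \<Otimes>\<^sub>M N5) \<partial>N3 \<partial>N2 \<partial>N1)"
    by (intro nn_integral_cong N45.nn_integral_fst[symmetric] measurable_Pair2[OF measurable_Pair2[OF Fm]]) simp_all
  also have "\<dots> = (\<integral>\<^sup>+a. \<integral>\<^sup>+x. \<integral>\<^sup>+t. \<integral>\<^sup>+y. \<integral>\<^sup>+w. F (a, x, t, y, w) \<partial>N5 \<partial>N4 \<partial>N3 \<partial>N2 \<partial>N1)"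
    by (intro nn_integral_cong N5.nn_integral_fst[symmetric] measurable_Pair2[OF measurable_Pair2[OF measurable_Pair2[OF Fm]]]) simp_all
  also have "\<dots> = (\<integral>\<^sup>+a. \<integral>\<^sup>+x. \<integral>\<^sup>+t. ennreal (u x t) * (\<integral>\<^sup>+y. ennreal (v a x t y) * g a x t y \<partial>N4) \<partial>N3 \<partial>N2 \<partial>N1)"
  proof (intro nn_integral_cong)
    fix a x t assume sp: "a \<in> space N1" "x \<in> space N2" "t \<in> space N3"
    have [measurable]: "(\<lambda>y. v a x t y) \<in> borel_measurable N4"
      using measurable_Pair2[OF measurable_Pair2[OF measurable_Pair2[OF v(1) sp(1)] sp(2)] sp(3)] by simp
    have [measurable]: "(\<lambda>y. g a x t y) \<in> borel_measurable N4"
      using measurable_Pair2[OF measurable_Pair2[OF measurable_Pair2[OF g sp(1)] sp(2)] sp(3)] by simp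
    have "(\<integral>\<^sup>+y. \<integral>\<^sup>+w. F (a, x, t, y, w) \<partial>N5 \<partial>N4) = (\<integral>\<^sup>+y. ennreal (u x t) * (ennreal (v a x t y) * g a x t y) \<partial>N4)"
      by (simp add: F_def U_def V_def G_def ennreal_mult u v N5.emeasure_space_1 mult.assoc)
    also have "\<dots> = ennreal (u x t) * (\<integral>\<^sup>+y. ennreal (v a x t y) * g a x t y \<partial>N4)"
      by (rule nn_integral_cmult) measurable
    finally show "(\<integral>\<^sup>+y. \<integral>\<^sup>+w. F (a, x, t, y, w) \<partial>N5 \<partial>N4) = ennreal (u x t) * (\<integral>\<^sup>+y. ennreal (v a x t y) * g a x t y \<partial>N4)" .
  qed
  finally show ?thesis .
qed

lemma entry_measurable:
  assumes a: "a \<in> measurable N (mat_space n)" and ij: "i < n" "j < n"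
  shows "(\<lambda>\<omega>. a \<omega> i j) \<in> borel_measurable N"
proof -
  have "(\<lambda>\<omega>. a \<omega> i) \<in> measurable N (\<Pi>\<^sub>M j\<in>{..<n}. borel)"
    using measurable_compose[OF a[unfolded mat_space_def] measurable_component_singleton[of i]] ij by simp
  from measurable_compose[OF this measurable_component_singleton[of j]] ij show ?thesis by simp
qed

lemma coordinate_measurable:
  assumes y: "y \<in> measurable N (\<Pi>\<^sub>M i\<in>{..<n}. L)" and L: "sets L = sets borel" and i: "i < n"
  shows "(\<lambda>\<omega>. y \<omega> i) \<in> borel_measurable N"
  using measurable_compose[OF y measurable_component_singleton[of i]] i by (simp add: measurable_cong_sets[OF refl L])

lemma gibbs_exponent_measurable_joint:
  assumes a: "\<And>i j. i < n \<Longrightarrow> j < n \<Longrightarrow> (\<lambda>\<omega>. a \<omega> i j) \<in> borel_measurable N"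
    and h: "\<And>i. i < n \<Longrightarrow> (\<lambda>\<omega>. h \<omega> i) \<in> borel_measurable N"
    and y: "\<And>i. i < n \<Longrightarrow> (\<lambda>\<omega>. y \<omega> i) \<in> borel_measurable N"
  shows "(\<lambda>\<omega>. gibbs_exponent n (a \<omega>) (h \<omega>) (y \<omega>)) \<in> borel_measurable N"
  unfolding gibbs_exponent_def quad_form_def mat_vec_def
  by (intro borel_measurable_add borel_measurable_divide borel_measurable_sum borel_measurable_times a h y) auto

lemma (in interval_law) weighted_residual_measurable_joint:
  assumes a: "\<And>i j. i < n \<Longrightarrow> j < n \<Longrightarrow> (\<lambda>\<omega>. a \<omega> i j) \<in> borel_measurable N"
    and h: "\<And>i. i < n \<Longrightarrow> (\<lambda>\<omega>. h \<omega> i) \<in> borel_measurable N"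
    and y: "\<And>i. i < n \<Longrightarrow> (\<lambda>\<omega>. y \<omega> i) \<in> borel_measurable N"
    and v: "\<And>i. i < n \<Longrightarrow> (\<lambda>\<omega>. v \<omega> i) \<in> borel_measurable N"
  shows "(\<lambda>\<omega>. \<Sum>i<n. v \<omega> i * residual n (a \<omega>) (h \<omega>) (y \<omega>) i) \<in> borel_measurable N"
  unfolding residual_def local_field_def
  by (intro borel_measurable_add borel_measurable_diff borel_measurable_sum borel_measurable_times alpha_d1_measurable a h y v) auto

lemma (in interval_law) nn_integral_gibbs_density:
  fixes n :: nat
  defines "Q \<equiv> \<Pi>\<^sub>M i\<in>{..<n}. \<nu>"
  shows "(\<integral>\<^sup>+y. ennreal (gibbs_density Q (gibbs_exponent n A h) y) \<partial>Q) = 1"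
  using gibbs_density_props[of n A h] unfolding Q_def by (subst nn_integral_eq_integral) auto

definition score_rate :: "real \<Rightarrow> real \<Rightarrow> nat \<Rightarrow> real" where
  "score_rate K \<eta> n = (4 * real n + 2 * real n * (K * sqrt (real n))) / (\<eta> * real n)\<^sup>2"

lemma score_rate_nonneg: "0 \<le> K \<Longrightarrow> 0 \<le> score_rate K \<eta> n"
  by (simp add: score_rate_def)

lemma score_rate_tendsto: "(\<lambda>n. score_rate K \<eta> n) \<longlonglongrightarrow> 0"
proof -
  have "(\<lambda>n. (4 / \<eta>\<^sup>2) * inverse (real n) + (2 * K / \<eta>\<^sup>2) * inverse (sqrt (real n))) \<longlonglongrightarrow> (4 / \<eta>\<^sup>2) * 0 + (2 * K / \<eta>\<^sup>2) * 0"
    by (intro tendsto_intros tendsto_inverse_0_at_top filterlim_real_sequentially filterlim_compose[OF sqrt_at_top])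
  moreover have "(4 / \<eta>\<^sup>2) * inverse (real n) + (2 * K / \<eta>\<^sup>2) * inverse (sqrt (real n)) = score_rate K \<eta> n" for n
  proof (cases "n = 0")
    case False
    define s where "s = sqrt (real n)"
    have s: "s > 0" "real n = s * s" using False by (auto simp: s_def)
    show ?thesis
    proof (cases "\<eta> = 0")
      case False
      then show ?thesis using s(1) by (simp add: score_rate_def s(2) power2_eq_square field_simps)
    qed (simp add: score_rate_def)
  qed (simp add: score_rate_def)
  ultimately show ?thesis by simp
qed

text \<open>Chebyshev's inequality under the Gibbs law, with the second moment of the conditionally centred sum.\<close>

lemma (in interval_law) gibbs_residual_tail:
  fixes n :: nat
  assumes A: "sym_mat n A" and F: "(\<Sum>i<n. \<Sum>j<n. (A i j)\<^sup>2) \<le> K\<^sup>2 * real n" and K: "0 \<le> K"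
    and v: "\<forall>i<n. \<bar>v i\<bar> \<le> 1" and n: "0 < n" and \<eta>: "0 < \<eta>"
  defines "Q \<equiv> \<Pi>\<^sub>M i\<in>{..<n}. \<nu>"
  shows "(\<integral>\<^sup>+y. ennreal (gibbs_density Q (gibbs_exponent n A h) y) *
     indicator {y. \<eta> * real n < \<bar>\<Sum>i<n. v i * residual n A h y i\<bar>} y \<partial>Q) \<le> ennreal (score_rate K \<eta> n)"
proof -
  let ?f = "gibbs_density Q (gibbs_exponent n A h)" and ?R = "\<lambda>y. \<Sum>i<n. v i * residual n A h y i"
  have pos: "0 < (\<eta> * real n)\<^sup>2" using n \<eta> by simp
  note sm = residual_second_moment[OF A v, of h, folded Q_def]
  have "(\<integral>\<^sup>+y. ennreal (?f y) * indicator {y. \<eta> * real n < \<bar>?R y\<bar>} y \<partial>Q) \<le> (\<integral>\<^sup>+y. ennreal ((?R y)\<^sup>2 * ?f y / (\<eta> * real n)\<^sup>2) \<partial>Q)"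
  proof (rule nn_integral_mono)
    fix y
    have f0: "0 \<le> ?f y" using gibbs_density_props(2)[of n A h y] by (simp add: Q_def)
    show "ennreal (?f y) * indicator {y. \<eta> * real n < \<bar>?R y\<bar>} y \<le> ennreal ((?R y)\<^sup>2 * ?f y / (\<eta> * real n)\<^sup>2)"
    proof (cases "\<eta> * real n < \<bar>?R y\<bar>")
      case True
      then have "\<bar>\<eta> * real n\<bar> \<le> \<bar>?R y\<bar>" using n \<eta> by simp
      then have "(\<eta> * real n)\<^sup>2 \<le> (?R y)\<^sup>2" by (simp only: abs_le_square_iff)
      then have "?f y * (\<eta> * real n)\<^sup>2 \<le> ?f y * (?R y)\<^sup>2" using f0 by (rule mult_left_mono)
      then have "?f y \<le> (?R y)\<^sup>2 * ?f y / (\<eta> * real n)\<^sup>2" using pos by (simp add: pos_le_divide_eq mult.commute)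
      then show ?thesis using True by (simp add: ennreal_leI)
    qed simp
  qed
  also have "\<dots> = ennreal (\<integral>y. (?R y)\<^sup>2 * ?f y / (\<eta> * real n)\<^sup>2 \<partial>Q)"
    by (rule nn_integral_eq_integral)
      (use sm(1) gibbs_density_props(2)[of n A h] in \<open>auto simp: Q_def intro!: divide_nonneg_nonneg mult_nonneg_nonneg\<close>)
  also have "\<dots> \<le> ennreal (score_rate K \<eta> n)"
  proof (rule ennreal_leI)
    have "sqrt (\<Sum>i<n. \<Sum>j<n. (A i j)\<^sup>2) \<le> sqrt (K\<^sup>2 * real n)" using F by (rule real_sqrt_le_mono)
    also have "\<dots> = K * sqrt (real n)" using K by (simp add: real_sqrt_mult)
    finally have "4 * real n + 2 * real n * sqrt (\<Sum>i<n. \<Sum>j<n. (A i j)\<^sup>2) \<le> 4 * real n + 2 * real n * (K * sqrt (real n))"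
      by (intro add_left_mono mult_left_mono) auto
    with sm(2) have "(\<integral>y. (?R y)\<^sup>2 * ?f y \<partial>Q) \<le> 4 * real n + 2 * real n * (K * sqrt (real n))" by (rule order_trans)
    then show "(\<integral>y. (?R y)\<^sup>2 * ?f y / (\<eta> * real n)\<^sup>2 \<partial>Q) \<le> score_rate K \<eta> n"
      unfolding score_rate_def by (simp add: divide_right_mono)
  qed
  finally show ?thesis .
qed

lemma nn_integral_prob_le: "prob_space N \<Longrightarrow> (\<And>x. x \<in> space N \<Longrightarrow> f x \<le> k) \<Longrightarrow> (\<integral>\<^sup>+x. f x \<partial>N) \<le> k"
  using nn_integral_mono[of N f "\<lambda>_. k"] by (simp add: prob_space.emeasure_space_1)

locale interference =
  fixes P :: "'w measure" and \<mu> :: "real measure" and PX :: "(real ^ 'd) measure" and c C :: real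
    and M :: "nat \<Rightarrow> nat \<Rightarrow> nat \<Rightarrow> real" and \<gamma>0 :: "real ^ 'd" and \<tau>0 :: real and \<theta>0 :: "real ^ 'd"
    and A :: "nat \<Rightarrow> 'w \<Rightarrow> nat \<Rightarrow> nat \<Rightarrow> real" and X :: "nat \<Rightarrow> 'w \<Rightarrow> nat \<Rightarrow> real ^ 'd"
    and T Y Tb :: "nat \<Rightarrow> 'w \<Rightarrow> nat \<Rightarrow> real" and Xb :: "nat \<Rightarrow> 'w \<Rightarrow> nat \<Rightarrow> real ^ 'd"
  assumes base: "base_measure \<mu>" and PX: "covariate_law c C PX"
    and model: "interference_model P \<mu> PX M \<gamma>0 \<tau>0 \<theta>0 A X T Y Tb Xb"
begin

sublocale prob_space P using model by (simp add: interference_model_def)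
sublocale U: interval_law \<mu> by (rule interval_law_base_measure[OF base])
sublocale R: interval_law rademacher by (rule interval_law_rademacher)
sublocale PX: prob_space PX by (rule covariate_lawD(1)[OF PX])

abbreviation LA :: "nat \<Rightarrow> (nat \<Rightarrow> nat \<Rightarrow> real) measure" where
  "LA n \<equiv> distr P (mat_space n) (A n)"
abbreviation LX :: "nat \<Rightarrow> (nat \<Rightarrow> real ^ 'd) measure" where "LX n \<equiv> \<Pi>\<^sub>M i\<in>{..<n}. PX"
abbreviation LT :: "nat \<Rightarrow> (nat \<Rightarrow> real) measure" where "LT n \<equiv> \<Pi>\<^sub>M i\<in>{..<n}. rademacher"
abbreviation LY :: "nat \<Rightarrow> (nat \<Rightarrow> real) measure" where "LY n \<equiv> \<Pi>\<^sub>M i\<in>{..<n}. \<mu>"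

abbreviation "density_T n x \<equiv> treatment_density n (M n) \<gamma>0 x"
abbreviation "density_Y n a x t \<equiv> outcome_density \<mu> n a \<tau>0 \<theta>0 t x"

definition J where "J n = joint_law n (LA n) \<mu> PX (M n) \<gamma>0 \<tau>0 \<theta>0"
definition Z where "Z n \<omega> = (A n \<omega>, X n \<omega>, T n \<omega>, Y n \<omega>, Tb n \<omega>, Xb n \<omega>)"

lemma A_measurable [measurable]: "A n \<in> measurable P (mat_space n)"
  using model by (simp add: interference_model_def)

lemma Z_measurable: "Z n \<in> measurable P (J n)" and Z_law: "distr P (J n) (Z n) = J n"
  using model unfolding interference_model_def Let_def J_def Z_def by auto

lemma prob_spaces: "prob_space (LA n)" "prob_space (LX n)" "prob_space (LT n)" "prob_space (LY n)" "prob_space (LT n \<Otimes>\<^sub>M LX n)"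
proof -
  show "prob_space (LA n)" by (rule prob_space_distr) measurable
  show 1: "prob_space (LX n)" by (rule prob_space_PiM) (rule PX.prob_space_axioms)
  show 2: "prob_space (LT n)" by (rule R.prob_space_product)
  show "prob_space (LY n)" by (rule U.prob_space_product)
  show "prob_space (LT n \<Otimes>\<^sub>M LX n)" by (rule prob_space_pair[OF 2 1])
qed

lemma sets_J: "sets (J n) = sets (LA n \<Otimes>\<^sub>M LX n \<Otimes>\<^sub>M LT n \<Otimes>\<^sub>M LY n \<Otimes>\<^sub>M LT n \<Otimes>\<^sub>M LX n)"
  by (simp add: J_def joint_law_def)

lemma sample_measurable: "X n \<in> measurable P (LX n)" "T n \<in> measurable P (LT n)" "Y n \<in> measurable P (LY n)"
  "Tb n \<in> measurable P (LT n)" "Xb n \<in> measurable P (LX n)"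
proof -
  have [measurable]: "Z n \<in> measurable P (LA n \<Otimes>\<^sub>M LX n \<Otimes>\<^sub>M LT n \<Otimes>\<^sub>M LY n \<Otimes>\<^sub>M LT n \<Otimes>\<^sub>M LX n)"
    using Z_measurable[of n] by (simp add: measurable_cong_sets[OF refl sets_J])
  have "(\<lambda>\<omega>. fst (snd (Z n \<omega>))) \<in> measurable P (LX n)" "(\<lambda>\<omega>. fst (snd (snd (Z n \<omega>)))) \<in> measurable P (LT n)"
    "(\<lambda>\<omega>. fst (snd (snd (snd (Z n \<omega>))))) \<in> measurable P (LY n)"
    "(\<lambda>\<omega>. fst (snd (snd (snd (snd (Z n \<omega>)))))) \<in> measurable P (LT n)"
    "(\<lambda>\<omega>. snd (snd (snd (snd (snd (Z n \<omega>)))))) \<in> measurable P (LX n)"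
    by measurable
  then show "X n \<in> measurable P (LX n)" "T n \<in> measurable P (LT n)" "Y n \<in> measurable P (LY n)"
    "Tb n \<in> measurable P (LT n)" "Xb n \<in> measurable P (LX n)"
    by (simp_all add: Z_def)
qed

lemma treatment_density_eq: "density_T n x = gibbs_density (LT n) (gibbs_exponent n (M n) (\<lambda>i. x i \<bullet> \<gamma>0))"
  by (simp add: treatment_density_def gibbs_exponent_def[abs_def])

lemma outcome_density_eq: "density_Y n a x t = gibbs_density (LY n) (gibbs_exponent n a (\<lambda>i. \<tau>0 * t i + x i \<bullet> \<theta>0))"
  by (simp add: outcome_density_def gibbs_exponent_def[abs_def])

lemma covariate_measurable: "x \<in> measurable N (LX n) \<Longrightarrow> i < n \<Longrightarrow> (\<lambda>\<omega>. x \<omega> i) \<in> borel_measurable N"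
  using measurable_compose[of x N "LX n" "\<lambda>x. x i" PX] measurable_component_singleton[of i "{..<n}" "\<lambda>_. PX"]
  by (simp add: measurable_cong_sets[OF refl covariate_lawD(2)[OF PX]])

lemma field_measurable:
  assumes "x \<in> measurable N (LX n)" "t \<in> measurable N (LT n)" "i < n"
  shows "(\<lambda>\<omega>. \<tau> * t \<omega> i + x \<omega> i \<bullet> \<theta>) \<in> borel_measurable N"
  by (intro borel_measurable_add borel_measurable_times borel_measurable_inner borel_measurable_const
      covariate_measurable[OF assms(1,3)] coordinate_measurable[OF assms(2) R.sets_law assms(3)])

lemma outcome_exponent_measurable:
  assumes "a \<in> measurable N (mat_space n)" "x \<in> measurable N (LX n)" "t \<in> measurable N (LT n)" "y \<in> measurable N (LY n)"
  shows "(\<lambda>\<omega>. gibbs_exponent n (a \<omega>) (\<lambda>i. \<tau>0 * t \<omega> i + x \<omega> i \<bullet> \<theta>0) (y \<omega>)) \<in> borel_measurable N"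
  by (rule gibbs_exponent_measurable_joint, erule (1) entry_measurable[OF assms(1)], erule field_measurable[OF assms(2,3)],
      erule coordinate_measurable[OF assms(4) U.sets_law])

lemma treatment_density_measurable: "(\<lambda>(x, t). density_T n x t) \<in> borel_measurable (LX n \<Otimes>\<^sub>M LT n)"
proof -
  interpret LT: prob_space "LT n" by (rule prob_spaces)
  have num: "(\<lambda>p. gibbs_exponent n (M n) (\<lambda>i. fst p i \<bullet> \<gamma>0) (snd p)) \<in> borel_measurable (LX n \<Otimes>\<^sub>M LT n)"
    by (rule gibbs_exponent_measurable_joint, simp, intro borel_measurable_inner covariate_measurable[OF measurable_fst] borel_measurable_const,
        assumption, erule coordinate_measurable[OF measurable_snd R.sets_law])
  then have "(\<lambda>(x, t). exp (gibbs_exponent n (M n) (\<lambda>i. x i \<bullet> \<gamma>0) t)) \<in> borel_measurable (LX n \<Otimes>\<^sub>M LT n)"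
    by (simp add: case_prod_beta)
  from LT.borel_measurable_lebesgue_integral[OF this]
  have "(\<lambda>x. \<integral>t. exp (gibbs_exponent n (M n) (\<lambda>i. x i \<bullet> \<gamma>0) t) \<partial>LT n) \<in> borel_measurable (LX n)" .
  note den = this
  have "(\<lambda>p. exp (gibbs_exponent n (M n) (\<lambda>i. fst p i \<bullet> \<gamma>0) (snd p)) / (\<integral>t. exp (gibbs_exponent n (M n) (\<lambda>i. fst p i \<bullet> \<gamma>0) t) \<partial>LT n))
      \<in> borel_measurable (LX n \<Otimes>\<^sub>M LT n)"
    by (intro borel_measurable_divide measurable_compose[OF _ borel_measurable_exp] num measurable_compose[OF measurable_fst den])
  then show ?thesis
    by (simp add: treatment_density_eq gibbs_density_def case_prod_beta')
qed

lemma outcome_density_measurable: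
  "(\<lambda>(a, x, t, y). density_Y n a x t y) \<in> borel_measurable (LA n \<Otimes>\<^sub>M LX n \<Otimes>\<^sub>M LT n \<Otimes>\<^sub>M LY n)"
proof -
  interpret LY: prob_space "LY n" by (rule prob_spaces)
  let ?N = "LA n \<Otimes>\<^sub>M LX n \<Otimes>\<^sub>M LT n"
  have "(\<lambda>p. exp (gibbs_exponent n (fst (fst p)) (\<lambda>i. \<tau>0 * snd (snd (fst p)) i + fst (snd (fst p)) i \<bullet> \<theta>0) (snd p))) \<in> borel_measurable (?N \<Otimes>\<^sub>M LY n)"
    by (intro measurable_compose[OF _ borel_measurable_exp] outcome_exponent_measurable) measurable
  then have "(\<lambda>(z, y). exp (gibbs_exponent n (fst z) (\<lambda>i. \<tau>0 * snd (snd z) i + fst (snd z) i \<bullet> \<theta>0) y)) \<in> borel_measurable (?N \<Otimes>\<^sub>M LY n)"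
    by (simp add: case_prod_beta)
  from LY.borel_measurable_lebesgue_integral[OF this]
  have den: "(\<lambda>z. \<integral>y. exp (gibbs_exponent n (fst z) (\<lambda>i. \<tau>0 * snd (snd z) i + fst (snd z) i \<bullet> \<theta>0) y) \<partial>LY n) \<in> borel_measurable ?N" .
  have "(\<lambda>p. (fst p, fst (snd p), fst (snd (snd p)))) \<in> measurable (LA n \<Otimes>\<^sub>M LX n \<Otimes>\<^sub>M LT n \<Otimes>\<^sub>M LY n) ?N" by measurable
  from measurable_compose[OF this den]
  have "(\<lambda>p. \<integral>y. exp (gibbs_exponent n (fst p) (\<lambda>i. \<tau>0 * fst (snd (snd p)) i + fst (snd p) i \<bullet> \<theta>0) y) \<partial>LY n) \<in> borel_measurable (LA n \<Otimes>\<^sub>M LX n \<Otimes>\<^sub>M LT n \<Otimes>\<^sub>M LY n)" by simp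
  moreover have "(\<lambda>p. exp (gibbs_exponent n (fst p) (\<lambda>i. \<tau>0 * fst (snd (snd p)) i + fst (snd p) i \<bullet> \<theta>0) (snd (snd (snd p))))) \<in> borel_measurable (LA n \<Otimes>\<^sub>M LX n \<Otimes>\<^sub>M LT n \<Otimes>\<^sub>M LY n)"
    by (intro measurable_compose[OF _ borel_measurable_exp] outcome_exponent_measurable) measurable
  ultimately show ?thesis
    by (simp add: outcome_density_eq gibbs_density_def case_prod_beta')
qed

lemma densities_nonneg: "0 \<le> density_T n x t" "0 \<le> density_Y n a x t y"
  unfolding treatment_density_eq outcome_density_eq by (rule R.gibbs_density_props(2) U.gibbs_density_props(2))+

lemma nn_integral_sample:
  assumes g: "(\<lambda>(a, x, t, y). g a x t y) \<in> borel_measurable (LA n \<Otimes>\<^sub>M LX n \<Otimes>\<^sub>M LT n \<Otimes>\<^sub>M LY n)"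
  shows "(\<integral>\<^sup>+\<omega>. g (A n \<omega>) (X n \<omega>) (T n \<omega>) (Y n \<omega>) \<partial>P) =
    (\<integral>\<^sup>+a. \<integral>\<^sup>+x. \<integral>\<^sup>+t. ennreal (density_T n x t) *
       (\<integral>\<^sup>+y. ennreal (density_Y n a x t y) * g a x t y \<partial>LY n) \<partial>LT n \<partial>LX n \<partial>LA n)"
proof -
  let ?G = "\<lambda>(a, x, t, y, w). g a x t y"
  have gm: "?G \<in> borel_measurable (J n)"
    using measurable_compose[of "\<lambda>(a, x, t, y, w). (a, x, t, y)" "LA n \<Otimes>\<^sub>M LX n \<Otimes>\<^sub>M LT n \<Otimes>\<^sub>M LY n \<Otimes>\<^sub>M LT n \<Otimes>\<^sub>M LX n", OF _ g]
    by (simp add: case_prod_beta measurable_cong_sets[OF sets_J refl])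
  have "(\<integral>\<^sup>+\<omega>. g (A n \<omega>) (X n \<omega>) (T n \<omega>) (Y n \<omega>) \<partial>P) = (\<integral>\<^sup>+\<omega>. ?G (Z n \<omega>) \<partial>P)" by (simp add: Z_def)
  also have "\<dots> = (\<integral>\<^sup>+z. ?G z \<partial>distr P (J n) (Z n))"
    by (rule nn_integral_distr[symmetric, OF Z_measurable]) (use gm in simp)
  also have "\<dots> = (\<integral>\<^sup>+z. ?G z \<partial>J n)" by (simp only: Z_law)
  also have "J n = density (LA n \<Otimes>\<^sub>M LX n \<Otimes>\<^sub>M LT n \<Otimes>\<^sub>M LY n \<Otimes>\<^sub>M (LT n \<Otimes>\<^sub>M LX n))
      (\<lambda>(a, x, t, y, w). ennreal (density_T n x t * density_Y n a x t y))"
    unfolding J_def joint_law_def by (simp add: case_prod_beta')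
  finally show ?thesis
    unfolding nn_integral_successive_densities[where v = "\<lambda>a x t y. density_Y n a x t y",
      OF prob_spaces treatment_density_measurable densities_nonneg(1) outcome_density_measurable densities_nonneg(2) g] .
qed

lemma integrals_densities:
  "(\<integral>\<^sup>+t. ennreal (density_T n x t) \<partial>LT n) = 1"
  "(\<integral>\<^sup>+y. ennreal (density_Y n a x t y) \<partial>LY n) = 1"
  unfolding treatment_density_eq outcome_density_eq by (rule R.nn_integral_gibbs_density U.nn_integral_gibbs_density)+

lemma nn_integral_sample_le_outcome:
  assumes g: "(\<lambda>(a, x, t, y). g a x t y) \<in> borel_measurable (LA n \<Otimes>\<^sub>M LX n \<Otimes>\<^sub>M LT n \<Otimes>\<^sub>M LY n)"
    and le: "\<And>a x t. (\<integral>\<^sup>+y. ennreal (density_Y n a x t y) * g a x t y \<partial>LY n) \<le> k"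
  shows "(\<integral>\<^sup>+\<omega>. g (A n \<omega>) (X n \<omega>) (T n \<omega>) (Y n \<omega>) \<partial>P) \<le> k"
  unfolding nn_integral_sample[OF g]
proof (rule nn_integral_prob_le[OF prob_spaces(1)], rule nn_integral_prob_le[OF prob_spaces(2)])
  fix a x assume x: "x \<in> space (LX n)"
  have m: "(\<lambda>t. density_T n x t) \<in> borel_measurable (LT n)"
    using measurable_Pair2[OF treatment_density_measurable x] by simp
  have "(\<integral>\<^sup>+t. ennreal (density_T n x t) * (\<integral>\<^sup>+y. ennreal (density_Y n a x t y) * g a x t y \<partial>LY n) \<partial>LT n)
     \<le> (\<integral>\<^sup>+t. ennreal (density_T n x t) * k \<partial>LT n)"
    by (intro nn_integral_mono mult_left_mono le) simp
  also have "\<dots> = (\<integral>\<^sup>+t. ennreal (density_T n x t) \<partial>LT n) * k"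
    by (rule nn_integral_multc) (use m in simp)
  finally show "(\<integral>\<^sup>+t. ennreal (density_T n x t) * (\<integral>\<^sup>+y. ennreal (density_Y n a x t y) * g a x t y \<partial>LY n) \<partial>LT n) \<le> k"
    by (simp add: integrals_densities)
qed

lemma nn_integral_sample_design:
  assumes g: "(\<lambda>(x, t). g x t) \<in> borel_measurable (LX n \<Otimes>\<^sub>M LT n)"
  shows "(\<integral>\<^sup>+\<omega>. g (X n \<omega>) (T n \<omega>) \<partial>P) = (\<integral>\<^sup>+x. \<integral>\<^sup>+t. ennreal (density_T n x t) * g x t \<partial>LT n \<partial>LX n)"
proof -
  have gm: "(\<lambda>(a, x, t, y). g x t) \<in> borel_measurable (LA n \<Otimes>\<^sub>M LX n \<Otimes>\<^sub>M LT n \<Otimes>\<^sub>M LY n)"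
    using measurable_compose[of "\<lambda>(a, x, t, y). (x, t)" "LA n \<Otimes>\<^sub>M LX n \<Otimes>\<^sub>M LT n \<Otimes>\<^sub>M LY n", OF _ g] by (simp add: case_prod_beta)
  have "(\<integral>\<^sup>+\<omega>. g (X n \<omega>) (T n \<omega>) \<partial>P) = (\<integral>\<^sup>+a. \<integral>\<^sup>+x. \<integral>\<^sup>+t. ennreal (density_T n x t) *
       (\<integral>\<^sup>+y. ennreal (density_Y n a x t y) * g x t \<partial>LY n) \<partial>LT n \<partial>LX n \<partial>LA n)"
    by (rule nn_integral_sample[where g = "\<lambda>a x t y. g x t", OF gm])
  also have "\<dots> = (\<integral>\<^sup>+a. \<integral>\<^sup>+x. \<integral>\<^sup>+t. ennreal (density_T n x t) * g x t \<partial>LT n \<partial>LX n \<partial>LA n)"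
  proof (intro nn_integral_cong)
    fix a x t assume sp: "a \<in> space (LA n)" "x \<in> space (LX n)" "t \<in> space (LT n)"
    have m: "(\<lambda>y. density_Y n a x t y) \<in> borel_measurable (LY n)"
      using measurable_Pair2[OF measurable_Pair2[OF measurable_Pair2[OF outcome_density_measurable sp(1)] sp(2)] sp(3)] by simp
    have "(\<integral>\<^sup>+y. ennreal (density_Y n a x t y) * g x t \<partial>LY n) = g x t"
      by (subst nn_integral_multc) (use m integrals_densities in auto)
    then show "ennreal (density_T n x t) * (\<integral>\<^sup>+y. ennreal (density_Y n a x t y) * g x t \<partial>LY n)
      = ennreal (density_T n x t) * g x t" by simp
  qed
  also have "\<dots> = (\<integral>\<^sup>+x. \<integral>\<^sup>+t. ennreal (density_T n x t) * g x t \<partial>LT n \<partial>LX n)"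
    using prob_space.emeasure_space_1[OF prob_spaces(1)] by (simp del: emeasure_distr)
  finally show ?thesis .
qed

lemma nn_integral_sample_covariates:
  assumes g: "g \<in> borel_measurable (LX n)"
  shows "(\<integral>\<^sup>+\<omega>. g (X n \<omega>) \<partial>P) = (\<integral>\<^sup>+x. g x \<partial>LX n)"
proof -
  have gm: "(\<lambda>(x, t). g x) \<in> borel_measurable (LX n \<Otimes>\<^sub>M LT n)"
    using measurable_compose[OF measurable_fst g, of "LT n"] by (simp add: case_prod_beta)
  have "(\<integral>\<^sup>+\<omega>. g (X n \<omega>) \<partial>P) = (\<integral>\<^sup>+x. \<integral>\<^sup>+t. ennreal (density_T n x t) * g x \<partial>LT n \<partial>LX n)"
    by (rule nn_integral_sample_design[where g = "\<lambda>x t. g x", OF gm])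
  also have "\<dots> = (\<integral>\<^sup>+x. g x \<partial>LX n)"
  proof (intro nn_integral_cong)
    fix x assume x: "x \<in> space (LX n)"
    have m: "(\<lambda>t. density_T n x t) \<in> borel_measurable (LT n)"
      using measurable_Pair2[OF treatment_density_measurable x] by simp
    show "(\<integral>\<^sup>+t. ennreal (density_T n x t) * g x \<partial>LT n) = g x"
      by (subst nn_integral_multc) (use m integrals_densities in auto)
  qed
  finally show ?thesis .
qed

lemma AE_sample:
  "AE \<omega> in P. (\<forall>i<n. \<forall>k. \<bar>X n \<omega> i $ k\<bar> \<le> 1) \<and> (\<forall>i<n. T n \<omega> i = 1 \<or> T n \<omega> i = -1) \<and> (\<forall>i<n. \<bar>Y n \<omega> i\<bar> \<le> 1)
    \<and> (\<forall>i<n. \<bar>Tb n \<omega> i\<bar> \<le> 1) \<and> (\<forall>i<n. \<forall>k. \<bar>Xb n \<omega> i $ k\<bar> \<le> 1)"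
proof -
  let ?Q = "\<lambda>(a :: nat \<Rightarrow> nat \<Rightarrow> real, x :: nat \<Rightarrow> real ^ 'd, t :: nat \<Rightarrow> real, y :: nat \<Rightarrow> real, tb :: nat \<Rightarrow> real, xb :: nat \<Rightarrow> real ^ 'd).
    (\<forall>i<n. \<forall>k. \<bar>x i $ k\<bar> \<le> 1) \<and> (\<forall>i<n. t i = 1 \<or> t i = -1) \<and> (\<forall>i<n. \<bar>y i\<bar> \<le> 1) \<and> (\<forall>i<n. \<bar>tb i\<bar> \<le> 1) \<and> (\<forall>i<n. \<forall>k. \<bar>xb i $ k\<bar> \<le> 1)"
  let ?B = "LA n \<Otimes>\<^sub>M LX n \<Otimes>\<^sub>M LT n \<Otimes>\<^sub>M LY n \<Otimes>\<^sub>M LT n \<Otimes>\<^sub>M LX n"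
  note aex = AE_PiM_all[OF PX.prob_space_axioms covariate_lawD(3)[OF PX], of n]
  note aet = AE_PiM_all[OF R.prob_space_axioms AE_rademacher, of n]
  note prs = prob_spaces prob_space_pair
  have "AE z in ?B. (\<forall>i<n. \<forall>k. \<bar>fst (snd z) i $ k\<bar> \<le> 1)"
    by (rule AE_pair_snd, (intro prs)+, rule AE_pair_fst, (intro prs)+, rule aex)
  moreover have "AE z in ?B. (\<forall>i<n. fst (snd (snd z)) i = 1 \<or> fst (snd (snd z)) i = -1)"
    by (rule AE_pair_snd, (intro prs)+, rule AE_pair_snd, (intro prs)+, rule AE_pair_fst, (intro prs)+, rule aet)
  moreover have "AE z in ?B. (\<forall>i<n. \<bar>fst (snd (snd (snd z))) i\<bar> \<le> 1)"
    by (rule AE_pair_snd, (intro prs)+, rule AE_pair_snd, (intro prs)+, rule AE_pair_snd, (intro prs)+, rule AE_pair_fst, (intro prs)+, rule U.AE_product_interval)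
  moreover have "AE z in ?B. (\<forall>i<n. \<bar>fst (snd (snd (snd (snd z)))) i\<bar> \<le> 1)"
    by (rule AE_pair_snd, (intro prs)+, rule AE_pair_snd, (intro prs)+, rule AE_pair_snd, (intro prs)+, rule AE_pair_snd, (intro prs)+,
        rule AE_pair_fst, (intro prs)+, rule R.AE_product_interval)
  moreover have "AE z in ?B. (\<forall>i<n. \<forall>k. \<bar>snd (snd (snd (snd (snd z)))) i $ k\<bar> \<le> 1)"
    by (rule AE_pair_snd, (intro prs)+, rule AE_pair_snd, (intro prs)+, rule AE_pair_snd, (intro prs)+, rule AE_pair_snd, (intro prs)+,
        rule AE_pair_snd, (intro prs)+, rule aex)
  ultimately have ae: "AE z in ?B. ?Q z" by eventually_elim (auto simp: case_prod_beta)
  have dm: "(\<lambda>(a, x, t, y, tb, xb). ennreal (density_T n x t * density_Y n a x t y)) \<in> borel_measurable ?B"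
  proof -
    have "(\<lambda>z. (case z of (a, x, t, y, w) \<Rightarrow> density_T n x t)) \<in> borel_measurable ?B"
      using measurable_compose[of "\<lambda>(a, x, t, y, w). (x, t)" ?B, OF _ treatment_density_measurable] by (simp add: case_prod_beta)
    moreover have "(\<lambda>z. (case z of (a, x, t, y, w) \<Rightarrow> density_Y n a x t y)) \<in> borel_measurable ?B"
      using measurable_compose[of "\<lambda>(a, x, t, y, w). (a, x, t, y)" ?B, OF _ outcome_density_measurable] by (simp add: case_prod_beta)
    ultimately have "(\<lambda>z. ennreal ((case z of (a, x, t, y, w) \<Rightarrow> density_T n x t) * (case z of (a, x, t, y, w) \<Rightarrow> density_Y n a x t y))) \<in> borel_measurable ?B"
      by measurable
    then show ?thesis by (simp add: case_prod_beta)
  qed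
  have "AE z in J n. ?Q z"
    unfolding J_def joint_law_def AE_density[OF dm] using ae by eventually_elim simp
  then have "AE z in distr P (J n) (Z n). ?Q z" by (simp only: Z_law)
  from AE_distrD[OF Z_measurable this] show ?thesis by (simp add: Z_def)
qed

end

section \<open>Consistency of the estimator\<close>

text \<open>The events about the outputs need not be measurable, but then they have measure zero; so it is enough
  that measurable sets \<open>D n\<close> of vanishing probability contain them almost surely for all large \<open>n\<close>.\<close>

lemma (in prob_space) measure_tendsto_0_if_eventually:
  assumes D: "\<And>n. D n \<in> events" "(\<lambda>n. prob (D n)) \<longlonglongrightarrow> 0"
    and AE: "AE \<omega> in M. \<forall>\<^sub>F n in sequentially. \<omega> \<in> E n \<longrightarrow> \<omega> \<in> D n"
  shows "(\<lambda>n. measure M (E n)) \<longlonglongrightarrow> 0"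
proof -
  define E' where "E' n = (if E n \<in> events then E n - D n else {})" for n
  have E' [measurable]: "E' n \<in> events" for n using D(1) by (simp add: E'_def)
  have "(\<lambda>n. \<integral>\<omega>. indicator (E' n) \<omega> \<partial>M) \<longlonglongrightarrow> (\<integral>\<omega>. (0::real) \<partial>M)"
  proof (rule integral_dominated_convergence[where w = "\<lambda>_. 1"])
    show "AE \<omega> in M. (\<lambda>n. indicator (E' n) \<omega> :: real) \<longlonglongrightarrow> 0"
      using AE
    proof eventually_elim
      case (elim \<omega>)
      then have "\<forall>\<^sub>F n in sequentially. indicator (E' n) \<omega> = (0::real)"
        by eventually_elim (auto simp: E'_def indicator_def)
      then show ?case by (rule tendsto_eventually)
    qed
  qed (auto simp: indicator_def)
  then have "(\<lambda>n. prob (E' n)) \<longlonglongrightarrow> 0" using sets.sets_into_space[OF E'] by (simp add: Int_absorb2)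
  from tendsto_add[OF this D(2)] have lim: "(\<lambda>n. prob (E' n) + prob (D n)) \<longlonglongrightarrow> 0" by simp
  have "measure M (E n) \<le> prob (E' n) + prob (D n)" for n
  proof (cases "E n \<in> events")
    case True
    then have "measure M (E n) \<le> prob (E' n \<union> D n)" using D(1) by (intro finite_measure_mono) (auto simp: E'_def)
    also have "\<dots> \<le> prob (E' n) + prob (D n)" by (rule measure_Un_le[OF E' D(1)])
    finally show ?thesis .
  qed (simp add: measure_notin_sets)
  then show ?thesis
    by (intro tendsto_sandwich[OF _ _ tendsto_const lim]) auto
qed

lemma (in prob_space) prob_le_if_nn_integral_indicator_le:
  assumes "E \<in> events" "(\<integral>\<^sup>+\<omega>. indicator E \<omega> \<partial>M) \<le> ennreal r" "0 \<le> r"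
  shows "prob E \<le> r"
  using assms by (simp add: emeasure_eq_measure)

text \<open>The weights of the estimating equations: the treatment, or one covariate.\<close>

definition weight :: "'d option \<Rightarrow> (nat \<Rightarrow> real) \<Rightarrow> (nat \<Rightarrow> real ^ 'd) \<Rightarrow> nat \<Rightarrow> real" where
  "weight w t x i = (case w of None \<Rightarrow> t i | Some k \<Rightarrow> x i $ k)"

context interference
begin

definition outcome_score :: "'d option \<Rightarrow> nat \<Rightarrow> (nat \<Rightarrow> nat \<Rightarrow> real) \<Rightarrow> (nat \<Rightarrow> real ^ 'd) \<Rightarrow> (nat \<Rightarrow> real) \<Rightarrow> (nat \<Rightarrow> real) \<Rightarrow> real" where
  "outcome_score w n a x t y = (\<Sum>i<n. weight w t x i * U.residual n a (\<lambda>i. \<tau>0 * t i + x i \<bullet> \<theta>0) y i)"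

text \<open>Symmetry of the matrix and the bounds on its Frobenius norm and on the weights are part of the event;
  this makes its conditional probability small for every value of the conditioning variables.\<close>

definition bad_outcome :: "'d option \<Rightarrow> real \<Rightarrow> real \<Rightarrow> nat \<Rightarrow> (nat \<Rightarrow> nat \<Rightarrow> real) \<Rightarrow> (nat \<Rightarrow> real ^ 'd) \<Rightarrow> (nat \<Rightarrow> real) \<Rightarrow> (nat \<Rightarrow> real) \<Rightarrow> bool" where
  "bad_outcome w K \<eta> n a x t y \<longleftrightarrow> (\<forall>i\<in>{..<n}. \<forall>j\<in>{..<n}. a i j = a j i) \<and> (\<Sum>i<n. \<Sum>j<n. (a i j)\<^sup>2) \<le> K\<^sup>2 * real n \<and>
     (\<forall>i\<in>{..<n}. \<bar>weight w t x i\<bar> \<le> 1) \<and> \<eta> * real n < \<bar>outcome_score w n a x t y\<bar>"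

lemma weight_measurable:
  assumes x: "x \<in> measurable N (LX n)" and t: "t \<in> measurable N (LT n)" and i: "i < n"
  shows "(\<lambda>\<omega>. weight w (t \<omega>) (x \<omega>) i) \<in> borel_measurable N"
proof (cases w)
  case None
  then show ?thesis using coordinate_measurable[OF t R.sets_law i] by (simp add: weight_def)
next
  case (Some k)
  have "(\<lambda>\<omega>. x \<omega> i \<bullet> axis k 1) \<in> borel_measurable N"
    using covariate_measurable[OF x i] by simp
  then show ?thesis by (simp add: weight_def Some inner_axis)
qed

lemma bad_outcome_measurable:
  assumes a: "a \<in> measurable N (mat_space n)" and x: "x \<in> measurable N (LX n)" and t: "t \<in> measurable N (LT n)"
    and y: "y \<in> measurable N (LY n)"
  shows "{\<omega> \<in> space N. bad_outcome w K \<eta> n (a \<omega>) (x \<omega>) (t \<omega>) (y \<omega>)} \<in> sets N"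
proof -
  have s: "(\<lambda>\<omega>. outcome_score w n (a \<omega>) (x \<omega>) (t \<omega>) (y \<omega>)) \<in> borel_measurable N"
    unfolding outcome_score_def
    by (rule U.weighted_residual_measurable_joint, erule (1) entry_measurable[OF a], erule field_measurable[OF x t],
        erule coordinate_measurable[OF y U.sets_law], erule weight_measurable[OF x t])
  have f: "(\<lambda>\<omega>. \<Sum>i<n. \<Sum>j<n. (a \<omega> i j)\<^sup>2) \<in> borel_measurable N"
    by (intro borel_measurable_sum borel_measurable_power entry_measurable[OF a]) auto
  show ?thesis
    unfolding bad_outcome_def
    by (intro sets.sets_Collect_conj sets.sets_Collect_finite_All borel_measurable_eq borel_measurable_le borel_measurable_less
        borel_measurable_abs borel_measurable_const entry_measurable[OF a] weight_measurable[OF x t] s f) auto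
qed

lemma prob_bad_outcome:
  assumes n: "0 < n" and \<eta>: "0 < \<eta>" and K: "0 \<le> K"
  shows "prob {\<omega> \<in> space P. bad_outcome w K \<eta> n (A n \<omega>) (X n \<omega>) (T n \<omega>) (Y n \<omega>)} \<le> score_rate K \<eta> n"
proof (rule prob_le_if_nn_integral_indicator_le)
  let ?g = "\<lambda>a x t y. if bad_outcome w K \<eta> n a x t y then 1 else 0 :: ennreal"
  let ?N = "LA n \<Otimes>\<^sub>M LX n \<Otimes>\<^sub>M LT n \<Otimes>\<^sub>M LY n"
  have "{p \<in> space ?N. bad_outcome w K \<eta> n (fst p) (fst (snd p)) (fst (snd (snd p))) (snd (snd (snd p)))} \<in> sets ?N"
    by (rule bad_outcome_measurable) measurable
  then have g: "(\<lambda>(a, x, t, y). ?g a x t y) \<in> borel_measurable ?N"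
    unfolding case_prod_beta' by (intro measurable_If) auto
  have "(\<integral>\<^sup>+\<omega>. indicator {\<omega> \<in> space P. bad_outcome w K \<eta> n (A n \<omega>) (X n \<omega>) (T n \<omega>) (Y n \<omega>)} \<omega> \<partial>P)
     = (\<integral>\<^sup>+\<omega>. ?g (A n \<omega>) (X n \<omega>) (T n \<omega>) (Y n \<omega>) \<partial>P)"
    by (rule nn_integral_cong) (simp add: indicator_def)
  also have "\<dots> \<le> ennreal (score_rate K \<eta> n)"
  proof (rule nn_integral_sample_le_outcome[OF g])
    fix a x t
    show "(\<integral>\<^sup>+y. ennreal (density_Y n a x t y) * ?g a x t y \<partial>LY n) \<le> ennreal (score_rate K \<eta> n)"
    proof (cases "sym_mat n a \<and> (\<Sum>i<n. \<Sum>j<n. (a i j)\<^sup>2) \<le> K\<^sup>2 * real n \<and> (\<forall>i<n. \<bar>weight w t x i\<bar> \<le> 1)")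
      case True
      have "(\<integral>\<^sup>+y. ennreal (density_Y n a x t y) * ?g a x t y \<partial>LY n) \<le>
          (\<integral>\<^sup>+y. ennreal (density_Y n a x t y) * indicator {y. \<eta> * real n < \<bar>outcome_score w n a x t y\<bar>} y \<partial>LY n)"
        by (intro nn_integral_mono mult_left_mono) (auto simp: bad_outcome_def indicator_def)
      also have "\<dots> \<le> ennreal (score_rate K \<eta> n)"
        unfolding outcome_density_eq outcome_score_def
        by (rule U.gibbs_residual_tail) (use True n \<eta> K in auto)
      finally show ?thesis .
    next
      case False
      then have "?g a x t y = 0" for y by (auto simp: bad_outcome_def sym_mat_def)
      then show ?thesis by simp
    qed
  qed
  finally show "(\<integral>\<^sup>+\<omega>. indicator {\<omega> \<in> space P. bad_outcome w K \<eta> n (A n \<omega>) (X n \<omega>) (T n \<omega>) (Y n \<omega>)} \<omega> \<partial>P) \<le> ennreal (score_rate K \<eta> n)" .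
qed (rule bad_outcome_measurable[OF A_measurable sample_measurable(1-3)], rule score_rate_nonneg[OF K])

definition treatment_score :: "'d \<Rightarrow> nat \<Rightarrow> (nat \<Rightarrow> real ^ 'd) \<Rightarrow> (nat \<Rightarrow> real) \<Rightarrow> real" where
  "treatment_score k n x t = (\<Sum>i<n. x i $ k * R.residual n (M n) (\<lambda>i. x i \<bullet> \<gamma>0) t i)"

definition bad_treatment :: "'d \<Rightarrow> real \<Rightarrow> nat \<Rightarrow> (nat \<Rightarrow> real ^ 'd) \<Rightarrow> (nat \<Rightarrow> real) \<Rightarrow> bool" where
  "bad_treatment k \<eta> n x t \<longleftrightarrow> (\<forall>i\<in>{..<n}. \<bar>x i $ k\<bar> \<le> 1) \<and> \<eta> * real n < \<bar>treatment_score k n x t\<bar>"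

lemma component_covariate_measurable: "x \<in> measurable N (LX n) \<Longrightarrow> i < n \<Longrightarrow> (\<lambda>\<omega>. x \<omega> i $ k) \<in> borel_measurable N"
  using borel_measurable_inner[OF covariate_measurable borel_measurable_const, of x N n i "axis k 1"] by (simp add: inner_axis)

lemma bad_treatment_measurable:
  assumes x: "x \<in> measurable N (LX n)" and t: "t \<in> measurable N (LT n)"
  shows "{\<omega> \<in> space N. bad_treatment k \<eta> n (x \<omega>) (t \<omega>)} \<in> sets N"
proof -
  have s: "(\<lambda>\<omega>. treatment_score k n (x \<omega>) (t \<omega>)) \<in> borel_measurable N"
    unfolding treatment_score_def
    by (rule R.weighted_residual_measurable_joint, rule borel_measurable_const,
        intro borel_measurable_inner covariate_measurable[OF x] borel_measurable_const, assumption,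
        erule coordinate_measurable[OF t R.sets_law], erule component_covariate_measurable[OF x])
  show ?thesis
    unfolding bad_treatment_def
    by (intro sets.sets_Collect_conj sets.sets_Collect_finite_All borel_measurable_le borel_measurable_less
        borel_measurable_abs borel_measurable_const component_covariate_measurable[OF x] s) auto
qed

lemma prob_bad_treatment:
  assumes n: "0 < n" and \<eta>: "0 < \<eta>" and M: "sym_mat n (M n)" "bounded_matrix n (M n) K"
  shows "prob {\<omega> \<in> space P. bad_treatment k \<eta> n (X n \<omega>) (T n \<omega>)} \<le> score_rate K \<eta> n"
proof (rule prob_le_if_nn_integral_indicator_le)
  have K: "0 \<le> K" using M by (simp add: bounded_matrix_def)
  then show "0 \<le> score_rate K \<eta> n" by (rule score_rate_nonneg)
  let ?g = "\<lambda>x t. if bad_treatment k \<eta> n x t then 1 else 0 :: ennreal"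
  have "{p \<in> space (LX n \<Otimes>\<^sub>M LT n). bad_treatment k \<eta> n (fst p) (snd p)} \<in> sets (LX n \<Otimes>\<^sub>M LT n)"
    by (rule bad_treatment_measurable) measurable
  then have g: "(\<lambda>(x, t). ?g x t) \<in> borel_measurable (LX n \<Otimes>\<^sub>M LT n)"
    unfolding case_prod_beta' by (intro measurable_If) auto
  have "(\<integral>\<^sup>+\<omega>. indicator {\<omega> \<in> space P. bad_treatment k \<eta> n (X n \<omega>) (T n \<omega>)} \<omega> \<partial>P)
     = (\<integral>\<^sup>+\<omega>. ?g (X n \<omega>) (T n \<omega>) \<partial>P)"
    by (rule nn_integral_cong) (simp add: indicator_def)
  also have "\<dots> = (\<integral>\<^sup>+x. \<integral>\<^sup>+t. ennreal (density_T n x t) * ?g x t \<partial>LT n \<partial>LX n)"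
    by (rule nn_integral_sample_design[where g = ?g, OF g])
  also have "\<dots> \<le> ennreal (score_rate K \<eta> n)"
  proof (rule nn_integral_prob_le[OF prob_spaces(2)])
    fix x
    show "(\<integral>\<^sup>+t. ennreal (density_T n x t) * ?g x t \<partial>LT n) \<le> ennreal (score_rate K \<eta> n)"
    proof (cases "\<forall>i<n. \<bar>x i $ k\<bar> \<le> 1")
      case True
      have "(\<integral>\<^sup>+t. ennreal (density_T n x t) * ?g x t \<partial>LT n) \<le>
          (\<integral>\<^sup>+t. ennreal (density_T n x t) * indicator {t. \<eta> * real n < \<bar>treatment_score k n x t\<bar>} t \<partial>LT n)"
        by (intro nn_integral_mono mult_left_mono) (auto simp: bad_treatment_def indicator_def)
      also have "\<dots> \<le> ennreal (score_rate K \<eta> n)"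
        unfolding treatment_density_eq treatment_score_def
        by (rule R.gibbs_residual_tail) (use True n \<eta> K M bounded_matrix_frobenius[OF M(2)] in \<open>auto simp: mult.commute\<close>)
      finally show ?thesis .
    next
      case False
      then have "?g x t = 0" for t by (auto simp: bad_treatment_def)
      then show ?thesis by simp
    qed
  qed
  finally show "(\<integral>\<^sup>+\<omega>. indicator {\<omega> \<in> space P. bad_treatment k \<eta> n (X n \<omega>) (T n \<omega>)} \<omega> \<partial>P) \<le> ennreal (score_rate K \<eta> n)" .
qed (rule bad_treatment_measurable[OF sample_measurable(1,2)])

definition bad_covariates :: "'d \<times> 'd \<Rightarrow> real \<Rightarrow> nat \<Rightarrow> (nat \<Rightarrow> real ^ 'd) \<Rightarrow> bool" where
  "bad_covariates p \<eta> n x \<longleftrightarrow> \<eta> * real n < \<bar>\<Sum>i<n. x i $ fst p * x i $ snd p - second_moment PX (fst p) (snd p)\<bar>"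

lemma bad_covariates_measurable:
  assumes x: "x \<in> measurable N (LX n)"
  shows "{\<omega> \<in> space N. bad_covariates p \<eta> n (x \<omega>)} \<in> sets N"
  unfolding bad_covariates_def
  by (intro borel_measurable_less borel_measurable_abs borel_measurable_const borel_measurable_sum borel_measurable_diff
      borel_measurable_times component_covariate_measurable[OF x]) auto

lemma prob_bad_covariates:
  assumes n: "0 < n" and \<eta>: "0 < \<eta>"
  shows "prob {\<omega> \<in> space P. bad_covariates p \<eta> n (X n \<omega>)} \<le> score_rate 0 \<eta> n"
proof (rule prob_le_if_nn_integral_indicator_le)
  let ?f = "\<lambda>x :: real ^ 'd. x $ fst p * x $ snd p"
  let ?R = "\<lambda>x. \<Sum>i<n. ?f (x i) - second_moment PX (fst p) (snd p)"
  let ?g = "\<lambda>x. if bad_covariates p \<eta> n x then 1 else 0 :: ennreal"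
  have fm: "?f \<in> borel_measurable PX" by (simp add: measurable_cong_sets[OF covariate_lawD(2)[OF PX] refl])
  have f1: "AE x in PX. \<bar>?f x\<bar> \<le> 1"
    using covariate_lawD(3)[OF PX]
  proof eventually_elim
    case (elim x)
    then show ?case using abs_mult_bound[of "x $ fst p" 1 "x $ snd p" 1] by simp
  qed
  note sm = second_moment_iid_sum[OF PX.prob_space_axioms fm f1, where n = n, folded second_moment_def]
  have pos: "0 < (\<eta> * real n)\<^sup>2" using n \<eta> by simp
  have "{x \<in> space (LX n). bad_covariates p \<eta> n x} \<in> sets (LX n)" by (rule bad_covariates_measurable) measurable
  then have g: "?g \<in> borel_measurable (LX n)" by (intro measurable_If) auto
  have "(\<integral>\<^sup>+\<omega>. indicator {\<omega> \<in> space P. bad_covariates p \<eta> n (X n \<omega>)} \<omega> \<partial>P) = (\<integral>\<^sup>+\<omega>. ?g (X n \<omega>) \<partial>P)"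
    by (rule nn_integral_cong) (simp add: indicator_def)
  also have "\<dots> = (\<integral>\<^sup>+x. ?g x \<partial>LX n)" by (rule nn_integral_sample_covariates[OF g])
  also have "\<dots> \<le> (\<integral>\<^sup>+x. ennreal ((?R x)\<^sup>2 / (\<eta> * real n)\<^sup>2) \<partial>LX n)"
  proof (rule nn_integral_mono)
    fix x
    show "?g x \<le> ennreal ((?R x)\<^sup>2 / (\<eta> * real n)\<^sup>2)"
    proof (cases "bad_covariates p \<eta> n x")
      case True
      then have "\<bar>\<eta> * real n\<bar> \<le> \<bar>?R x\<bar>" using n \<eta> by (simp add: bad_covariates_def)
      then have "(\<eta> * real n)\<^sup>2 \<le> (?R x)\<^sup>2" by (simp only: abs_le_square_iff)
      then have "1 \<le> (?R x)\<^sup>2 / (\<eta> * real n)\<^sup>2" using pos by (simp add: pos_le_divide_eq)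
      then show ?thesis using True by (simp add: ennreal_leI flip: ennreal_1)
    qed simp
  qed
  also have "\<dots> = ennreal (\<integral>x. (?R x)\<^sup>2 / (\<eta> * real n)\<^sup>2 \<partial>LX n)"
    by (rule nn_integral_eq_integral) (use sm(1) in auto)
  also have "\<dots> \<le> ennreal (score_rate 0 \<eta> n)"
    using sm(2) by (intro ennreal_leI) (simp add: score_rate_def divide_right_mono)
  finally show "(\<integral>\<^sup>+\<omega>. indicator {\<omega> \<in> space P. bad_covariates p \<eta> n (X n \<omega>)} \<omega> \<partial>P) \<le> ennreal (score_rate 0 \<eta> n)" .
qed (rule bad_covariates_measurable[OF sample_measurable(1)], rule score_rate_nonneg, simp)

text \<open>Outside finitely many events of vanishing probability, the sample satisfies the deterministic conditions
  for a unique maximiser close to the true parameter.\<close>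

theorem estimator_consistent:
  assumes B: "0 \<le> B" and c: "0 < c" and p0: "(\<tau>0, \<theta>0) \<in> param_space B M0" and \<gamma>: "\<gamma>0 \<in> coef_box M0"
    and M: "\<And>n. sym_mat n (M n)" "\<And>n. bounded_matrix n (M n) KM"
    and A: "\<And>n \<omega>. \<omega> \<in> space P \<Longrightarrow> sym_mat n (A n \<omega>)"
    and KA: "AE \<omega> in P. \<forall>\<^sub>F n in sequentially. bounded_matrix n (A n \<omega>) KA"
    and mpl: "is_mpl P \<mu> B M0 A X T Y \<tau>h \<theta>h" and \<delta>: "0 < \<delta>"
  shows "(\<lambda>n. prob {\<omega> \<in> space P. \<delta> < dist (\<tau>h n \<omega>, \<theta>h n \<omega>) (\<tau>0, \<theta>0)}) \<longlonglongrightarrow> 0"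
proof -
  let ?d = "real CARD('d)"
  define H where "H = B + ?d * (?d * M0)"
  define k1 where "k1 = design_curvature KM H"
  have k1: "0 < k1" by (simp add: k1_def design_curvature_def)
  define \<kappa>0 where "\<kappa>0 = min (k1 / 4) (k1 * c / 8)"
  have \<kappa>0: "\<kappa>0 \<le> design_curvature KM H / 4" "\<kappa>0 \<le> design_curvature KM H * c / 8" "0 < \<kappa>0"
    using k1 c by (auto simp: \<kappa>0_def k1_def)
  \<comment> \<open>The tolerance that keeps the design nondegenerate with constant \<open>\<kappa>\<close>.\<close>
  define \<eta>1 where "\<eta>1 = \<kappa>0 / (4 * ?d\<^sup>2)"
  have \<eta>1: "0 < \<eta>1" "4 * ?d\<^sup>2 * \<eta>1 \<le> \<kappa>0" using \<kappa>0 by (auto simp: \<eta>1_def)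
  define \<kappa> where "\<kappa> = \<kappa>0 / 4"
  have \<kappa>: "0 < \<kappa>" using \<kappa>0 by (simp add: \<kappa>_def)
  \<comment> \<open>Local fields above \<open>L\<close> are so rare that removing their sites costs at most half of \<open>\<kappa>\<close>.\<close>
  define L where "L = sqrt (4 * ?d\<^sup>2 * (4 * KA\<^sup>2) / \<kappa>) + 1"
  have L: "0 < L" "4 * ?d\<^sup>2 * (4 * KA\<^sup>2) \<le> \<kappa> * L\<^sup>2"
  proof -
    have s0: "0 \<le> sqrt (4 * ?d\<^sup>2 * (4 * KA\<^sup>2) / \<kappa>)" using \<kappa> by simp
    show "0 < L" unfolding L_def by (rule add_nonneg_pos[OF s0]) simp
    have "4 * ?d\<^sup>2 * (4 * KA\<^sup>2) / \<kappa> = (sqrt (4 * ?d\<^sup>2 * (4 * KA\<^sup>2) / \<kappa>))\<^sup>2" using \<kappa> by simp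
    also have "\<dots> \<le> L\<^sup>2" using s0 by (intro power_mono) (auto simp: L_def)
    finally show "4 * ?d\<^sup>2 * (4 * KA\<^sup>2) \<le> \<kappa> * L\<^sup>2" using \<kappa> by (simp add: field_simps)
  qed
  have V: "0 < alpha_d2 \<mu> 0 0" by (rule base_measure_variance_pos[OF base])
  define k0 where "k0 = exp (- 2 * (L + (B + ?d * (?d * M0))) - KA) * alpha_d2 \<mu> 0 0"
  have k0: "0 < k0" using V by (simp add: k0_def)
  \<comment> \<open>The size of the gradient for which the bound on the distance of the maximiser equals \<open>\<delta>\<close>.\<close>
  define \<eta>2 where "\<eta>2 = \<delta> * (k0 * \<kappa> / 4) / (1 + ?d)"
  have \<eta>2: "0 < \<eta>2" using \<delta> k0 \<kappa> by (simp add: \<eta>2_def add_pos_nonneg)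
  have \<eta>2': "(1 + ?d) * \<eta>2 / (k0 * \<kappa> / 4) = \<delta>"
  proof -
    have "1 + ?d \<noteq> 0" by (metis add_pos_nonneg less_irrefl of_nat_0_le_iff zero_less_one)
    moreover have "e \<noteq> 0 \<Longrightarrow> q \<noteq> 0 \<Longrightarrow> e * (\<delta> * q / e) / q = \<delta>" for e q :: real by simp
    moreover have "k0 * \<kappa> / 4 \<noteq> 0" using k0 \<kappa> by simp
    ultimately show ?thesis unfolding \<eta>2_def by blast
  qed
  define S1 where "S1 w n = {\<omega> \<in> space P. bad_outcome w KA \<eta>2 n (A n \<omega>) (X n \<omega>) (T n \<omega>) (Y n \<omega>)}" for w n
  define S2 where "S2 k n = {\<omega> \<in> space P. bad_treatment k \<eta>1 n (X n \<omega>) (T n \<omega>)}" for k n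
  define S3 where "S3 p n = {\<omega> \<in> space P. bad_covariates p \<eta>1 n (X n \<omega>)}" for p n
  define D where "D n = (\<Union>w. S1 w n) \<union> ((\<Union>k. S2 k n) \<union> (\<Union>p. S3 p n))" for n
  have S: "S1 w n \<in> events" "S2 k n \<in> events" "S3 p n \<in> events" for w k p n
    unfolding S1_def S2_def S3_def
    by (rule bad_outcome_measurable[OF A_measurable sample_measurable(1-3)] bad_treatment_measurable[OF sample_measurable(1,2)]
        bad_covariates_measurable[OF sample_measurable(1)])+
  have D: "D n \<in> events" for n unfolding D_def using S by (intro sets.Un sets.finite_UN) auto
  have "AE \<omega> in P. 0 \<le> KA" using KA by eventually_elim (auto simp: bounded_matrix_def dest: eventually_happens)
  then have KA0: "0 \<le> KA" by simp
  define rate where "rate n = real CARD('d option) * score_rate KA \<eta>2 n + (?d * score_rate KM \<eta>1 n + real CARD('d \<times> 'd) * score_rate 0 \<eta>1 n)" for n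
  have rate: "rate \<longlonglongrightarrow> real CARD('d option) * 0 + (?d * 0 + real CARD('d \<times> 'd) * 0)"
    unfolding rate_def by (intro tendsto_intros score_rate_tendsto)
  have le: "prob (D n) \<le> rate n" if n: "0 < n" for n
  proof -
    have "prob (D n) \<le> prob (\<Union>w. S1 w n) + (prob (\<Union>k. S2 k n) + prob (\<Union>p. S3 p n))"
      unfolding D_def using S
      by (intro order_trans[OF measure_Un_le] add_left_mono measure_Un_le sets.Un sets.finite_UN) auto
    also have "\<dots> \<le> (\<Sum>w\<in>UNIV. prob (S1 w n)) + ((\<Sum>k\<in>UNIV. prob (S2 k n)) + (\<Sum>p\<in>UNIV. prob (S3 p n)))"
      using S by (intro add_mono finite_measure_subadditive_finite) auto
    also have "\<dots> \<le> (\<Sum>w\<in>(UNIV :: 'd option set). score_rate KA \<eta>2 n) + ((\<Sum>k\<in>(UNIV :: 'd set). score_rate KM \<eta>1 n) + (\<Sum>p\<in>(UNIV :: ('d \<times> 'd) set). score_rate 0 \<eta>1 n))"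
      unfolding S1_def S2_def S3_def
      by (intro add_mono sum_mono prob_bad_outcome prob_bad_treatment prob_bad_covariates n \<eta>1 \<eta>2 KA0 M)
    finally show ?thesis by (simp add: rate_def)
  qed
  have D0: "(\<lambda>n. prob (D n)) \<longlonglongrightarrow> 0"
    by (rule tendsto_sandwich[OF _ _ tendsto_const rate[simplified]])
      (use le in \<open>auto simp: eventually_sequentially intro!: exI[of _ 1]\<close>)
  show ?thesis
  proof (rule measure_tendsto_0_if_eventually[OF D D0])
    have "AE \<omega> in P. \<forall>n. (\<forall>i<n. \<forall>k. \<bar>X n \<omega> i $ k\<bar> \<le> 1) \<and> (\<forall>i<n. T n \<omega> i = 1 \<or> T n \<omega> i = -1) \<and> (\<forall>i<n. \<bar>Y n \<omega> i\<bar> \<le> 1)"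
      unfolding AE_all_countable using AE_sample by (auto elim!: eventually_mono)
    then show "AE \<omega> in P. \<forall>\<^sub>F n in sequentially.
       \<omega> \<in> {\<omega> \<in> space P. \<delta> < dist (\<tau>h n \<omega>, \<theta>h n \<omega>) (\<tau>0, \<theta>0)} \<longrightarrow> \<omega> \<in> D n"
      using KA
    proof eventually_elim
      case (elim \<omega>)
      show ?case using elim(2) eventually_gt_at_top[of 0]
      proof eventually_elim
        case (elim n)
        note An = elim(1) and n = elim(2)
        show ?case
        proof (intro impI, rule ccontr)
          assume w: "\<omega> \<in> {\<omega> \<in> space P. \<delta> < dist (\<tau>h n \<omega>, \<theta>h n \<omega>) (\<tau>0, \<theta>0)}" and nD: "\<omega> \<notin> D n"
          then have sp: "\<omega> \<in> space P" and far: "\<delta> < dist (\<tau>h n \<omega>, \<theta>h n \<omega>) (\<tau>0, \<theta>0)" by auto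
          have x: "\<forall>i<n. \<forall>k. \<bar>X n \<omega> i $ k\<bar> \<le> 1" and t: "\<forall>i<n. T n \<omega> i = 1 \<or> T n \<omega> i = -1" and y: "\<forall>i<n. \<bar>Y n \<omega> i\<bar> \<le> 1"
            using \<open>\<forall>n. (\<forall>i<n. \<forall>k. \<bar>X n \<omega> i $ k\<bar> \<le> 1) \<and> (\<forall>i<n. T n \<omega> i = 1 \<or> T n \<omega> i = -1) \<and> (\<forall>i<n. \<bar>Y n \<omega> i\<bar> \<le> 1)\<close> by auto
          have t1: "\<forall>i<n. \<bar>T n \<omega> i\<bar> \<le> 1" using t by auto
          have h: "\<forall>i<n. \<bar>X n \<omega> i \<bullet> \<gamma>0\<bar> \<le> H"
          proof (intro allI impI)
            fix i assume "i < n"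
            then show "\<bar>X n \<omega> i \<bullet> \<gamma>0\<bar> \<le> H"
              using abs_design_row_param_le[of "\<lambda>_. 0" i "X n \<omega>" "(0, \<gamma>0)" B M0] x \<gamma> B
              by (simp add: design_row_def H_def param_space_def)
          qed
          have treat: "\<bar>\<Sum>i<n. X n \<omega> i $ k * R.residual n (M n) (\<lambda>i. X n \<omega> i \<bullet> \<gamma>0) (T n \<omega>) i\<bar> \<le> \<eta>1 * real n" for k
            using nD sp x unfolding D_def S2_def bad_treatment_def treatment_score_def by (auto simp: not_less)
          have cov: "\<bar>(\<Sum>i<n. X n \<omega> i $ k * X n \<omega> i $ l - second_moment PX k l)\<bar> \<le> \<eta>1 * real n" for k l
          proof -
            have "\<omega> \<notin> S3 (k, l) n" using nD unfolding D_def by blast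
            then show ?thesis using sp unfolding S3_def bad_covariates_def by (simp add: not_less)
          qed
          have nondeg: "design_nondegenerate n (T n \<omega>) (X n \<omega>) \<kappa>"
            unfolding \<kappa>_def
            by (rule design_nondegenerate_if[OF t M(2) h treat cov second_moment_pos[OF PX] c \<kappa>0 \<eta>1(2)]) (use \<eta>1 in simp)
          have score: "\<bar>\<Sum>i<n. weight w (T n \<omega>) (X n \<omega>) i * U.residual n (A n \<omega>) (\<lambda>i. design_row (T n \<omega>) (X n \<omega>) i (\<tau>0, \<theta>0)) (Y n \<omega>) i\<bar> \<le> \<eta>2 * real n" for w
          proof -
            have "\<omega> \<notin> S1 w n" using nD unfolding D_def by blast
            moreover have "\<forall>i\<in>{..<n}. \<forall>j\<in>{..<n}. A n \<omega> i j = A n \<omega> j i" using A[OF sp] by (simp add: sym_mat_def)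
            moreover have "(\<Sum>i<n. \<Sum>j<n. (A n \<omega> i j)\<^sup>2) \<le> KA\<^sup>2 * real n" using bounded_matrix_frobenius[OF An] by (simp add: mult.commute)
            moreover have "\<forall>i\<in>{..<n}. \<bar>weight w (T n \<omega>) (X n \<omega>) i\<bar> \<le> 1" using t1 x by (auto simp: weight_def split: option.split)
            ultimately show ?thesis using sp unfolding S1_def bad_outcome_def outcome_score_def design_row_def by (auto simp: not_less)
          qed
          have diag: "\<forall>i<n. \<bar>A n \<omega> i i\<bar> \<le> KA" using bounded_matrix_entry[OF An] by auto
          note max = U.pseudo_likelihood_maximiser[OF n A[OF sp] V t1 x diag local_field_square_sum_le[OF An y] \<kappa> nondeg L p0
              score[of None, unfolded weight_def, simplified] score[of "Some _", unfolded weight_def, simplified], folded k0_def]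
          have "\<exists>!p. is_arg_max (pseudo_likelihood \<mu> n (A n \<omega>) (T n \<omega>) (X n \<omega>) (Y n \<omega>)) (\<lambda>p. p \<in> param_space B M0) p"
            by (rule max(1))
          then have "is_arg_max (pseudo_likelihood \<mu> n (A n \<omega>) (T n \<omega>) (X n \<omega>) (Y n \<omega>)) (\<lambda>p. p \<in> param_space B M0) (\<tau>h n \<omega>, \<theta>h n \<omega>)"
            using mpl sp unfolding is_mpl_def Let_def by blast
          from max(2)[OF this] show False using far unfolding \<eta>2' by simp
        qed
      qed
    qed
  qed
qed

end

section \<open>The scale of the Gaussian matrix\<close>

text \<open>The squared norm \<open>S\<close> of the first row has mean near 1 and bounded second moment, so it exceeds \<open>1/4\<close>
  with a probability bounded away from 0; hence a norm bound on \<open>\<beta> G\<^sub>n\<close> bounds \<open>\<beta>\<close>.  The numbers come from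
  \<open>S \<le> 1/4 + S\<^sup>2/24 + 6\<cdot>1(S > 1/4)\<close>.\<close>

lemma (in prob_space) gaussian_matrix_scale_le:
  assumes G: "\<And>n. gaussian_matrix M n (G n)" and \<beta>: "0 < \<beta>"
    and A: "\<And>n \<omega> i j. \<omega> \<in> space M \<Longrightarrow> i < n \<Longrightarrow> j < n \<Longrightarrow> A n \<omega> i j = \<beta> * G n \<omega> i j"
    and bd: "AE \<omega> in M. \<forall>\<^sub>F n in sequentially. bounded_matrix n (A n \<omega>) \<kappa>"
  shows "\<beta> \<le> 2 * \<kappa>"
proof (rule ccontr)
  assume neg: "\<not> \<beta> \<le> 2 * \<kappa>"
  have "AE \<omega> in M. 0 \<le> \<kappa>" using bd by eventually_elim (auto simp: bounded_matrix_def dest: eventually_happens)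
  then have \<kappa>: "0 \<le> \<kappa>" by simp
  have ratio: "(\<kappa> / \<beta>)\<^sup>2 \<le> 1/4"
  proof -
    have "\<kappa> / \<beta> \<le> 1/2" using neg \<beta> by (simp add: field_simps)
    then have "(\<kappa> / \<beta>)\<^sup>2 \<le> (1/2)\<^sup>2" using \<kappa> \<beta> by (intro power_mono) auto
    then show ?thesis by (simp add: power2_eq_square)
  qed
  define S where "S n \<omega> = (\<Sum>j\<in>{1..<n}. (G n \<omega> 0 j)\<^sup>2)" for n \<omega>
  define D where "D n = {\<omega> \<in> space M. 1/4 < S n \<omega>}" for n
  have dist: "distributed M lborel (\<lambda>\<omega>. G n \<omega> 0 j) (normal_density 0 (sqrt (1 / real n)))" if "j \<in> {1..<n}" for n j
    using G[of n] that unfolding gaussian_matrix_def by auto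
  have meas [measurable]: "(\<lambda>\<omega>. G n \<omega> 0 j) \<in> borel_measurable M" if "j \<in> {1..<n}" for n j
    using distributed_measurable[OF dist[OF that]] by simp
  have Sm: "S n \<in> borel_measurable M" for n
    unfolding S_def by (intro borel_measurable_sum borel_measurable_power meas)
  have D: "D n \<in> events" for n unfolding D_def using Sm by measurable
  have mom: "integrable M (\<lambda>\<omega>. (G n \<omega> 0 j) ^ (2 * k))"
    "expectation (\<lambda>\<omega>. (G n \<omega> 0 j) ^ (2 * k)) = fact (2 * k) / ((2 * real n) ^ k * fact k)"
    if "j \<in> {1..<n}" for n j k
  proof -
    have n: "0 < real n" using that by auto
    have "has_bochner_integral lborel (\<lambda>x. normal_density 0 (sqrt (1 / real n)) x * (x - 0) ^ (2 * k)) (fact (2 * k) / ((2 / (sqrt (1 / real n))\<^sup>2) ^ k * fact k))"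
      by (rule normal_moment_even) (use n in simp)
    then have h: "has_bochner_integral lborel (\<lambda>x. normal_density 0 (sqrt (1 / real n)) x * x ^ (2 * k)) (fact (2 * k) / ((2 * real n) ^ k * fact k))"
      using n by simp
    show "integrable M (\<lambda>\<omega>. (G n \<omega> 0 j) ^ (2 * k))"
      using distributed_integrable[OF dist[OF that], of "\<lambda>x. x ^ (2 * k)"] h by (simp add: has_bochner_integral_iff)
    show "expectation (\<lambda>\<omega>. (G n \<omega> 0 j) ^ (2 * k)) = fact (2 * k) / ((2 * real n) ^ k * fact k)"
      using distributed_integral[OF dist[OF that], of "\<lambda>x. x ^ (2 * k)"] h by (simp add: has_bochner_integral_iff)
  qed
  have m2: "integrable M (\<lambda>\<omega>. (G n \<omega> 0 j)\<^sup>2)" "expectation (\<lambda>\<omega>. (G n \<omega> 0 j)\<^sup>2) = 1 / real n"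
    and m4: "integrable M (\<lambda>\<omega>. (G n \<omega> 0 j) ^ 4)" "expectation (\<lambda>\<omega>. (G n \<omega> 0 j) ^ 4) = 3 / (real n)\<^sup>2"
    if "j \<in> {1..<n}" for n j
    using mom[OF that, of 1] mom[OF that, of 2] by (auto simp: fact_numeral power2_eq_square)
  have lower: "1/48 \<le> prob (D n)" if n: "2 \<le> n" for n
  proof -
    have iS: "integrable M (S n)" unfolding S_def using m2(1) by (intro Bochner_Integration.integrable_sum)
    have "expectation (S n) = (\<Sum>j\<in>{1..<n}. 1 / real n)"
      unfolding S_def using m2 by (subst Bochner_Integration.integral_sum) auto
    also have "\<dots> = (real n - 1) / real n" using n by (simp add: of_nat_diff)
    also have "\<dots> \<ge> 1/2" using n by (simp add: field_simps)
    finally have ES: "1/2 \<le> expectation (S n)" .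
    have S2: "(S n \<omega>)\<^sup>2 \<le> (\<Sum>j\<in>{1..<n}. real n * (G n \<omega> 0 j) ^ 4)" for \<omega>
    proof -
      have "(S n \<omega>)\<^sup>2 \<le> (\<Sum>j\<in>{1..<n}. 1\<^sup>2) * (\<Sum>j\<in>{1..<n}. ((G n \<omega> 0 j)\<^sup>2)\<^sup>2)"
        using Cauchy_Schwarz_ineq_sum[of "\<lambda>_. 1" "\<lambda>j. (G n \<omega> 0 j)\<^sup>2" "{1..<n}"] by (simp add: S_def)
      also have "\<dots> \<le> real n * (\<Sum>j\<in>{1..<n}. ((G n \<omega> 0 j)\<^sup>2)\<^sup>2)"
        by (intro mult_right_mono sum_nonneg) auto
      finally show ?thesis by (simp add: sum_distrib_left power_mult[symmetric])
    qed
    have i4: "integrable M (\<lambda>\<omega>. \<Sum>j\<in>{1..<n}. real n * (G n \<omega> 0 j) ^ 4)"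
      using m4(1) by (intro Bochner_Integration.integrable_sum integrable_mult_right)
    have E4: "expectation (\<lambda>\<omega>. \<Sum>j\<in>{1..<n}. real n * (G n \<omega> 0 j) ^ 4) \<le> 3"
    proof -
      have "expectation (\<lambda>\<omega>. \<Sum>j\<in>{1..<n}. real n * (G n \<omega> 0 j) ^ 4) = (\<Sum>j\<in>{1..<n}. 3 / real n)"
        using m4 n by (subst Bochner_Integration.integral_sum) (auto simp: power2_eq_square)
      also have "\<dots> \<le> 3" using n by (simp add: field_simps of_nat_diff)
      finally show ?thesis .
    qed
    have "expectation (S n) \<le> expectation (\<lambda>\<omega>. 1/4 + (\<Sum>j\<in>{1..<n}. real n * (G n \<omega> 0 j) ^ 4) / 24 + 6 * indicator (D n) \<omega>)"
    proof (rule integral_mono[OF iS])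
      show "integrable M (\<lambda>\<omega>. 1/4 + (\<Sum>j\<in>{1..<n}. real n * (G n \<omega> 0 j) ^ 4) / 24 + 6 * indicator (D n) \<omega>)"
        using i4 D by (intro Bochner_Integration.integrable_add) (auto simp: integrable_indicator_iff emeasure_eq_measure)
      fix \<omega> assume w: "\<omega> \<in> space M"
      have "S n \<omega> \<le> (S n \<omega>)\<^sup>2 / 24 + 6"
        using zero_le_power2[of "S n \<omega> - 12"] by (simp add: power2_diff)
      then have "S n \<omega> \<le> 1/4 + (S n \<omega>)\<^sup>2 / 24 + 6 * indicator (D n) \<omega>"
      proof (cases "\<omega> \<in> D n")
        case False
        then have "S n \<omega> \<le> 1/4" using w by (simp add: D_def)
        then show ?thesis using False by (simp add: add_increasing2)
      qed simp
      then show "S n \<omega> \<le> 1/4 + (\<Sum>j\<in>{1..<n}. real n * (G n \<omega> 0 j) ^ 4) / 24 + 6 * indicator (D n) \<omega>"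
        using S2[of \<omega>] by linarith
    qed
    also have "\<dots> = 1/4 + expectation (\<lambda>\<omega>. \<Sum>j\<in>{1..<n}. real n * (G n \<omega> 0 j) ^ 4) / 24 + 6 * prob (D n)"
      using i4 D[of n] by (simp add: prob_space integrable_indicator_iff emeasure_eq_measure sets.Int_space_eq2)
    finally show ?thesis using ES E4 by linarith
  qed
  have "(\<lambda>n. measure M (D n)) \<longlonglongrightarrow> 0"
  proof (rule measure_tendsto_0_if_eventually[where D = "\<lambda>_. {}"])
    show "AE \<omega> in M. \<forall>\<^sub>F n in sequentially. \<omega> \<in> D n \<longrightarrow> \<omega> \<in> {}"
      using bd AE_space
    proof eventually_elim
      case (elim \<omega>)
      note w = elim(2)
      show ?case using elim(1)
      proof eventually_elim
        case (elim n)
        have "S n \<omega> \<le> 1/4"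
        proof (cases "n = 0")
          case False
          have "bounded_matrix n (G n \<omega>) (\<kappa> / \<beta>)"
            by (rule bounded_matrix_rescale[OF elim _ \<beta>]) (use A[OF w] in auto)
          then have "(\<Sum>i<n. (G n \<omega> i 0)\<^sup>2) \<le> (\<kappa> / \<beta>)\<^sup>2" by (rule bounded_matrix_column) (use False in simp)
          moreover have "S n \<omega> \<le> (\<Sum>i<n. (G n \<omega> i 0)\<^sup>2)"
          proof -
            have sym: "G n \<omega> 0 j = G n \<omega> j 0" if "j < n" for j
              using G[of n] w that False unfolding gaussian_matrix_def sym_mat_def by auto
            have "S n \<omega> = (\<Sum>j\<in>{1..<n}. (G n \<omega> j 0)\<^sup>2)" unfolding S_def by (intro sum.cong refl) (simp add: sym)
            also have "\<dots> \<le> (\<Sum>i<n. (G n \<omega> i 0)\<^sup>2)" by (intro sum_mono2) auto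
            finally show ?thesis .
          qed
          ultimately show ?thesis using ratio by linarith
        qed (simp add: S_def)
        then show ?case by (simp add: D_def)
      qed
    qed
  qed auto
  then have "\<forall>\<^sub>F n in sequentially. measure M (D n) < 1/48" by (rule order_tendstoD) simp
  then obtain n where "2 \<le> n" "measure M (D n) < 1/48"
    unfolding eventually_sequentially by (metis le_add1 le_add2)
  with lower[of n] show False by simp
qed

section \<open>Stability of the reported effects\<close>

context interval_law
begin

lemma ext_field_diff_le:
  fixes xb :: "nat \<Rightarrow> real ^ 'd"
  assumes "\<forall>i<n. \<bar>tb i\<bar> \<le> 1" "\<forall>i<n. \<forall>k. \<bar>xb i $ k\<bar> \<le> 1"
  shows "\<forall>i<n. \<bar>ext_field \<tau> \<theta> tb xb i - ext_field \<tau>' \<theta>' tb xb i\<bar> \<le> field_dist (\<tau>, \<theta>) (\<tau>', \<theta>')"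
  using assms field_diff_le unfolding ext_field_def by blast

lemma alg1_stable:
  fixes xb :: "nat \<Rightarrow> real ^ 'd" and \<kappa> :: real and K :: nat
  assumes A: "bounded_matrix n A \<kappa>" and tb: "\<forall>i<n. \<bar>tb i\<bar> \<le> 1" and xb: "\<forall>i<n. \<forall>k. \<bar>xb i $ k\<bar> \<le> 1"
    and \<delta>: "field_dist (\<tau>, \<theta>) (\<tau>', \<theta>') \<le> \<delta>" "0 \<le> \<delta>"
  defines "L \<equiv> ((\<lambda>L. \<kappa> * L + 1) ^^ K) 0"
  shows "\<bar>DE_alg1 \<nu> n A tb xb K \<tau> \<theta> - DE_alg1 \<nu> n A tb xb K \<tau>' \<theta>'\<bar> \<le> 2 * (L * \<delta>)"
    and "\<bar>IE_alg1 \<nu> n A tb xb K \<tau> \<theta> - IE_alg1 \<nu> n A tb xb K \<tau>' \<theta>'\<bar> \<le> 3 * (L * \<delta>)"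
proof -
  have L0: "0 \<le> ((\<lambda>L. \<kappa> * L + 1) ^^ K) 0" using A by (induction K) (auto simp: bounded_matrix_def)
  have it: "L2_set (\<lambda>i. mf_iter \<nu> n A (ext_field \<tau> \<theta> t xb) K i - mf_iter \<nu> n A (ext_field \<tau>' \<theta>' t xb) K i) {..<n} \<le> L * \<delta> * sqrt (real n)"
    if "\<forall>i<n. \<bar>t i\<bar> \<le> 1" for t
  proof -
    have "\<forall>i<n. \<bar>ext_field \<tau> \<theta> t xb i - ext_field \<tau>' \<theta>' t xb i\<bar> \<le> \<delta>"
      using ext_field_diff_le[OF that xb, of \<tau> \<theta> \<tau>' \<theta>'] \<delta>(1) by (meson order_trans)
    from mf_iter_stable[OF A this, of K] show ?thesis using \<delta>(2) by (simp add: L_def mult_ac)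
  qed
  have ctrl: "\<forall>i<n. \<bar>(\<lambda>_. -1 :: real) i\<bar> \<le> 1" by simp
  have pos: "0 \<le> L * \<delta>" using L0 \<delta>(2) by (simp add: L_def)
  show "\<bar>DE_alg1 \<nu> n A tb xb K \<tau> \<theta> - DE_alg1 \<nu> n A tb xb K \<tau>' \<theta>'\<bar> \<le> 2 * (L * \<delta>)"
    unfolding DE_alg1_def by (rule DE_of_diff_le[OF tb it[OF tb] pos])
  show "\<bar>IE_alg1 \<nu> n A tb xb K \<tau> \<theta> - IE_alg1 \<nu> n A tb xb K \<tau>' \<theta>'\<bar> \<le> 3 * (L * \<delta>)"
    unfolding IE_alg1_def by (rule IE_of_diff_le[OF tb it[OF tb] it[OF ctrl] pos])
qed

text \<open>The state evolution enters through \<open>\<surd>q\<close>, which is only a square-root function of the parameter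
  error when \<open>q\<close> may vanish; hence the quadratic relation between the parameter error and \<open>r\<close>.\<close>

lemma alg2_stable:
  fixes PX :: "(real ^ 'd) measure"
  assumes PX: "covariate_law c C PX" and \<beta>: "0 \<le> \<beta>" "\<beta> \<le> 1/8" and \<kappa>: "0 \<le> \<kappa>"
  obtains L where "0 \<le> L"
    "\<And>n G tb xb \<tau> \<theta> \<tau>' \<theta>' r. bounded_matrix n G \<kappa> \<Longrightarrow> \<forall>i<n. \<bar>tb i\<bar> \<le> 1 \<Longrightarrow> \<forall>i<n. \<forall>k. \<bar>xb i $ k\<bar> \<le> 1 \<Longrightarrow>
       field_dist (\<tau>, \<theta>) (\<tau>', \<theta>') \<le> r\<^sup>2 / 24 \<Longrightarrow> 0 \<le> r \<Longrightarrow> r \<le> 1 \<Longrightarrow>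
       \<bar>DE_alg2 \<nu> PX n \<beta> G tb xb K \<tau> \<theta> - DE_alg2 \<nu> PX n \<beta> G tb xb K \<tau>' \<theta>'\<bar> \<le> 2 * (L * r) \<and>
       \<bar>IE_alg2 \<nu> PX n \<beta> G tb xb K \<tau> \<theta> - IE_alg2 \<nu> PX n \<beta> G tb xb K \<tau>' \<theta>'\<bar> \<le> 3 * (L * r)"
proof -
  obtain L where L: "0 \<le> L" "\<And>n G p p' h h' \<delta>. bounded_matrix n G \<kappa> \<Longrightarrow> \<bar>sqrt (fst p) - sqrt (fst p')\<bar> \<le> \<delta> \<Longrightarrow>
     \<bar>snd p - snd p'\<bar> \<le> \<delta> \<Longrightarrow> (\<forall>i<n. \<bar>h i - h' i\<bar> \<le> \<delta>) \<Longrightarrow>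
     L2_set (\<lambda>i. amp_output \<nu> n \<beta> G p h K i - amp_output \<nu> n \<beta> G p' h' K i) {..<n} \<le> L * \<delta> * sqrt (real n)"
    using amp_output_stable[OF \<beta>(1) \<kappa>, of K] by blast
  show ?thesis
  proof (rule that[OF L(1)])
    fix n :: nat and G and tb :: "nat \<Rightarrow> real" and xb :: "nat \<Rightarrow> real ^ 'd" and \<tau> \<tau>' r :: real and \<theta> \<theta>' :: "real ^ 'd"
    assume G: "bounded_matrix n G \<kappa>" and tb: "\<forall>i<n. \<bar>tb i\<bar> \<le> 1" and xb: "\<forall>i<n. \<forall>k. \<bar>xb i $ k\<bar> \<le> 1"
      and d: "field_dist (\<tau>, \<theta>) (\<tau>', \<theta>') \<le> r\<^sup>2 / 24" and r: "0 \<le> r" "r \<le> 1"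
    let ?\<delta> = "field_dist (\<tau>, \<theta>) (\<tau>', \<theta>')"
    have rr: "r\<^sup>2 \<le> r" using r by (simp add: power2_eq_square mult_left_le_one_le)
    have "sqrt (24 * ?\<delta>) \<le> sqrt (r\<^sup>2)" using d by (intro real_sqrt_le_mono) simp
    then have s: "sqrt (24 * ?\<delta>) \<le> r" using r by simp
    have s': "24 * ?\<delta> \<le> r" "?\<delta> \<le> r" using d rr r by auto
    have b: "\<bar>\<beta>\<bar> \<le> 1/8" using \<beta> by simp
    note fp = fp_solution_field_stable[OF PX b, of \<tau> \<theta> \<tau>' \<theta>']
    have h: "\<forall>i<n. \<bar>ext_field \<tau> \<theta> t xb i - ext_field \<tau>' \<theta>' t xb i\<bar> \<le> r" if "\<forall>i<n. \<bar>t i\<bar> \<le> 1" for t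
      using ext_field_diff_le[OF that xb, of \<tau> \<theta> \<tau>' \<theta>'] s'(2) by (meson order_trans)
    have u: "L2_set (\<lambda>i. amp_output \<nu> n \<beta> G (fp_solution \<nu> \<beta> (field_law PX \<tau> \<theta>)) (ext_field \<tau> \<theta> tb xb) K i
        - amp_output \<nu> n \<beta> G (fp_solution \<nu> \<beta> (field_law PX \<tau>' \<theta>')) (ext_field \<tau>' \<theta>' tb xb) K i) {..<n} \<le> L * r * sqrt (real n)"
      by (rule L(2)[OF G order_trans[OF fp(1) s] order_trans[OF fp(2) s'(1)] h[OF tb]])
    have v: "L2_set (\<lambda>i. amp_output \<nu> n \<beta> G (fp_solution \<nu> \<beta> (field_law_control PX \<tau> \<theta>)) (ext_field \<tau> \<theta> (\<lambda>_. -1) xb) K i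
        - amp_output \<nu> n \<beta> G (fp_solution \<nu> \<beta> (field_law_control PX \<tau>' \<theta>')) (ext_field \<tau>' \<theta>' (\<lambda>_. -1) xb) K i) {..<n} \<le> L * r * sqrt (real n)"
      by (rule L(2)[OF G order_trans[OF fp(3) s] order_trans[OF fp(4) s'(1)] h]) simp
    have pos: "0 \<le> L * r" using L(1) r by simp
    show "\<bar>DE_alg2 \<nu> PX n \<beta> G tb xb K \<tau> \<theta> - DE_alg2 \<nu> PX n \<beta> G tb xb K \<tau>' \<theta>'\<bar> \<le> 2 * (L * r) \<and>
       \<bar>IE_alg2 \<nu> PX n \<beta> G tb xb K \<tau> \<theta> - IE_alg2 \<nu> PX n \<beta> G tb xb K \<tau>' \<theta>'\<bar> \<le> 3 * (L * r)"
      unfolding DE_alg2_def IE_alg2_def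
      by (intro conjI DE_of_diff_le[OF tb u pos] IE_of_diff_le[OF tb u v pos])
  qed
qed

end

lemma field_dist_le_dist: "field_dist p p' \<le> (1 + real CARD('d)) * dist p' p" for p p' :: "real \<times> (real ^ 'd)"
proof -
  have "\<bar>fst p - fst p'\<bar> \<le> dist p' p" using dist_fst_le[of p p'] by (simp add: dist_real_def dist_commute)
  moreover have "real CARD('d) * norm (snd p - snd p') \<le> real CARD('d) * dist p' p"
    using dist_snd_le[of p p'] by (intro mult_left_mono) (simp_all add: dist_norm norm_minus_commute)
  ultimately have "field_dist p p' \<le> dist p' p + real CARD('d) * dist p' p" unfolding field_dist_def by (rule add_mono)
  then show ?thesis by (simp add: distrib_right)
qed

lemma AE_eventually_mono:
  assumes "AE \<omega> in N. \<forall>\<^sub>F n in F. Q \<omega> n" and "\<And>\<omega> n. Q \<omega> n \<Longrightarrow> R \<omega> n"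
  shows "AE \<omega> in N. \<forall>\<^sub>F n in F. R \<omega> n"
  using assms(1) by (rule AE_mp) (auto intro!: AE_I2 elim!: eventually_mono assms(2))

text \<open>Convergence in probability passes from the estimator to an output whose modulus of continuity in the
  parameter is, almost surely, the same for all large \<open>n\<close>.\<close>

lemma (in prob_space) output_consistent:
  fixes \<theta>h :: "nat \<Rightarrow> 'a \<Rightarrow> real ^ 'd"
  assumes [measurable]: "\<And>n. \<tau>h n \<in> borel_measurable M" "\<And>n. \<theta>h n \<in> borel_measurable M"
    and consistent: "\<And>\<delta>. 0 < \<delta> \<Longrightarrow> (\<lambda>n. prob {\<omega> \<in> space M. \<delta> < dist (\<tau>h n \<omega>, \<theta>h n \<omega>) (\<tau>0, \<theta>0)}) \<longlonglongrightarrow> 0"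
    and L: "0 \<le> L"
    and stable: "\<And>r. 0 < r \<Longrightarrow> r \<le> 1 \<Longrightarrow> AE \<omega> in M. \<forall>\<^sub>F n in sequentially.
        field_dist (\<tau>0, \<theta>0) (\<tau>h n \<omega>, \<theta>h n \<omega>) \<le> r\<^sup>2 / 24 \<longrightarrow> \<bar>F n \<omega>\<bar> \<le> L * r"
    and \<epsilon>: "0 < \<epsilon>"
  shows "(\<lambda>n. measure M {\<omega> \<in> space M. \<bar>F n \<omega>\<bar> > \<epsilon>}) \<longlonglongrightarrow> 0"
proof -
  define r where "r = min 1 (\<epsilon> / (L + 1))"
  have r: "0 < r" "r \<le> 1" using \<epsilon> L by (auto simp: r_def)
  have "L * r \<le> L * (\<epsilon> / (L + 1))" using L by (intro mult_left_mono) (auto simp: r_def)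
  also have "\<dots> \<le> \<epsilon>" using L \<epsilon> by (simp add: field_simps)
  finally have Lr: "L * r \<le> \<epsilon>" .
  have d: "0 < 1 + real CARD('d)" by (simp add: add_pos_nonneg)
  define \<delta> where "\<delta> = r\<^sup>2 / 24 / (1 + real CARD('d))"
  have \<delta>: "0 < \<delta>" using r d by (simp add: \<delta>_def)
  show ?thesis
  proof (rule measure_tendsto_0_if_eventually[OF _ consistent[OF \<delta>]])
    show "{\<omega> \<in> space M. \<delta> < dist (\<tau>h n \<omega>, \<theta>h n \<omega>) (\<tau>0, \<theta>0)} \<in> events" for n
      unfolding dist_Pair_Pair by measurable
    show "AE \<omega> in M. \<forall>\<^sub>F n in sequentially. \<omega> \<in> {\<omega> \<in> space M. \<bar>F n \<omega>\<bar> > \<epsilon>} \<longrightarrow>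
       \<omega> \<in> {\<omega> \<in> space M. \<delta> < dist (\<tau>h n \<omega>, \<theta>h n \<omega>) (\<tau>0, \<theta>0)}"
      using stable[OF r]
    proof eventually_elim
      case (elim \<omega>)
      then show ?case
      proof eventually_elim
        case (elim n)
        show ?case
        proof (rule impI, rule ccontr)
          assume w: "\<omega> \<in> {\<omega> \<in> space M. \<bar>F n \<omega>\<bar> > \<epsilon>}" and "\<omega> \<notin> {\<omega> \<in> space M. \<delta> < dist (\<tau>h n \<omega>, \<theta>h n \<omega>) (\<tau>0, \<theta>0)}"
          then have "dist (\<tau>h n \<omega>, \<theta>h n \<omega>) (\<tau>0, \<theta>0) \<le> \<delta>" by auto
          then have "(1 + real CARD('d)) * dist (\<tau>h n \<omega>, \<theta>h n \<omega>) (\<tau>0, \<theta>0) \<le> (1 + real CARD('d)) * \<delta>"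
            using d by (intro mult_left_mono) auto
          moreover have "(1 + real CARD('d)) * \<delta> = r\<^sup>2 / 24"
          proof -
            have "e * (q / e) = q" if "0 < e" for e q :: real using that by simp
            from this[OF d] show ?thesis unfolding \<delta>_def .
          qed
          ultimately have "field_dist (\<tau>0, \<theta>0) (\<tau>h n \<omega>, \<theta>h n \<omega>) \<le> r\<^sup>2 / 24"
            using field_dist_le_dist[of "(\<tau>0, \<theta>0)" "(\<tau>h n \<omega>, \<theta>h n \<omega>)"] by linarith
          then show False using elim w Lr by auto
        qed
      qed
    qed
  qed
qed

theorem lemma2p4:
  fixes \<mu> :: "real measure" and PX :: "(real ^ 'd) measure" and B M0 c C :: real
  assumes "B > 0" and "M0 > 0" and "0 < c" and "c \<le> C"
    and "base_measure \<mu>" and "covariate_law c C PX"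
  shows "\<exists>C0>0. \<forall>(P :: 'w measure) M \<gamma>0 \<tau>0 \<theta>0 A X T Y Tb Xb \<tau>h \<theta>h.
     (\<tau>0, \<theta>0) \<in> param_space B M0 \<longrightarrow> \<gamma>0 \<in> coef_box M0 \<longrightarrow>
     (\<forall>n. sym_mat n (M n)) \<longrightarrow> bdd_above (range (\<lambda>n. op_norm n (M n))) \<longrightarrow>
     interference_model P \<mu> PX M \<gamma>0 \<tau>0 \<theta>0 A X T Y Tb Xb \<longrightarrow>
     (\<forall>n. \<forall>\<omega>\<in>space P. sym_mat n (A n \<omega>)) \<longrightarrow>
     (AE \<omega> in P. bdd_above (range (\<lambda>n. op_norm n (A n \<omega>)))) \<longrightarrow>
     (AE \<omega> in P. limsup (\<lambda>n. ereal (op_norm n (A n \<omega>))) \<le> ereal C0) \<longrightarrow>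
     is_mpl P \<mu> B M0 A X T Y \<tau>h \<theta>h \<longrightarrow>
     (\<forall>K\<ge>1. \<forall>\<epsilon>>0.
        (\<lambda>n. \<P>(\<omega> in P. \<bar>DE_alg1 \<mu> n (A n \<omega>) (Tb n \<omega>) (Xb n \<omega>) K \<tau>0 \<theta>0 -
                        DE_alg1 \<mu> n (A n \<omega>) (Tb n \<omega>) (Xb n \<omega>) K (\<tau>h n \<omega>) (\<theta>h n \<omega>)\<bar> > \<epsilon>)) \<longlonglongrightarrow> 0 \<and>
        (\<lambda>n. \<P>(\<omega> in P. \<bar>IE_alg1 \<mu> n (A n \<omega>) (Tb n \<omega>) (Xb n \<omega>) K \<tau>0 \<theta>0 -
                        IE_alg1 \<mu> n (A n \<omega>) (Tb n \<omega>) (Xb n \<omega>) K (\<tau>h n \<omega>) (\<theta>h n \<omega>)\<bar> > \<epsilon>)) \<longlonglongrightarrow> 0) \<and>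
     (\<forall>\<beta>>0. \<forall>G.
        (\<forall>n. gaussian_matrix P n (G n) \<and> (\<forall>\<omega>\<in>space P. \<forall>i<n. \<forall>j<n. A n \<omega> i j = \<beta> * G n \<omega> i j)) \<longrightarrow>
        (\<forall>K\<ge>1. \<forall>\<epsilon>>0.
        (\<lambda>n. \<P>(\<omega> in P. \<bar>DE_alg2 \<mu> PX n \<beta> (G n \<omega>) (Tb n \<omega>) (Xb n \<omega>) K \<tau>0 \<theta>0 -
                        DE_alg2 \<mu> PX n \<beta> (G n \<omega>) (Tb n \<omega>) (Xb n \<omega>) K (\<tau>h n \<omega>) (\<theta>h n \<omega>)\<bar> > \<epsilon>)) \<longlonglongrightarrow> 0 \<and>
        (\<lambda>n. \<P>(\<omega> in P. \<bar>IE_alg2 \<mu> PX n \<beta> (G n \<omega>) (Tb n \<omega>) (Xb n \<omega>) K \<tau>0 \<theta>0 -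
                        IE_alg2 \<mu> PX n \<beta> (G n \<omega>) (Tb n \<omega>) (Xb n \<omega>) K (\<tau>h n \<omega>) (\<theta>h n \<omega>)\<bar> > \<epsilon>)) \<longlonglongrightarrow> 0))"
  \<comment> \<open>With \<open>1/32\<close> the norm of \<open>A\<^sub>n\<close> is eventually below \<open>1/16\<close>, which forces \<open>\<beta> \<le> 1/8\<close>, the range where the
    fixed-point system is a contraction.\<close>
proof (intro exI[of _ "1/32 :: real"] conjI allI impI)
  show "(0::real) < 1/32" by simp
  fix P :: "'w measure" and M \<gamma>0 \<tau>0 \<theta>0 A X T Y Tb Xb \<tau>h \<theta>h
  assume p0: "(\<tau>0, \<theta>0) \<in> param_space B M0" and \<gamma>: "\<gamma>0 \<in> coef_box M0"
    and symM: "\<forall>n. sym_mat n (M n)" and bddM: "bdd_above (range (\<lambda>n. op_norm n (M n)))"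
    and model: "interference_model P \<mu> PX M \<gamma>0 \<tau>0 \<theta>0 A X T Y Tb Xb"
    and symA: "\<forall>n. \<forall>\<omega>\<in>space P. sym_mat n (A n \<omega>)"
    and lim: "AE \<omega> in P. limsup (\<lambda>n. ereal (op_norm n (A n \<omega>))) \<le> ereal (1/32)"
    and mpl: "is_mpl P \<mu> B M0 A X T Y \<tau>h \<theta>h"
  interpret interference P \<mu> PX c C M \<gamma>0 \<tau>0 \<theta>0 A X T Y Tb Xb
    using assms model by unfold_locales
  obtain KM where "\<And>n. op_norm n (M n) \<le> KM" using bddM by (auto simp: bdd_above_def)
  then have KM: "bounded_matrix n (M n) KM" for n by (rule bounded_matrix_op_norm)
  define \<kappa> :: real where "\<kappa> = 1/16"
  have bA: "AE \<omega> in P. \<forall>\<^sub>F n in sequentially. bounded_matrix n (A n \<omega>) \<kappa>"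
    using lim
  proof eventually_elim
    case (elim \<omega>)
    also have "ereal (1/32) < ereal \<kappa>" by (simp add: \<kappa>_def)
    finally have "\<forall>\<^sub>F n in sequentially. ereal (op_norm n (A n \<omega>)) < ereal \<kappa>" by (rule Limsup_lessD)
    then show ?case by eventually_elim (auto intro: bounded_matrix_op_norm)
  qed
  have hm: "\<tau>h n \<in> borel_measurable P" "\<theta>h n \<in> borel_measurable P" for n
    using mpl by (auto simp: is_mpl_def)
  have cons: "(\<lambda>n. prob {\<omega> \<in> space P. \<delta> < dist (\<tau>h n \<omega>, \<theta>h n \<omega>) (\<tau>0, \<theta>0)}) \<longlonglongrightarrow> 0" if "0 < \<delta>" for \<delta>
    by (rule estimator_consistent[OF _ _ p0 \<gamma> _ KM _ bA mpl that]) (use assms symM symA in auto)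
  have fresh: "AE \<omega> in P. \<forall>n. (\<forall>i<n. \<bar>Tb n \<omega> i\<bar> \<le> 1) \<and> (\<forall>i<n. \<forall>k. \<bar>Xb n \<omega> i $ k\<bar> \<le> 1)"
    unfolding AE_all_countable using AE_sample by (auto elim!: eventually_mono)
  {
    fix K :: nat and \<epsilon> :: real assume \<epsilon>: "\<epsilon> > 0"
    let ?DE1 = "\<lambda>n \<omega>. DE_alg1 \<mu> n (A n \<omega>) (Tb n \<omega>) (Xb n \<omega>) K \<tau>0 \<theta>0 -
        DE_alg1 \<mu> n (A n \<omega>) (Tb n \<omega>) (Xb n \<omega>) K (\<tau>h n \<omega>) (\<theta>h n \<omega>)"
    let ?IE1 = "\<lambda>n \<omega>. IE_alg1 \<mu> n (A n \<omega>) (Tb n \<omega>) (Xb n \<omega>) K \<tau>0 \<theta>0 -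
        IE_alg1 \<mu> n (A n \<omega>) (Tb n \<omega>) (Xb n \<omega>) K (\<tau>h n \<omega>) (\<theta>h n \<omega>)"
    define L where "L = ((\<lambda>L. \<kappa> * L + 1) ^^ K) (0::real)"
    have L: "0 \<le> L" unfolding L_def by (induction K) (auto simp: \<kappa>_def)
    have st: "AE \<omega> in P. \<forall>\<^sub>F n in sequentially. field_dist (\<tau>0, \<theta>0) (\<tau>h n \<omega>, \<theta>h n \<omega>) \<le> r\<^sup>2 / 24 \<longrightarrow>
        \<bar>?DE1 n \<omega>\<bar> \<le> (2 * L) * r \<and>
        \<bar>?IE1 n \<omega>\<bar> \<le> (3 * L) * r"
      if r: "0 < r" "r \<le> 1" for r
      using bA fresh
    proof eventually_elim
      case (elim \<omega>)
      note fr = elim(2)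
      have r24: "r\<^sup>2 / 24 \<le> r" using r mult_left_le_one_le[of r r] unfolding power2_eq_square by simp
      show ?case using elim(1)
      proof eventually_elim
        case (elim n)
        show ?case
        proof (rule impI)
          assume "field_dist (\<tau>0, \<theta>0) (\<tau>h n \<omega>, \<theta>h n \<omega>) \<le> r\<^sup>2 / 24"
          then have d: "field_dist (\<tau>0, \<theta>0) (\<tau>h n \<omega>, \<theta>h n \<omega>) \<le> r" using r24 by simp
          from U.alg1_stable[OF elim _ _ d, of "Tb n \<omega>" "Xb n \<omega>" K] fr r
          show "\<bar>?DE1 n \<omega>\<bar> \<le> (2 * L) * r \<and>
            \<bar>?IE1 n \<omega>\<bar> \<le> (3 * L) * r"
            by (simp add: L_def)
        qed
      qed
    qed
    show "(\<lambda>n. \<P>(\<omega> in P. \<bar>?DE1 n \<omega>\<bar> > \<epsilon>)) \<longlonglongrightarrow> 0"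
      by (rule output_consistent[OF hm _ _ _ \<epsilon>, where L = "2 * L"], erule cons)
        ((use L in \<open>simp\<close>), rule AE_eventually_mono[OF st], assumption, assumption, blast)
    show "(\<lambda>n. \<P>(\<omega> in P. \<bar>?IE1 n \<omega>\<bar> > \<epsilon>)) \<longlonglongrightarrow> 0"
      by (rule output_consistent[OF hm _ _ _ \<epsilon>, where L = "3 * L"], erule cons)
        ((use L in \<open>simp\<close>), rule AE_eventually_mono[OF st], assumption, assumption, blast)
  }
  fix \<beta> :: real and G
  assume \<beta>: "\<beta> > 0" and G: "\<forall>n. gaussian_matrix P n (G n) \<and> (\<forall>\<omega>\<in>space P. \<forall>i<n. \<forall>j<n. A n \<omega> i j = \<beta> * G n \<omega> i j)"
  fix K :: nat and \<epsilon> :: real assume \<epsilon>: "\<epsilon> > 0"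
  let ?DE2 = "\<lambda>n \<omega>. DE_alg2 \<mu> PX n \<beta> (G n \<omega>) (Tb n \<omega>) (Xb n \<omega>) K \<tau>0 \<theta>0 -
      DE_alg2 \<mu> PX n \<beta> (G n \<omega>) (Tb n \<omega>) (Xb n \<omega>) K (\<tau>h n \<omega>) (\<theta>h n \<omega>)"
  let ?IE2 = "\<lambda>n \<omega>. IE_alg2 \<mu> PX n \<beta> (G n \<omega>) (Tb n \<omega>) (Xb n \<omega>) K \<tau>0 \<theta>0 -
      IE_alg2 \<mu> PX n \<beta> (G n \<omega>) (Tb n \<omega>) (Xb n \<omega>) K (\<tau>h n \<omega>) (\<theta>h n \<omega>)"
  have "\<beta> \<le> 2 * \<kappa>" by (rule gaussian_matrix_scale_le[OF _ \<beta> _ bA, of G]) (use G in auto)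
  then have \<beta>8: "\<beta> \<le> 1/8" by (simp add: \<kappa>_def)
  have \<kappa>\<beta>: "0 \<le> \<kappa> / \<beta>" using \<beta> by (simp add: \<kappa>_def)
  obtain L where L: "0 \<le> L" and stable: "\<And>n G tb xb \<tau> \<theta> \<tau>' \<theta>' r. bounded_matrix n G (\<kappa> / \<beta>) \<Longrightarrow> \<forall>i<n. \<bar>tb i\<bar> \<le> 1 \<Longrightarrow> \<forall>i<n. \<forall>k. \<bar>xb i $ k\<bar> \<le> 1 \<Longrightarrow>
       field_dist (\<tau>, \<theta>) (\<tau>', \<theta>') \<le> r\<^sup>2 / 24 \<Longrightarrow> 0 \<le> r \<Longrightarrow> r \<le> 1 \<Longrightarrow>
       \<bar>DE_alg2 \<mu> PX n \<beta> G tb xb K \<tau> \<theta> - DE_alg2 \<mu> PX n \<beta> G tb xb K \<tau>' \<theta>'\<bar> \<le> 2 * (L * r) \<and>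
       \<bar>IE_alg2 \<mu> PX n \<beta> G tb xb K \<tau> \<theta> - IE_alg2 \<mu> PX n \<beta> G tb xb K \<tau>' \<theta>'\<bar> \<le> 3 * (L * r)"
    using U.alg2_stable[OF assms(6) less_imp_le[OF \<beta>] \<beta>8 \<kappa>\<beta>, of K] by blast
  have st: "AE \<omega> in P. \<forall>\<^sub>F n in sequentially. field_dist (\<tau>0, \<theta>0) (\<tau>h n \<omega>, \<theta>h n \<omega>) \<le> r\<^sup>2 / 24 \<longrightarrow>
        \<bar>?DE2 n \<omega>\<bar> \<le> (2 * L) * r \<and>
        \<bar>?IE2 n \<omega>\<bar> \<le> (3 * L) * r"
    if r: "0 < r" "r \<le> 1" for r
    using bA fresh AE_space
  proof eventually_elim
    case (elim \<omega>)
    note fr = elim(2) and sp = elim(3)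
    show ?case using elim(1)
    proof eventually_elim
      case (elim n)
      have "bounded_matrix n (G n \<omega>) (\<kappa> / \<beta>)"
        by (rule bounded_matrix_rescale[OF elim _ \<beta>]) (use G sp in auto)
      from stable[OF this, of "Tb n \<omega>" "Xb n \<omega>" \<tau>0 \<theta>0 "\<tau>h n \<omega>" "\<theta>h n \<omega>" r] show ?case using fr r by (auto simp: mult.assoc)
    qed
  qed
  show "(\<lambda>n. \<P>(\<omega> in P. \<bar>?DE2 n \<omega>\<bar> > \<epsilon>)) \<longlonglongrightarrow> 0"
    by (rule output_consistent[OF hm _ _ _ \<epsilon>, where L = "2 * L"], erule cons)
        ((use L in \<open>simp\<close>), rule AE_eventually_mono[OF st], assumption, assumption, blast)
  show "(\<lambda>n. \<P>(\<omega> in P. \<bar>?IE2 n \<omega>\<bar> > \<epsilon>)) \<longlonglongrightarrow> 0"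
    by (rule output_consistent[OF hm _ _ _ \<epsilon>, where L = "3 * L"], erule cons)
        ((use L in \<open>simp\<close>), rule AE_eventually_mono[OF st], assumption, assumption, blast)
qed

end
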